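(* Let $\Omega\subseteq\mathbb{R}^N$, $N\ge 2$, be a bounded domain with Lipschitz boundary, let $p,q\in C_+(\overline\Omega)$ with $p(x)\le q(x)<p^*(x)$ for all $x\in\overline\Omega$, and let $0\le\mu\in L^\infty(\Omega)$. Then $W^{1,\mathcal{H}_{\log}}(\Omega)\hookrightarrow L^{\mathcal{H}_{\log}}(\Omega)$ is a compact embedding and there exists a constant $C>0$ such that $$\|u\|_{\mathcal{H}_{\log}}\le C\|\nabla u\|_{\mathcal{H}_{\log}}\quad\text{for all }u\in W^{1,\mathcal{H}_{\log}}_0(\Omega).$$
   Context: $C_+(\overline\Omega)$ is the set of $r\in C(\overline\Omega)$ with $\min_{\overline\Omega}r>1$. $p^*(x)=\frac{Np(x)}{N-p(x)}$ if $p(x)<N$ and $p^*(x)=+\infty$ if $p(x)\ge N$. Let $\mathcal{H}_{\log}(x,t)=t^{p(x)}+\mu(x)t^{q(x)}\log(e+t)$ for $x\in\overline\Omega$, $t\ge0$. For measurable $u$ set $\varrho_{\mathcal{H}_{\log}}(u)=\int_\Omega\mathcal{H}_{\log}(x,|u|)\,dx$; $L^{\mathcal{H}_{\log}}(\Omega)$ is the space of measurable $u:\Omega\to\mathbb{R}$ with $\varrho_{\mathcal{H}_{\log}}(u)<\infty$, with norm $\|u\|_{\mathcal{H}_{\log}}=\inf\{\lambda>0:\varrho_{\mathcal{H}_{\log}}(u/\lambda)\le1\}$, and $\|\nabla u\|_{\mathcal{H}_{\log}}=\|\,|\nabla u|\,\|_{\mathcal{H}_{\log}}$. $W^{1,\mathcal{H}_{\log}}(\Omega)=\{u\in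 L^{\mathcal{H}_{\log}}(\Omega): |\nabla u|\in L^{\mathcal{H}_{\log}}(\Omega)\}$ with norm $\|u\|_{1,\mathcal{H}_{\log}}=\inf\{\lambda>0:\varrho_{\mathcal{H}_{\log}}(u/\lambda)+\varrho_{\mathcal{H}_{\log}}(|\nabla u|/\lambda)\le1\}$, and $W^{1,\mathcal{H}_{\log}}_0(\Omega)$ is the closure of $C_0^\infty(\Omega)$ in it. *)

theory Defs
  imports "HOL-Analysis.Analysis"
begin

text \<open>
  The space \<open>\<real>\<^sup>N\<close> is an arbitrary type \<open>'a\<close> of class \<open>euclidean_space\<close>, with \<open>N = DIM('a)\<close>.
  Elements of function spaces are represented by functions on all of \<open>'a\<close>, of which only the
  values on \<open>\<Omega>\<close> (on its closure, for the exponents) matter; functions that agree almost everywhere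
  on \<open>\<Omega>\<close> are not identified, so the norms below vanish exactly on the functions that are zero
  almost everywhere.
\<close>

section \<open>Bounded Lipschitz domains\<close>

text \<open>
  Near each boundary point, \<open>\<Omega>\<close> is the part of a ball lying strictly above the graph of a Lipschitz
  function \<open>\<gamma>\<close>, in Cartesian coordinates with last axis \<open>e\<close>: the last coordinate of \<open>x\<close> is \<open>x \<bullet> e\<close>,
  and its first \<open>N - 1\<close> coordinates are given by the projection of \<open>x\<close> onto the hyperplane
  orthogonal to \<open>e\<close>.
\<close>

definition lipschitz_boundary :: "'a::euclidean_space set \<Rightarrow> bool" where
  "lipschitz_boundary \<Omega> \<longleftrightarrow>
    (\<forall>x0\<in>frontier \<Omega>. \<exists>e r L. \<exists>\<gamma>::'a \<Rightarrow> real.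
       norm e = 1 \<and> r > 0 \<and> L-lipschitz_on {y. y \<bullet> e = 0} \<gamma> \<and>
       \<Omega> \<inter> ball x0 r = {x \<in> ball x0 r. \<gamma> (x - (x \<bullet> e) *\<^sub>R e) < x \<bullet> e})"

definition bounded_lipschitz_domain :: "'a::euclidean_space set \<Rightarrow> bool" where
  "bounded_lipschitz_domain \<Omega> \<longleftrightarrow>
    open \<Omega> \<and> connected \<Omega> \<and> \<Omega> \<noteq> {} \<and> bounded \<Omega> \<and> lipschitz_boundary \<Omega>"

section \<open>Exponents and weight\<close>

text \<open>For bounded nonempty \<open>\<Omega>\<close> the closure is compact, so the infimum is a minimum.\<close>

definition C_plus :: "'a::euclidean_space set \<Rightarrow> ('a \<Rightarrow> real) set" where
  "C_plus D = {r. continuous_on D r \<and> (INF x\<in>D. r x) > 1}"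

definition crit_exponent :: "('a::euclidean_space \<Rightarrow> real) \<Rightarrow> 'a \<Rightarrow> ereal" where
  "crit_exponent p x =
    (if p x < real DIM('a) then ereal (real DIM('a) * p x / (real DIM('a) - p x)) else \<infinity>)"

definition L_infty :: "'a::euclidean_space set \<Rightarrow> ('a \<Rightarrow> real) set" where
  "L_infty \<Omega> = {f \<in> borel_measurable (lebesgue_on \<Omega>). \<exists>M. AE x in lebesgue_on \<Omega>. \<bar>f x\<bar> \<le> M}"

section \<open>The Musielak--Orlicz space\<close>

definition H_log ::
  "('a \<Rightarrow> real) \<Rightarrow> ('a \<Rightarrow> real) \<Rightarrow> ('a \<Rightarrow> real) \<Rightarrow> 'a \<Rightarrow> real \<Rightarrow> real" where
  "H_log p q \<mu> x t = t powr p x + \<mu> x * t powr q x * ln (exp 1 + t)"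

definition modular_H ::
  "'a::euclidean_space set \<Rightarrow> ('a \<Rightarrow> real) \<Rightarrow> ('a \<Rightarrow> real) \<Rightarrow> ('a \<Rightarrow> real) \<Rightarrow> ('a \<Rightarrow> real) \<Rightarrow> ennreal"
  where
  "modular_H \<Omega> p q \<mu> u = (\<integral>\<^sup>+x. ennreal (H_log p q \<mu> x \<bar>u x\<bar>) \<partial>lebesgue_on \<Omega>)"

definition L_H ::
  "'a::euclidean_space set \<Rightarrow> ('a \<Rightarrow> real) \<Rightarrow> ('a \<Rightarrow> real) \<Rightarrow> ('a \<Rightarrow> real) \<Rightarrow> ('a \<Rightarrow> real) set" where
  "L_H \<Omega> p q \<mu> = {u \<in> borel_measurable (lebesgue_on \<Omega>). modular_H \<Omega> p q \<mu> u < \<infinity>}"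

definition norm_H ::
  "'a::euclidean_space set \<Rightarrow> ('a \<Rightarrow> real) \<Rightarrow> ('a \<Rightarrow> real) \<Rightarrow> ('a \<Rightarrow> real) \<Rightarrow> ('a \<Rightarrow> real) \<Rightarrow> real" where
  "norm_H \<Omega> p q \<mu> u = Inf {l::real. l > 0 \<and> modular_H \<Omega> p q \<mu> (\<lambda>x. u x / l) \<le> 1}"

section \<open>Test functions and weak gradients\<close>

definition partial_deriv :: "'a::euclidean_space \<Rightarrow> ('a \<Rightarrow> real) \<Rightarrow> 'a \<Rightarrow> real" where
  "partial_deriv b f x = frechet_derivative f (at x) b"

fun C_k :: "nat \<Rightarrow> ('a::euclidean_space \<Rightarrow> real) \<Rightarrow> bool" where
  "C_k 0 f \<longleftrightarrow> continuous_on UNIV f"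
| "C_k (Suc k) f \<longleftrightarrow> (\<forall>x. f differentiable (at x)) \<and> (\<forall>b\<in>Basis. C_k k (partial_deriv b f))"

text \<open>Test functions on \<open>\<Omega>\<close> are taken extended by zero to the whole space.\<close>

definition test_functions :: "'a::euclidean_space set \<Rightarrow> ('a \<Rightarrow> real) set" where
  "test_functions \<Omega> =
    {\<phi>. (\<forall>k. C_k k \<phi>) \<and> compact (closure {x. \<phi> x \<noteq> 0}) \<and> closure {x. \<phi> x \<noteq> 0} \<subseteq> \<Omega>}"

definition locally_integrable ::
  "'a::euclidean_space set \<Rightarrow> ('a \<Rightarrow> 'b::euclidean_space) \<Rightarrow> bool" where
  "locally_integrable \<Omega> f \<longleftrightarrow> (\<forall>K. compact K \<and> K \<subseteq> \<Omega> \<longrightarrow> integrable (lebesgue_on K) f)"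

definition has_weak_gradient ::
  "'a::euclidean_space set \<Rightarrow> ('a \<Rightarrow> real) \<Rightarrow> ('a \<Rightarrow> 'a) \<Rightarrow> bool" where
  "has_weak_gradient \<Omega> u g \<longleftrightarrow>
    locally_integrable \<Omega> u \<and> locally_integrable \<Omega> g \<and>
    (\<forall>\<phi>\<in>test_functions \<Omega>. \<forall>b\<in>Basis.
       (\<integral>x. u x * partial_deriv b \<phi> x \<partial>lebesgue_on \<Omega>) = - (\<integral>x. (g x \<bullet> b) * \<phi> x \<partial>lebesgue_on \<Omega>))"

text \<open>The weak gradient is unique only up to null sets; a representative is chosen.\<close>

definition weak_gradient :: "'a::euclidean_space set \<Rightarrow> ('a \<Rightarrow> real) \<Rightarrow> 'a \<Rightarrow> 'a" where
  "weak_gradient \<Omega> u = (SOME g. has_weak_gradient \<Omega> u g)"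

section \<open>The Musielak--Orlicz Sobolev spaces\<close>

definition W1_H ::
  "'a::euclidean_space set \<Rightarrow> ('a \<Rightarrow> real) \<Rightarrow> ('a \<Rightarrow> real) \<Rightarrow> ('a \<Rightarrow> real) \<Rightarrow> ('a \<Rightarrow> real) set" where
  "W1_H \<Omega> p q \<mu> =
    {u \<in> L_H \<Omega> p q \<mu>. (\<exists>g. has_weak_gradient \<Omega> u g) \<and>
       (\<lambda>x. norm (weak_gradient \<Omega> u x)) \<in> L_H \<Omega> p q \<mu>}"

definition norm_W1_H ::
  "'a::euclidean_space set \<Rightarrow> ('a \<Rightarrow> real) \<Rightarrow> ('a \<Rightarrow> real) \<Rightarrow> ('a \<Rightarrow> real) \<Rightarrow> ('a \<Rightarrow> real) \<Rightarrow> real" where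
  "norm_W1_H \<Omega> p q \<mu> u =
    Inf {l::real. l > 0 \<and>
      modular_H \<Omega> p q \<mu> (\<lambda>x. u x / l) +
      modular_H \<Omega> p q \<mu> (\<lambda>x. norm (weak_gradient \<Omega> u x) / l) \<le> 1}"

definition W1_H_0 ::
  "'a::euclidean_space set \<Rightarrow> ('a \<Rightarrow> real) \<Rightarrow> ('a \<Rightarrow> real) \<Rightarrow> ('a \<Rightarrow> real) \<Rightarrow> ('a \<Rightarrow> real) set" where
  "W1_H_0 \<Omega> p q \<mu> =
    {u \<in> W1_H \<Omega> p q \<mu>. \<forall>\<epsilon>>0. \<exists>\<phi>\<in>test_functions \<Omega>. norm_W1_H \<Omega> p q \<mu> (\<lambda>x. u x - \<phi> x) < \<epsilon>}"

section \<open>Compact embeddings\<close>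

definition compact_embedding ::
  "('a \<Rightarrow> real) set \<Rightarrow> (('a \<Rightarrow> real) \<Rightarrow> real) \<Rightarrow>
   ('a \<Rightarrow> real) set \<Rightarrow> (('a \<Rightarrow> real) \<Rightarrow> real) \<Rightarrow> bool" where
  "compact_embedding X norm_X Y norm_Y \<longleftrightarrow>
    X \<subseteq> Y \<and>
    (\<exists>C>0. \<forall>u\<in>X. norm_Y u \<le> C * norm_X u) \<and>
    (\<forall>u::nat \<Rightarrow> 'a \<Rightarrow> real. (\<forall>n. u n \<in> X) \<and> (\<exists>B. \<forall>n. norm_X (u n) \<le> B) \<longrightarrow>
      (\<exists>v\<in>Y. \<exists>r. strict_mono r \<and> (\<lambda>n. norm_Y (\<lambda>x. u (r n) x - v x)) \<longlonglongrightarrow> 0))"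

end

theory Submission
  imports Defs "HOL-Complex_Analysis.Great_Picard"
begin

text \<open>
  The compactness of \<open>W\<^sup>1 \<hookrightarrow> L\<close> rests on averaging along cones. Near each point of the closure,
  \<open>\<Omega>\<close> has a uniform truncated cone: there are a unit vector \<open>e\<close> and \<open>\<rho> > 0\<close> such that
  \<open>x + s *\<^sub>R z\<close> stays in \<open>\<Omega>\<close> for all nearby \<open>x \<in> \<Omega>\<close>, all small \<open>s > 0\<close> and all \<open>z\<close> in the ball of
  radius \<open>\<rho>\<close> about \<open>e\<close> (\<open>local_cone_property\<close>). With a mollifier supported in that ball, \<open>avg e \<rho> s u x\<close>
  is the mean of \<open>u (x + s *\<^sub>R z)\<close>. It converges to \<open>u\<close> in \<open>L\<^sup>1\<close> as \<open>s\<close> tends to zero, and its derivative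
  in \<open>s\<close> is bounded by twice the average of \<open>norm (\<nabla>u)\<close>, even when only the weak gradient exists
  (\<open>avg_diff_le\<close>): the kernel's derivative in \<open>s\<close> is minus the divergence of a smooth compactly supported
  vector field.

  Integrating over \<open>0 < s \<le> \<epsilon>\<close>, an average of a function bounded in \<open>L\<^sup>p\<close> is at most of order
  \<open>s powr (- N / p)\<close> pointwise and bounded in \<open>L\<^sup>p\<close>; interpolating, the error \<open>u - avg e \<rho> \<epsilon> u\<close> is of order a positive
  power of \<open>\<epsilon>\<close> in \<open>L\<^sup>r\<close>, for every exponent \<open>r\<close> with \<open>r * (N - p) < N * p\<close>, that is, for every subcritical
  \<open>r\<close> (\<open>avg_error_Lr\<close>). For fixed \<open>\<epsilon>\<close> the averages of a bounded sequence are bounded and equicontinuous, so the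
  theorem of Arzela and Ascoli and a diagonal argument produce a subsequence that is Cauchy in \<open>L\<^sup>r\<close>
  near the given point (\<open>Lr_cauchy_subseq\<close>).

  The exponents are continuous and \<open>q < p\<^sup>*\<close> is an open condition, so finitely many pieces cover \<open>\<Omega>\<close> on each of which
  constant exponents \<open>p1 \<le> p\<close> and \<open>r > q\<close> are available with \<open>r\<close> subcritical for \<open>p1\<close>
  (\<open>good_piece_exists\<close>). The gap between \<open>q\<close> and \<open>r\<close> absorbs the logarithm, and convergence in \<open>L\<^sup>r\<close> on
  every piece gives convergence of the modular at every scale, hence in norm
  (\<open>bounded_sequence_has_convergent_subsequence\<close>).

  If the Poincare inequality failed, there would be functions in \<open>W\<^sub>0\<close> of norm one whose gradients
  tend to zero in norm. By compactness a subsequence converges in norm. The elementary Poincare inequality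
  in \<open>L\<^sup>1\<close> for test functions passes to \<open>W\<^sub>0\<close> by approximation (\<open>L1_Poincare_W1_H_0\<close>) and shows that the limit vanishes,
  contradicting that the norms are one. The chosen representative of the weak gradient is
  compatible with sums and multiples up to null sets, because weak gradients are unique almost everywhere
  (\<open>weak_gradient_AE_unique\<close>), which is again read off from averages.
\<close>

section \<open>Smooth functions and bumps\<close>

definition smooth :: "('a::euclidean_space \<Rightarrow> real) \<Rightarrow> bool" where
  "smooth f \<longleftrightarrow> (\<forall>k. C_k k f)"

lemma partial_deriv_eq:
  "(f has_derivative f') (at x) \<Longrightarrow> partial_deriv b f x = f' b"
  unfolding partial_deriv_def using frechet_derivative_at by metis

lemma C_k_Suc_D: "C_k (Suc k) f \<Longrightarrow> C_k k f"
proof (induction k arbitrary: f)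
  case 0
  then show ?case
    by (auto intro!: continuous_at_imp_continuous_on differentiable_imp_continuous_within)
next
  case (Suc k)
  then show ?case by (metis C_k.simps(2))
qed

lemma smooth_differentiable: "smooth f \<Longrightarrow> f differentiable (at x)"
  unfolding smooth_def by (metis C_k.simps(2))

lemma smooth_partial_deriv: "smooth f \<Longrightarrow> b \<in> Basis \<Longrightarrow> smooth (partial_deriv b f)"
  unfolding smooth_def by (metis C_k.simps(2))

lemma smooth_continuous_on: "smooth f \<Longrightarrow> continuous_on S f"
  unfolding smooth_def by (metis C_k.simps(1) continuous_on_subset subset_UNIV)

lemma C_k_const: "C_k k (\<lambda>x. c)"
proof (induction k arbitrary: c)
  case (Suc k)
  have "partial_deriv b (\<lambda>x. c) = (\<lambda>x. 0)" for b :: 'a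
    by (rule ext, rule partial_deriv_eq) (rule has_derivative_const)
  with Suc show ?case by simp
qed simp

lemma C_k_inner: "C_k k (\<lambda>x. x \<bullet> a)"
proof (cases k)
  case (Suc n)
  have d: "((\<lambda>x. x \<bullet> a) has_derivative (\<lambda>h. h \<bullet> a)) (at x)" for x
    by (auto intro!: derivative_eq_intros)
  have "partial_deriv b (\<lambda>x. x \<bullet> a) = (\<lambda>x. b \<bullet> a)" for b :: 'a
    by (rule ext, rule partial_deriv_eq) (rule d)
  then show ?thesis using C_k_const[of n] d by (auto simp: Suc differentiable_def)
qed (auto intro!: continuous_intros)

lemma C_k_add: "C_k k f \<Longrightarrow> C_k k g \<Longrightarrow> C_k k (\<lambda>x. f x + g x)"
proof (induction k arbitrary: f g)
  case (Suc k)
  have "partial_deriv b (\<lambda>x. f x + g x) = (\<lambda>x. partial_deriv b f x + partial_deriv b g x)" for b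
  proof
    fix x
    show "partial_deriv b (\<lambda>x. f x + g x) x = partial_deriv b f x + partial_deriv b g x"
      using Suc.prems unfolding partial_deriv_def[of b f] partial_deriv_def[of b g]
      by (intro partial_deriv_eq has_derivative_add) (auto simp: frechet_derivative_works)
  qed
  with Suc show ?case by auto
qed (auto intro!: continuous_intros)

lemma C_k_mult: "C_k k f \<Longrightarrow> C_k k g \<Longrightarrow> C_k k (\<lambda>x. f x * g x)"
proof (induction k arbitrary: f g)
  case (Suc k)
  have eq: "partial_deriv b (\<lambda>x. f x * g x)
      = (\<lambda>x. f x * partial_deriv b g x + partial_deriv b f x * g x)" for b
  proof
    fix x
    have "((\<lambda>x. f x * g x) has_derivative (\<lambda>h. f x * frechet_derivative g (at x) h
        + frechet_derivative f (at x) h * g x)) (at x)"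
      using Suc.prems by (intro has_derivative_mult) (auto simp: frechet_derivative_works)
    then show "partial_deriv b (\<lambda>x. f x * g x) x
        = f x * partial_deriv b g x + partial_deriv b f x * g x"
      by (simp add: partial_deriv_eq) (simp add: partial_deriv_def)
  qed
  have "C_k k f" "C_k k g" using Suc.prems by (blast intro: C_k_Suc_D)+
  then have "C_k k (partial_deriv b (\<lambda>x. f x * g x))" if "b \<in> Basis" for b
    unfolding eq using Suc that by (intro C_k_add Suc.IH) auto
  with Suc.prems show ?case by auto
qed (auto intro!: continuous_intros)

lemma smooth_const: "smooth (\<lambda>x. c)"
  and smooth_inner: "smooth (\<lambda>x. x \<bullet> a)"
  and smooth_add: "smooth f \<Longrightarrow> smooth g \<Longrightarrow> smooth (\<lambda>x. f x + g x)"
  and smooth_mult: "smooth f \<Longrightarrow> smooth g \<Longrightarrow> smooth (\<lambda>x. f x * g x)"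
  by (simp_all add: smooth_def C_k_const C_k_inner C_k_add C_k_mult)

lemma smooth_diff: "smooth f \<Longrightarrow> smooth g \<Longrightarrow> smooth (\<lambda>x. f x - g x)"
  using smooth_add[of f "\<lambda>x. - 1 * g x"] smooth_mult[OF smooth_const, of g "-1"] by simp

lemma smooth_sum: "finite I \<Longrightarrow> (\<And>i. i \<in> I \<Longrightarrow> smooth (f i)) \<Longrightarrow> smooth (\<lambda>x. \<Sum>i\<in>I. f i x)"
  by (induction rule: finite_induct) (auto intro: smooth_const smooth_add)

text \<open>The functions \<open>t\<^sup>-\<^sup>n * exp (- 1 / t)\<close>, extended by zero. The whole family is needed so that derivatives
  stay linear combinations of members.\<close>

definition flat :: "nat \<Rightarrow> real \<Rightarrow> real" where
  "flat n t = (if t > 0 then (1 / t) ^ n * exp (- (1 / t)) else 0)"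

lemma flat_tendsto_0: "(flat n \<longlongrightarrow> 0) (at_right 0)"
proof -
  have "((\<lambda>t. inverse t ^ n / exp (inverse t)) \<longlongrightarrow> (0::real)) (at_right 0)"
    by (rule filterlim_compose[OF tendsto_power_div_exp_0 filterlim_inverse_at_top_right])
  then show ?thesis
    by (rule Lim_transform_eventually)
      (auto simp: eventually_at_right_field flat_def exp_minus field_simps intro!: exI[of _ 1])
qed

text \<open>At zero the difference quotient of \<open>flat n\<close> is \<open>flat (n + 1)\<close> from the right and zero from the left.\<close>

lemma flat_DERIV:
  "(flat n has_real_derivative (flat (n + 2) t - real n * flat (n + 1) t)) (at t)"
proof -
  consider "t > 0" | "t < 0" | "t = 0" by linarith
  then show ?thesis
  proof cases
    case 1
    have 2: "((\<lambda>t. (1 / t) ^ n * exp (- (1 / t))) has_real_derivative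
        (flat (n + 2) t - real n * flat (n + 1) t)) (at t)"
    proof -
      have a: "((\<lambda>t. 1 / t) has_real_derivative - ((1 / t)\<^sup>2)) (at t)"
        using 1 by (auto intro!: derivative_eq_intros simp: field_simps power2_eq_square)
      show ?thesis
        by (rule DERIV_cong[OF DERIV_mult[OF DERIV_power[OF a] DERIV_fun_exp[OF DERIV_minus[OF a]]]])
          (use 1 in \<open>cases n; simp add: flat_def algebra_simps power2_eq_square\<close>)
    qed
    show ?thesis
      by (rule has_field_derivative_transform_within_open[OF 2, of "{0<..}"])
        (use 1 in \<open>auto simp: flat_def\<close>)
  next
    case 2
    have 3: "((\<lambda>t. 0) has_real_derivative (flat (n + 2) t - real n * flat (n + 1) t)) (at t)"
      using 2 by (auto simp: flat_def)
    show ?thesis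
      by (rule has_field_derivative_transform_within_open[OF 3, of "{..<0}"])
        (use 2 in \<open>auto simp: flat_def\<close>)
  next
    case 3
    have r: "((\<lambda>h. flat n h / h) \<longlongrightarrow> 0) (at_right 0)"
      by (rule Lim_transform_eventually[OF flat_tendsto_0[of "n+1"]])
        (auto simp: eventually_at_right_field flat_def field_simps intro!: exI[of _ 1])
    have l: "((\<lambda>h. flat n h / h) \<longlongrightarrow> 0) (at_left 0)"
      by (rule Lim_transform_eventually[OF tendsto_const[of 0]])
        (auto simp: eventually_at_left_field flat_def intro!: exI[of _ "-1"])
    have "((\<lambda>h. flat n h / h) \<longlongrightarrow> 0) (at 0)"
      using l r by (simp add: filterlim_at_split)
    then show ?thesis unfolding 3 by (simp add: DERIV_def flat_def)
  qed
qed

lemma flat_continuous_on: "continuous_on S (flat n)"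
  by (rule continuous_at_imp_continuous_on) (auto intro: DERIV_isCont flat_DERIV)

lemma flat_nonneg: "0 \<le> flat n t"
  by (simp add: flat_def)

text \<open>The induction on the order of differentiability must run over all \<open>n\<close> at once, since differentiating
  \<open>flat n\<close> raises the index.\<close>

lemma smooth_flat_compose:
  assumes "smooth q" shows "smooth (\<lambda>x. flat n (q x))"
proof -
  have "C_k k (\<lambda>x. flat n (q x))" for k
  proof (induction k arbitrary: n)
    case 0
    show ?case using smooth_continuous_on[OF assms] 
      by (auto intro: continuous_on_compose2[OF flat_continuous_on])
  next
    case (Suc k)
    have d: "((\<lambda>x. flat n (q x)) has_derivative
        (\<lambda>h. frechet_derivative q (at x) h * (flat (n + 2) (q x) - real n * flat (n + 1) (q x)))) (at x)" for x
      using DERIV_compose_FDERIV[OF flat_DERIV]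
        smooth_differentiable[OF assms, of x, unfolded frechet_derivative_works] by blast
    have eq: "partial_deriv b (\<lambda>x. flat n (q x)) =
       (\<lambda>x. partial_deriv b q x * (flat (n + 2) (q x) + (- real n) * flat (n + 1) (q x)))" for b
      by (rule ext, subst partial_deriv_eq[OF d]) (simp add: partial_deriv_def)
    have "C_k k (partial_deriv b (\<lambda>x. flat n (q x)))" if "b \<in> Basis" for b
      unfolding eq using smooth_partial_deriv[OF assms that] Suc
      by (intro C_k_mult C_k_add C_k_const) (auto simp: smooth_def)
    then show ?case using d by (auto simp: differentiable_def)
  qed
  then show ?thesis by (simp add: smooth_def)
qed

lemma smooth_norm_sq_affine: "smooth (\<lambda>y. (norm (c *\<^sub>R (y - x) - e))\<^sup>2)"
proof -
  have "(norm (c *\<^sub>R (y - x) - e))\<^sup>2 =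
     (\<Sum>b\<in>Basis. (c * (y \<bullet> b) - (c * (x \<bullet> b) + e \<bullet> b)) * (c * (y \<bullet> b) - (c * (x \<bullet> b) + e \<bullet> b)))" for y
    unfolding power2_norm_eq_inner
    by (subst euclidean_inner) (simp add: inner_simps algebra_simps)
  then show ?thesis
    by (auto intro!: smooth_sum smooth_mult smooth_diff smooth_const smooth_inner)
qed

definition bump :: "'a::euclidean_space \<Rightarrow> real \<Rightarrow> 'a \<Rightarrow> real" where
  "bump e \<rho> z = flat 0 (\<rho>\<^sup>2 - (norm (z - e))\<^sup>2)"

lemma bump_nonneg: "0 \<le> bump e \<rho> z"
  by (simp add: bump_def flat_nonneg)

lemma bump_pos: "norm (z - e) < \<rho> \<Longrightarrow> 0 < bump e \<rho> z"
  by (simp add: bump_def flat_def power_strict_mono)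

lemma bump_eq_0: "0 \<le> \<rho> \<Longrightarrow> \<not> norm (z - e) < \<rho> \<Longrightarrow> bump e \<rho> z = 0"
  by (simp add: bump_def flat_def not_less)

lemma bump_le_1: "bump e \<rho> z \<le> 1"
  by (simp add: bump_def flat_def)

lemma bump_continuous_on: "continuous_on S (bump e \<rho>)"
  unfolding bump_def by (intro continuous_on_compose2[OF flat_continuous_on[of UNIV]] continuous_intros) auto

lemma bump_smooth: "smooth (\<lambda>y. bump e \<rho> (c *\<^sub>R (y - x)))"
  unfolding bump_def by (intro smooth_flat_compose smooth_diff smooth_const smooth_norm_sq_affine)

definition mollifier :: "'a::euclidean_space \<Rightarrow> real \<Rightarrow> 'a \<Rightarrow> real" where
  "mollifier e \<rho> z = bump e \<rho> z / (\<integral>z. bump e \<rho> z \<partial>lborel)"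

lemma bump_integrable:
  assumes "\<rho> > 0" shows "integrable lborel (bump e \<rho>)"
proof -
  have "integrable lborel (\<lambda>x. indicator (cball e \<rho>) x *\<^sub>R bump e \<rho> x)"
    by (intro borel_integrable_compact bump_continuous_on) auto
  moreover have "(\<lambda>x. indicator (cball e \<rho>) x *\<^sub>R bump e \<rho> x) = bump e \<rho>"
  proof
    fix x show "indicator (cball e \<rho>) x *\<^sub>R bump e \<rho> x = bump e \<rho> x"
      using bump_eq_0[of \<rho> x e] assms
      by (cases "norm (x - e) < \<rho>") (auto simp: indicator_def dist_norm norm_minus_commute)
  qed
  ultimately show ?thesis by metis
qed

lemma bump_integral_pos:
  assumes "\<rho> > 0" shows "0 < (\<integral>z. bump e \<rho> z \<partial>lborel)"
proof (rule ccontr)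
  assume "\<not> ?thesis"
  then have "(\<integral>z. bump e \<rho> z \<partial>lborel) = 0"
    using bump_nonneg[of e \<rho>] by (simp add: order_antisym)
  then have "AE z in lborel. bump e \<rho> z = 0"
    using integral_nonneg_eq_0_iff_AE[OF bump_integrable[OF assms, of e]] by (simp add: bump_nonneg)
  then have "AE z in lborel. z \<notin> ball e \<rho>"
    by (rule eventually_mono) (use bump_pos[of _ e \<rho>] in \<open>force simp: dist_norm norm_minus_commute\<close>)
  then have "emeasure lborel (ball e \<rho>) = 0"
    by (subst (asm) AE_iff_measurable[of "ball e \<rho>"]) auto
  then show False using content_ball_pos[OF assms, of e] 
    by (simp add: measure_def)
qed

lemma mollifier_nonneg: "\<rho> > 0 \<Longrightarrow> 0 \<le> mollifier e \<rho> z"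
  using bump_integral_pos[of \<rho> e] bump_nonneg[of e \<rho> z] by (simp add: mollifier_def)

lemma mollifier_eq_0: "\<rho> > 0 \<Longrightarrow> z \<notin> ball e \<rho> \<Longrightarrow> mollifier e \<rho> z = 0"
  by (simp add: mollifier_def bump_eq_0 dist_norm norm_minus_commute)

lemma mollifier_integrable: "\<rho> > 0 \<Longrightarrow> integrable lborel (mollifier e \<rho>)"
  unfolding mollifier_def using bump_integrable[of \<rho> e] by auto

lemma mollifier_integral: "\<rho> > 0 \<Longrightarrow> (\<integral>z. mollifier e \<rho> z \<partial>lborel) = 1"
  unfolding mollifier_def using bump_integral_pos[of \<rho> e] by simp

lemma mollifier_nn_integral: "\<rho> > 0 \<Longrightarrow> (\<integral>\<^sup>+z. ennreal (mollifier e \<rho> z) \<partial>lborel) = 1"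
  by (subst nn_integral_eq_integral) (auto simp: mollifier_integrable mollifier_nonneg mollifier_integral)

lemma mollifier_continuous_on: "continuous_on S (mollifier e \<rho>)"
  unfolding mollifier_def divide_inverse by (intro continuous_intros bump_continuous_on)

lemma mollifier_measurable [measurable]: "mollifier e \<rho> \<in> borel_measurable borel"
  by (rule borel_measurable_continuous_onI) (rule mollifier_continuous_on)

lemma mollifier_bounded:
  assumes "\<rho> > 0" obtains M where "M > 0" "\<And>z. mollifier e \<rho> z \<le> M"
proof
  show "1 / (\<integral>z. bump e \<rho> z \<partial>lborel) > 0" using bump_integral_pos[OF assms] by simp
  show "mollifier e \<rho> z \<le> 1 / (\<integral>z. bump e \<rho> z \<partial>lborel)" for z
    unfolding mollifier_def using bump_integral_pos[OF assms, of e] bump_le_1[of e \<rho> z]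
    by (simp add: divide_right_mono)
qed

lemma mollifier_smooth: "smooth (\<lambda>y. mollifier e \<rho> (c *\<^sub>R (y - x)))"
  unfolding mollifier_def divide_inverse by (intro smooth_mult smooth_const bump_smooth)

section \<open>Integral inequalities, rescaling and translation\<close>

text \<open>The form in which Young's inequality is used throughout: below \<open>\<kappa>\<close> the first term suffices, above it
  \<open>(t / \<kappa>) powr (r - 1) \<ge> 1\<close>.\<close>

lemma le_add_powr:
  fixes t \<kappa> r :: real
  assumes "0 \<le> t" "0 < \<kappa>" "1 \<le> r"
  shows "t \<le> \<kappa> + \<kappa> powr (1 - r) * t powr r"
proof (cases "t \<le> \<kappa>")
  case False
  then have "1 \<le> (t / \<kappa>) powr (r - 1)"
    using assms by (intro ge_one_powr_ge_zero) auto
  also have "\<dots> = \<kappa> powr (1 - r) * t powr (r - 1)"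
    using assms False by (simp add: powr_divide powr_diff)
  finally have "t * 1 \<le> t * (\<kappa> powr (1 - r) * t powr (r - 1))"
    using assms by (intro mult_left_mono) auto
  also have "\<dots> = \<kappa> powr (1 - r) * t powr r"
    using assms False by (simp add: powr_diff)
  finally show ?thesis using assms by simp
qed (use assms in \<open>auto intro: add_increasing2\<close>)

text \<open>Jensen's inequality up to the factor \<open>2 powr r\<close>. Splitting \<open>f\<close> at the height \<open>d / (2 * W)\<close>, the low part contributes at
  most \<open>d / 2\<close>, which can be subtracted because \<open>d\<close> is finite.\<close>

lemma powr_le_weighted_nn_integral:
  fixes d W r :: real
  assumes [measurable]: "w \<in> borel_measurable M" "f \<in> borel_measurable M"
    and w0: "\<And>x. 0 \<le> w x" and f0: "\<And>x. 0 \<le> f x"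
    and d: "ennreal d \<le> (\<integral>\<^sup>+x. ennreal (w x * f x) \<partial>M)"
    and W: "(\<integral>\<^sup>+x. ennreal (w x) \<partial>M) \<le> ennreal W" "0 < W" and r: "1 \<le> r" and d0: "0 \<le> d"
  shows "ennreal (d powr r) \<le> ennreal (2 powr r * W powr (r - 1)) *
           (\<integral>\<^sup>+x. ennreal (w x * f x powr r) \<partial>M)" (is "_ \<le> _ * ?J")
proof (cases "?J = top \<or> d = 0")
  case True
  then show ?thesis
  proof
    assume "?J = top"
    then show ?thesis using W by (simp add: ennreal_mult_top)
  qed simp
next
  case False
  then obtain J where J: "?J = ennreal J" "0 \<le> J"
    by (cases "\<integral>\<^sup>+x. ennreal (w x * f x powr r) \<partial>M") auto
  define c where "c = d / (2 * W)"
  have d: "d > 0" "c > 0" using False d0 W by (auto simp: c_def)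
  have "ennreal d \<le> (\<integral>\<^sup>+x. ennreal (w x * f x) \<partial>M)" by fact
  also have "\<dots> \<le> (\<integral>\<^sup>+x. ennreal c * ennreal (w x) + ennreal (c powr (1 - r)) * ennreal (w x * f x powr r) \<partial>M)"
  proof (rule nn_integral_mono)
    fix x
    have "w x * f x \<le> w x * (c + c powr (1 - r) * f x powr r)"
      using w0 f0 d r by (intro mult_left_mono le_add_powr) auto
    then show "ennreal (w x * f x) \<le> ennreal c * ennreal (w x) + ennreal (c powr (1 - r)) * ennreal (w x * f x powr r)"
      using w0[of x] d by (simp flip: ennreal_mult ennreal_plus add: algebra_simps)
  qed
  also have "\<dots> = ennreal c * (\<integral>\<^sup>+x. ennreal (w x) \<partial>M) + ennreal (c powr (1 - r)) * ?J"
    by (simp add: nn_integral_add nn_integral_cmult)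
  also have "\<dots> \<le> ennreal c * ennreal W + ennreal (c powr (1 - r)) * ?J"
    by (intro add_mono mult_left_mono W) auto
  also have "\<dots> = ennreal (d / 2 + c powr (1 - r) * J)"
    using d W J by (simp add: c_def flip: ennreal_mult ennreal_plus)
  finally have "d \<le> d / 2 + c powr (1 - r) * J"
    using d J by (subst (asm) ennreal_le_iff) auto
  then have "d / 2 * c powr (r - 1) \<le> (c powr (1 - r) * J) * c powr (r - 1)"
    by (intro mult_right_mono) auto
  also have "\<dots> = J" using d by (simp add: powr_diff)
  finally have "2 powr r * W powr (r - 1) * (d / 2 * c powr (r - 1)) \<le> 2 powr r * W powr (r - 1) * J"
    by (intro mult_left_mono) auto
  moreover have "2 powr r * W powr (r - 1) * (d / 2 * c powr (r - 1)) = d powr r"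
    using d W by (simp add: c_def powr_divide powr_mult powr_diff field_simps)
  ultimately have "d powr r \<le> 2 powr r * W powr (r - 1) * J" by (simp only:)
  then show ?thesis
    using J by (simp flip: ennreal_mult)
qed

lemma nn_integral_rescale:
  fixes f :: "'a::euclidean_space \<Rightarrow> ennreal"
  assumes [measurable]: "f \<in> borel_measurable borel" and "0 < s"
  shows "(\<integral>\<^sup>+z. f (x + s *\<^sub>R z) \<partial>lborel) = ennreal ((1 / s) ^ DIM('a)) * (\<integral>\<^sup>+y. f y \<partial>lborel)"
proof -
  have "(\<integral>\<^sup>+y. f y \<partial>lborel) = ennreal (s ^ DIM('a)) * (\<integral>\<^sup>+z. f (x + s *\<^sub>R z) \<partial>lborel)"
    using assms(2)
    by (subst lborel_affine[of s x]) (simp_all add: nn_integral_density nn_integral_distr nn_integral_cmult)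
  then have "ennreal ((1 / s) ^ DIM('a)) * (\<integral>\<^sup>+y. f y \<partial>lborel) =
     ennreal ((1 / s) ^ DIM('a) * s ^ DIM('a)) * (\<integral>\<^sup>+z. f (x + s *\<^sub>R z) \<partial>lborel)"
    using assms(2) by (simp add: ennreal_mult mult.assoc)
  then show ?thesis using assms(2) by (simp flip: power_mult_distrib)
qed

lemma nn_integral_translate:
  fixes f :: "'a::euclidean_space \<Rightarrow> ennreal"
  assumes "f \<in> borel_measurable borel"
  shows "(\<integral>\<^sup>+x. f (x + h) \<partial>lborel) = (\<integral>\<^sup>+x. f x \<partial>lborel)"
  using nn_integral_rescale[OF assms, of 1 h] by (simp add: add.commute)

lemma integrable_rescale:
  fixes f :: "'a::euclidean_space \<Rightarrow> real"
  assumes "integrable lborel f" and s: "0 < s"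
  shows "integrable lborel (\<lambda>z. f (x + s *\<^sub>R z))"
proof -
  have m[measurable]: "f \<in> borel_measurable borel" using assms(1) by simp
  have "(\<integral>\<^sup>+z. ennreal (norm (f (x + s *\<^sub>R z))) \<partial>lborel) < \<infinity>"
    using nn_integral_rescale[of "\<lambda>y. ennreal (norm (f y))" s x] assms
    by (simp add: integrable_iff_bounded ennreal_mult_less_top)
  then show ?thesis by (simp add: integrable_iff_bounded)
qed

lemma integral_rescale:
  fixes f :: "'a::euclidean_space \<Rightarrow> real"
  assumes [measurable]: "f \<in> borel_measurable borel" and s: "0 < s"
  shows "(\<integral>z. f (x + s *\<^sub>R z) \<partial>lborel) = (1 / s) ^ DIM('a) * (\<integral>y. f y \<partial>lborel)"
proof -
  have "(\<integral>y. f y \<partial>lborel) = s ^ DIM('a) * (\<integral>z. f (x + s *\<^sub>R z) \<partial>lborel)"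
    using s by (subst lborel_affine[of s x]) (simp_all add: integral_density integral_distr)
  then show ?thesis using s by (simp add: power_divide)
qed

text \<open>Open sets suffice: where \<open>x\<close> lies in an open \<open>U\<close>, so does \<open>x + h\<close> for small \<open>h\<close>; and the two
  halves of the symmetric difference of \<open>U\<close> and its translate have the same measure.\<close>

lemma L1_translation_continuous_open:
  fixes h :: "nat \<Rightarrow> 'a::euclidean_space"
  assumes U: "open U" "emeasure lborel U < \<infinity>" and h: "h \<longlonglongrightarrow> 0"
  shows "(\<lambda>n. \<integral>\<^sup>+x. ennreal \<bar>indicator U (x + h n) - indicator U x\<bar> \<partial>lborel) \<longlonglongrightarrow> 0"
proof -
  have [measurable]: "U \<in> sets borel" using U by simp
  let ?D = "\<lambda>n x. ennreal (indicator U x * (1 - indicator U (x + h n)))"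
  have lim: "(\<lambda>n. \<integral>\<^sup>+x. ?D n x \<partial>lborel) \<longlonglongrightarrow> (\<integral>\<^sup>+x. 0 \<partial>(lborel::'a measure))"
  proof (rule nn_integral_dominated_convergence[where w="indicator U"])
    show "AE x in lborel. (\<lambda>n. ?D n x) \<longlonglongrightarrow> 0"
    proof (rule AE_I2)
      fix x :: 'a
      show "(\<lambda>n. ?D n x) \<longlonglongrightarrow> 0"
      proof (cases "x \<in> U")
        case True
        have "(\<lambda>n. x + h n) \<longlonglongrightarrow> x" using tendsto_add[OF tendsto_const h, of x] by simp
        then have "\<forall>\<^sub>F n in sequentially. x + h n \<in> U" using U True by (metis topological_tendstoD)
        then have "\<forall>\<^sub>F n in sequentially. ?D n x = 0" by (rule eventually_mono) auto
        then show ?thesis by (simp add: tendsto_eventually)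
      qed simp
    qed
    show "AE x in lborel. ?D n x \<le> indicator U x" for n
      by (intro AE_I2) (auto simp: indicator_def)
  qed (use U in \<open>auto simp: less_top[symmetric]\<close>)
  have eq: "(\<integral>\<^sup>+x. ennreal \<bar>indicator U (x + h n) - indicator U x\<bar> \<partial>lborel) = 2 * (\<integral>\<^sup>+x. ?D n x \<partial>lborel)" for n
  proof -
    let ?E = "\<lambda>x. ennreal (indicator U (x + h n) * (1 - indicator U x))"
    have fin: "(\<integral>\<^sup>+x. indicator U x * indicator U (x + h n) \<partial>lborel) \<noteq> \<infinity>"
    proof -
      have "(\<integral>\<^sup>+x. indicator U x * indicator U (x + h n) \<partial>lborel) \<le> (\<integral>\<^sup>+x. indicator U x \<partial>lborel)"
        by (intro nn_integral_mono) (auto simp: indicator_def)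
      then show ?thesis using U by (auto simp: top_unique)
    qed
    have a: "(\<integral>\<^sup>+x. indicator U x \<partial>lborel) = (\<integral>\<^sup>+x. indicator U x * indicator U (x + h n) \<partial>lborel) + (\<integral>\<^sup>+x. ?D n x \<partial>lborel)"
      by (subst nn_integral_add[symmetric]) (measurable, intro nn_integral_cong, simp add: indicator_def)
    have b: "(\<integral>\<^sup>+x. indicator U (x + h n) \<partial>lborel) = (\<integral>\<^sup>+x. indicator U x * indicator U (x + h n) \<partial>lborel) + (\<integral>\<^sup>+x. ?E x \<partial>lborel)"
      by (subst nn_integral_add[symmetric]) (auto intro!: nn_integral_cong simp: indicator_def)
    have "(\<integral>\<^sup>+x. indicator U (x + h n) \<partial>lborel) = (\<integral>\<^sup>+x. indicator U x \<partial>(lborel :: 'a measure))"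
      by (rule nn_integral_translate) simp
    note eq = trans[OF trans[OF b[symmetric] this] a]
    have DE: "(\<integral>\<^sup>+x. ?D n x \<partial>lborel) = (\<integral>\<^sup>+x. ?E x \<partial>lborel)"
      using iffD1[OF ennreal_add_left_cancel eq] fin by (elim disjE) (simp_all only: not_True_eq_False)
    have "(\<integral>\<^sup>+x. ennreal \<bar>indicator U (x + h n) - indicator U x\<bar> \<partial>lborel)
      = (\<integral>\<^sup>+x. ?D n x \<partial>lborel) + (\<integral>\<^sup>+x. ?E x \<partial>lborel)"
      by (subst nn_integral_add[symmetric]) (auto intro!: nn_integral_cong simp: indicator_def)
    then show ?thesis by (simp add: DE flip: mult_2)
  qed
  have "(\<lambda>n. 2 * (\<integral>\<^sup>+x. ?D n x \<partial>lborel)) \<longlonglongrightarrow> 2 * (\<integral>\<^sup>+x. 0 \<partial>(lborel::'a measure))"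
    by (intro ennreal_tendsto_cmult lim) simp
  then show ?thesis by (simp add: eq)
qed

lemma L1_translation_diff_le:
  fixes f g :: "'a::euclidean_space \<Rightarrow> real"
  assumes [measurable]: "f \<in> borel_measurable borel" "g \<in> borel_measurable borel"
  shows "(\<integral>\<^sup>+x. ennreal \<bar>f (x + h) - f x\<bar> \<partial>lborel) \<le>
    (\<integral>\<^sup>+x. ennreal \<bar>g (x + h) - g x\<bar> \<partial>lborel) + 2 * (\<integral>\<^sup>+x. ennreal \<bar>f x - g x\<bar> \<partial>lborel)"
proof -
  have "(\<integral>\<^sup>+x. ennreal \<bar>f (x + h) - f x\<bar> \<partial>lborel) \<le>
    (\<integral>\<^sup>+x. ennreal \<bar>g (x + h) - g x\<bar> + (ennreal \<bar>f (x + h) - g (x + h)\<bar> + ennreal \<bar>f x - g x\<bar>) \<partial>lborel)"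
    by (intro nn_integral_mono) (auto simp flip: ennreal_plus)
  also have "\<dots> = (\<integral>\<^sup>+x. ennreal \<bar>g (x + h) - g x\<bar> \<partial>lborel) +
     ((\<integral>\<^sup>+x. ennreal \<bar>f (x + h) - g (x + h)\<bar> \<partial>lborel) + (\<integral>\<^sup>+x. ennreal \<bar>f x - g x\<bar> \<partial>lborel))"
    by (simp add: nn_integral_add)
  also have "(\<integral>\<^sup>+x. ennreal \<bar>f (x + h) - g (x + h)\<bar> \<partial>lborel) = (\<integral>\<^sup>+x. ennreal \<bar>f x - g x\<bar> \<partial>lborel)"
    by (rule nn_integral_translate[of "\<lambda>x. ennreal \<bar>f x - g x\<bar>"]) simp
  finally show ?thesis unfolding mult_2 .
qed

text \<open>A limit in \<open>ennreal\<close> cannot be handled by subtraction; this replaces the usual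
  \<open>\<epsilon>/2\<close> argument.\<close>

lemma tendsto_0_approx_ennreal:
  fixes a :: "nat \<Rightarrow> ennreal"
  assumes "\<And>e::real. e > 0 \<Longrightarrow> \<exists>b. b \<longlonglongrightarrow> 0 \<and> (\<forall>n. a n \<le> b n + ennreal e)"
  shows "a \<longlonglongrightarrow> 0"
proof -
  have "\<forall>\<^sub>F n in sequentially. a n < c" if "c > 0" for c
  proof -
    obtain d where d: "0 < d" "d < c" using dense[OF \<open>c > 0\<close>] by auto
    then obtain e where "d = ennreal e" "0 \<le> e" by (cases d) auto
    with d have e: "e > 0" "ennreal e < c" by auto
    obtain b where b: "b \<longlonglongrightarrow> 0" "\<And>n. a n \<le> b n + ennreal (e / 2)"
      using assms[of "e / 2"] e by auto
    have "\<forall>\<^sub>F n in sequentially. b n < ennreal (e / 2)"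
      using b(1) e by (intro order_tendstoD(2)) auto
    then show ?thesis
    proof (rule eventually_mono)
      fix n assume n: "b n < ennreal (e / 2)"
      have "a n \<le> ennreal (e / 2) + ennreal (e / 2)" 
        using b(2)[of n] n by (meson add_right_mono order.trans less_imp_le)
      also have "\<dots> = ennreal e" using e by (simp flip: ennreal_plus)
      finally show "a n < c" using e by simp
    qed
  qed
  then show ?thesis by (intro order_tendstoI) auto
qed

text \<open>Indicators of open sets approximate indicators of measurable sets by outer regularity, and the property is stable
  under sums and \<open>L\<^sup>1\<close> limits because translation preserves the \<open>L\<^sup>1\<close> distance.\<close>

proposition L1_translation_continuous:
  fixes f :: "'a::euclidean_space \<Rightarrow> real"
  assumes "integrable lborel f" and h: "h \<longlonglongrightarrow> 0"
  shows "(\<lambda>n. \<integral>\<^sup>+x. ennreal \<bar>f (x + h n) - f x\<bar> \<partial>lborel) \<longlonglongrightarrow> 0"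
  using assms(1)
proof (induction rule: integrable_induct)
  case (base A c)
  then have [measurable]: "A \<in> sets borel" by simp
  show ?case
  proof (rule tendsto_0_approx_ennreal)
    fix e :: real assume e: "e > 0"
    define e' where "e' = e / (2 * (\<bar>c\<bar> + 1))"
    have e': "e' > 0" "2 * \<bar>c\<bar> * e' \<le> e" using e by (auto simp: e'_def field_simps)
    obtain U where U: "open U" "A \<subseteq> U" "emeasure lebesgue (U - A) < ennreal e'"
      using sets_lebesgue_outer_open[of A e'] e' base by auto
    have [measurable]: "U \<in> sets borel" using U by simp
    have UA: "emeasure lborel (U - A) < ennreal e'" using U by simp
    have "emeasure lborel U = emeasure lborel A + emeasure lborel (U - A)"
      using U by (subst plus_emeasure) (auto intro!: arg_cong[where f="emeasure lborel"])
    then have Ufin: "emeasure lborel U < \<infinity>" using base(2) UA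
      by (simp add: less_trans[OF UA])
    let ?b = "\<lambda>n. ennreal \<bar>c\<bar> * (\<integral>\<^sup>+x. ennreal \<bar>indicator U (x + h n) - indicator U x\<bar> \<partial>lborel)"
    have "?b \<longlonglongrightarrow> ennreal \<bar>c\<bar> * 0"
      by (intro ennreal_tendsto_cmult L1_translation_continuous_open U Ufin h) simp
    moreover have "(\<integral>\<^sup>+x. ennreal \<bar>indicator A (x + h n) *\<^sub>R c - indicator A x *\<^sub>R c\<bar> \<partial>lborel) \<le> ?b n + ennreal e" for n
    proof -
      have c: "(\<integral>\<^sup>+x. ennreal \<bar>indicator U (x + h n) *\<^sub>R c - indicator U x *\<^sub>R c\<bar> \<partial>lborel) = ?b n"
        by (subst nn_integral_cmult[symmetric])
          (auto intro!: nn_integral_cong simp: abs_mult indicator_def simp flip: ennreal_mult)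
      have "(\<integral>\<^sup>+x. ennreal \<bar>indicator A x *\<^sub>R c - indicator U x *\<^sub>R c\<bar> \<partial>lborel) = (\<integral>\<^sup>+x. ennreal \<bar>c\<bar> * indicator (U - A) x \<partial>lborel)"
        using U by (intro nn_integral_cong) (auto simp: indicator_def)
      also have "\<dots> = ennreal \<bar>c\<bar> * emeasure lborel (U - A)" by (simp add: nn_integral_cmult_indicator)
      also have "\<dots> \<le> ennreal \<bar>c\<bar> * ennreal e'" using UA by (intro mult_left_mono) auto
      finally have "2 * (\<integral>\<^sup>+x. ennreal \<bar>indicator A x *\<^sub>R c - indicator U x *\<^sub>R c\<bar> \<partial>lborel) \<le> 2 * (ennreal \<bar>c\<bar> * ennreal e')"
        by (intro mult_left_mono) auto
      also have "\<dots> = ennreal (2 * \<bar>c\<bar> * e')" using e'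
        by (simp flip: ennreal_mult ennreal_numeral add: mult.assoc)
      also have "\<dots> \<le> ennreal e" using e' by (intro ennreal_leI)
      finally show ?thesis
        using L1_translation_diff_le[of "\<lambda>x. indicator A x *\<^sub>R c" "\<lambda>x. indicator U x *\<^sub>R c" "h n"] unfolding c
        by (simp add: order_trans[OF _ add_left_mono])
    qed
    ultimately show "\<exists>b. b \<longlonglongrightarrow> 0 \<and>
      (\<forall>n. (\<integral>\<^sup>+x. ennreal \<bar>indicator A (x + h n) *\<^sub>R c - indicator A x *\<^sub>R c\<bar> \<partial>lborel) \<le> b n + ennreal e)"
      by (intro exI[of _ ?b]) auto
  qed
next
  case (add f g)
  have [measurable]: "f \<in> borel_measurable borel" "g \<in> borel_measurable borel" using add by auto
  have "(\<lambda>n. (\<integral>\<^sup>+x. ennreal \<bar>f (x + h n) - f x\<bar> \<partial>lborel) + (\<integral>\<^sup>+x. ennreal \<bar>g (x + h n) - g x\<bar> \<partial>lborel)) \<longlonglongrightarrow> 0 + 0"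
    by (intro tendsto_add add)
  then show ?case unfolding add_0
  proof (rule tendsto_sandwich[rotated 3])
    show "\<forall>\<^sub>F n in sequentially. (\<integral>\<^sup>+x. ennreal \<bar>f (x + h n) + g (x + h n) - (f x + g x)\<bar> \<partial>lborel)
      \<le> (\<integral>\<^sup>+x. ennreal \<bar>f (x + h n) - f x\<bar> \<partial>lborel) + (\<integral>\<^sup>+x. ennreal \<bar>g (x + h n) - g x\<bar> \<partial>lborel)"
      by (intro always_eventually allI, subst nn_integral_add[symmetric])
        (auto intro!: nn_integral_mono simp flip: ennreal_plus)
  qed auto
next
  case (lim f s)
  note int = \<open>integrable lborel f\<close> \<open>\<And>i. integrable lborel (s i)\<close>
  have [measurable]: "f \<in> borel_measurable borel" "\<And>i. s i \<in> borel_measurable borel"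
    using int by (simp_all add: integrable_iff_bounded)
  have conv: "(\<lambda>i. \<integral>\<^sup>+x. ennreal (norm (s i x - f x)) \<partial>lborel) \<longlonglongrightarrow> 0"
  proof -
    have "(\<lambda>i. \<integral>\<^sup>+x. ennreal (norm (s i x - f x)) \<partial>lborel) \<longlonglongrightarrow> (\<integral>\<^sup>+x. 0 \<partial>(lborel::'a measure))"
    proof (rule nn_integral_dominated_convergence[where w="\<lambda>x. ennreal (3 * norm (f x))"])
      show "AE x in lborel. (\<lambda>i. ennreal (norm (s i x - f x))) \<longlonglongrightarrow> 0"
      proof (rule AE_I2)
        fix x :: 'a
        have "(\<lambda>i. s i x) \<longlonglongrightarrow> f x" by (rule lim) simp
        then have "(\<lambda>i. norm (s i x - f x)) \<longlonglongrightarrow> 0"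
          by (intro tendsto_norm_zero LIM_zero)
        then show "(\<lambda>i. ennreal (norm (s i x - f x))) \<longlonglongrightarrow> 0"
          by (metis ennreal_0 tendsto_ennrealI)
      qed
      show "AE x in lborel. ennreal (norm (s i x - f x)) \<le> ennreal (3 * norm (f x))" for i
      proof (rule AE_I2)
        fix x :: 'a
        have "norm (s i x) \<le> 2 * norm (f x)" by (rule lim) simp
        then show "ennreal (norm (s i x - f x)) \<le> ennreal (3 * norm (f x))"
          by (intro ennreal_leI) auto
      qed
      show "(\<integral>\<^sup>+x. ennreal (3 * norm (f x)) \<partial>lborel) < \<infinity>"
        using int(1) by (simp add: ennreal_mult nn_integral_cmult integrable_iff_bounded ennreal_mult_less_top)
    qed auto
    then show ?thesis by simp
  qed
  show ?case
  proof (rule tendsto_0_approx_ennreal)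
    fix e :: real assume e: "e > 0"
    have "\<forall>\<^sub>F i in sequentially. (\<integral>\<^sup>+x. ennreal (norm (s i x - f x)) \<partial>lborel) < ennreal (e / 2)"
      using e by (intro order_tendstoD(2)[OF conv]) auto
    then obtain i where i: "(\<integral>\<^sup>+x. ennreal (norm (s i x - f x)) \<partial>lborel) < ennreal (e / 2)"
      by (auto simp: eventually_sequentially)
    have "2 * (\<integral>\<^sup>+x. ennreal \<bar>f x - s i x\<bar> \<partial>lborel) \<le> 2 * ennreal (e / 2)"
      using i by (intro mult_left_mono) (auto simp: abs_minus_commute)
    also have "\<dots> = ennreal e" using e by (simp flip: ennreal_mult ennreal_numeral)
    finally have "\<forall>n. (\<integral>\<^sup>+x. ennreal \<bar>f (x + h n) - f x\<bar> \<partial>lborel) \<le> (\<integral>\<^sup>+x. ennreal \<bar>s i (x + h n) - s i x\<bar> \<partial>lborel) + ennreal e"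
      using L1_translation_diff_le[of f "s i"] by (meson add_left_mono order_trans \<open>f \<in> borel_measurable borel\<close> \<open>s i \<in> borel_measurable borel\<close>)
    with lim.IH[of i] show "\<exists>b. b \<longlonglongrightarrow> 0 \<and> (\<forall>n. (\<integral>\<^sup>+x. ennreal \<bar>f (x + h n) - f x\<bar> \<partial>lborel) \<le> b n + ennreal e)"
      by blast
  qed
qed

section \<open>Averaging along a cone\<close>

text \<open>A mollification whose kernel is supported near \<open>e\<close> instead of near the origin, so that only the values of
  \<open>u\<close> in a cone with apex \<open>x\<close> and axis \<open>e\<close> enter.\<close>

definition avg :: "'a::euclidean_space \<Rightarrow> real \<Rightarrow> real \<Rightarrow> ('a \<Rightarrow> real) \<Rightarrow> 'a \<Rightarrow> real" where
  "avg e \<rho> s u x = (\<integral>z. u (x + s *\<^sub>R z) * mollifier e \<rho> z \<partial>lborel)"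

lemma norm_le_2_of_cone:
  assumes "norm e = 1" "\<rho> \<le> 1" "z \<in> cball e \<rho>" shows "norm z \<le> 2"
  using norm_triangle_sub[of z e] assms by (simp add: dist_norm norm_minus_commute)

text \<open>Keeps the cones with apex in a small ball inside a ball of comparable radius, where the exponents vary little.\<close>

lemma cone_step_in_ball:
  assumes e: "norm e = 1" "\<rho> \<le> 1" "z \<in> cball e \<rho>" and x: "x \<in> ball x0 r" and s: "0 < s" "s \<le> r"
  shows "x + s *\<^sub>R z \<in> ball x0 (3 * r)"
proof -
  have "norm (s *\<^sub>R z) \<le> r * 2"
    using mult_mono[of s r "norm z" 2] norm_le_2_of_cone[OF e] s by simp
  moreover have "norm (x - x0) < r" using x by (simp add: dist_norm norm_minus_commute)
  moreover have "norm (x + s *\<^sub>R z - x0) \<le> norm (x - x0) + norm (s *\<^sub>R z)"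
    using norm_triangle_ineq[of "x - x0" "s *\<^sub>R z"] by (simp add: algebra_simps)
  ultimately have "norm (x + s *\<^sub>R z - x0) < 3 * r" by linarith
  then show ?thesis by (simp add: dist_norm norm_minus_commute)
qed

lemma integrable_mult_bounded_fun:
  fixes f g :: "'a \<Rightarrow> real"
  assumes f: "integrable M f" and [measurable]: "g \<in> borel_measurable M" and g: "\<And>x. \<bar>g x\<bar> \<le> C"
  shows "integrable M (\<lambda>x. f x * g x)"
proof (rule Bochner_Integration.integrable_bound)
  show "integrable M (\<lambda>x. C * f x)" using f by simp
  show "AE x in M. norm (f x * g x) \<le> norm (C * f x)"
  proof (rule AE_I2)
    fix x
    have "0 \<le> C" using g[of x] by linarith
    then show "norm (f x * g x) \<le> norm (C * f x)"
      using mult_right_mono[OF g[of x], of "\<bar>f x\<bar>"] by (simp add: abs_mult mult.commute)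
  qed
qed (use f in measurable)

lemma mollifier_abs_bounded:
  assumes "\<rho> > 0" obtains C where "C > 0" "\<And>z. \<bar>mollifier e \<rho> z\<bar> \<le> C"
  using mollifier_bounded[OF assms, of e] mollifier_nonneg[OF assms, of e] by (metis abs_of_nonneg)

lemma avg_integrand_integrable:
  fixes u :: "'a::euclidean_space \<Rightarrow> real"
  assumes u: "integrable lborel u" and "\<rho> > 0" "0 < s"
  shows "integrable lborel (\<lambda>z. u (x + s *\<^sub>R z) * mollifier e \<rho> z)"
proof -
  obtain C where "\<And>z. \<bar>mollifier e \<rho> z\<bar> \<le> C" using mollifier_abs_bounded[OF assms(2), of e] by blast
  then show ?thesis
    by (intro integrable_mult_bounded_fun[OF integrable_rescale[OF u \<open>0 < s\<close>]]) auto
qed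

text \<open>As a convolution the average depends on \<open>x\<close> and \<open>s\<close> through a smooth kernel only; this form is the one that can be
  differentiated and tested against a weak gradient.\<close>

lemma avg_eq_convolution:
  fixes u :: "'a::euclidean_space \<Rightarrow> real"
  assumes [measurable]: "u \<in> borel_measurable borel" and s: "0 < s"
  shows "avg e \<rho> s u x = (1 / s) ^ DIM('a) * (\<integral>y. u y * mollifier e \<rho> ((1 / s) *\<^sub>R (y - x)) \<partial>lborel)"
  using integral_rescale[of "\<lambda>y. u y * mollifier e \<rho> ((1 / s) *\<^sub>R (y - x))" s x] s
  by (simp add: avg_def)

lemma mollifier_affine_eq_0:
  assumes "\<rho> > 0" "0 < s" "y \<notin> (\<lambda>z. x + s *\<^sub>R z) ` cball e \<rho>"
  shows "mollifier e \<rho> ((1 / s) *\<^sub>R (y - x)) = 0"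
proof -
  have "(1 / s) *\<^sub>R (y - x) \<notin> cball e \<rho>"
  proof
    assume "(1 / s) *\<^sub>R (y - x) \<in> cball e \<rho>"
    moreover have "y = x + s *\<^sub>R ((1 / s) *\<^sub>R (y - x))" using assms(2) by simp
    ultimately show False using assms(3) by blast
  qed
  then show ?thesis by (intro mollifier_eq_0 assms) auto
qed

lemma avg_cong:
  assumes "\<rho> > 0" "\<And>z. z \<in> ball e \<rho> \<Longrightarrow> u (x + s *\<^sub>R z) = v (x + s *\<^sub>R z)"
  shows "avg e \<rho> s u x = avg e \<rho> s v x"
  unfolding avg_def
proof (rule Bochner_Integration.integral_cong)
  show "u (x + s *\<^sub>R z) * mollifier e \<rho> z = v (x + s *\<^sub>R z) * mollifier e \<rho> z" for z
    using assms mollifier_eq_0[OF assms(1), of z e] by (cases "z \<in> ball e \<rho>") auto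
qed simp

lemma avg_nonneg: "\<rho> > 0 \<Longrightarrow> (\<And>x. 0 \<le> u x) \<Longrightarrow> 0 \<le> avg e \<rho> s u x"
  unfolding avg_def by (intro Bochner_Integration.integral_nonneg) (auto simp: mollifier_nonneg)

lemma avg_measurable [measurable]:
  assumes [measurable]: "u \<in> borel_measurable borel"
  shows "(\<lambda>(s, x). avg e \<rho> s u x) \<in> borel_measurable (borel \<Otimes>\<^sub>M borel)"
  unfolding avg_def by measurable

lemma avg_measurable_x [measurable]:
  assumes [measurable]: "u \<in> borel_measurable borel"
  shows "avg e \<rho> s u \<in> borel_measurable borel"
  unfolding avg_def by measurable

text \<open>The \<open>L\<^sup>1\<close> distance is at most the mean over \<open>z\<close> of the \<open>L\<^sup>1\<close> distances between \<open>u\<close> and its translates by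
  \<open>\<delta> n *\<^sub>R z\<close>, which tend to zero boundedly.\<close>

lemma avg_tendsto_L1:
  fixes u :: "'a::euclidean_space \<Rightarrow> real"
  assumes u: "integrable lborel u" and \<rho>: "\<rho> > 0" and \<delta>: "\<And>n. 0 < \<delta> n" "\<delta> \<longlonglongrightarrow> 0"
  shows "(\<lambda>n. \<integral>\<^sup>+x. ennreal \<bar>avg e \<rho> (\<delta> n) u x - u x\<bar> \<partial>lborel) \<longlonglongrightarrow> 0"
proof -
  let ?\<eta> = "mollifier e \<rho>"
  have [measurable]: "u \<in> borel_measurable borel" using u by simp
  define \<omega> where "\<omega> h = (\<integral>\<^sup>+x. ennreal \<bar>u (x + h) - u x\<bar> \<partial>lborel)" for h
  have [measurable]: "\<omega> \<in> borel_measurable borel" unfolding \<omega>_def by measurable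
  have le: "(\<integral>\<^sup>+x. ennreal \<bar>avg e \<rho> (\<delta> n) u x - u x\<bar> \<partial>lborel)
      \<le> (\<integral>\<^sup>+z. ennreal (?\<eta> z) * \<omega> (\<delta> n *\<^sub>R z) \<partial>lborel)" for n
  proof -
    have "ennreal \<bar>avg e \<rho> (\<delta> n) u x - u x\<bar> \<le> (\<integral>\<^sup>+z. ennreal (?\<eta> z) * ennreal \<bar>u (x + \<delta> n *\<^sub>R z) - u x\<bar> \<partial>lborel)" for x
    proof -
      have i: "integrable lborel (\<lambda>z. u (x + \<delta> n *\<^sub>R z) * ?\<eta> z)" "integrable lborel (\<lambda>z. u x * ?\<eta> z)"
        using avg_integrand_integrable[OF u \<rho> \<delta>(1)] mollifier_integrable[OF \<rho>] by auto
      have "avg e \<rho> (\<delta> n) u x - u x = (\<integral>z. u (x + \<delta> n *\<^sub>R z) * ?\<eta> z - u x * ?\<eta> z \<partial>lborel)"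
        using i by (simp add: avg_def mollifier_integral[OF \<rho>])
      then have "ennreal \<bar>avg e \<rho> (\<delta> n) u x - u x\<bar> \<le> (\<integral>\<^sup>+z. ennreal \<bar>u (x + \<delta> n *\<^sub>R z) * ?\<eta> z - u x * ?\<eta> z\<bar> \<partial>lborel)"
        using integral_norm_bound_ennreal[OF Bochner_Integration.integrable_diff[OF i]] by simp
      also have "\<dots> = (\<integral>\<^sup>+z. ennreal (?\<eta> z) * ennreal \<bar>u (x + \<delta> n *\<^sub>R z) - u x\<bar> \<partial>lborel)"
      proof (rule nn_integral_cong)
        fix z
        have "\<bar>u (x + \<delta> n *\<^sub>R z) * ?\<eta> z - u x * ?\<eta> z\<bar> = ?\<eta> z * \<bar>u (x + \<delta> n *\<^sub>R z) - u x\<bar>"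
          using mollifier_nonneg[OF \<rho>, of e z] by (metis abs_mult abs_of_nonneg left_diff_distrib mult.commute)
        then show "ennreal \<bar>u (x + \<delta> n *\<^sub>R z) * ?\<eta> z - u x * ?\<eta> z\<bar>
            = ennreal (?\<eta> z) * ennreal \<bar>u (x + \<delta> n *\<^sub>R z) - u x\<bar>"
          using mollifier_nonneg[OF \<rho>, of e z] by (simp add: ennreal_mult)
      qed
      finally show ?thesis .
    qed
    then have "(\<integral>\<^sup>+x. ennreal \<bar>avg e \<rho> (\<delta> n) u x - u x\<bar> \<partial>lborel) \<le>
       (\<integral>\<^sup>+x. \<integral>\<^sup>+z. ennreal (?\<eta> z) * ennreal \<bar>u (x + \<delta> n *\<^sub>R z) - u x\<bar> \<partial>lborel \<partial>lborel)"
      by (intro nn_integral_mono) auto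
    also have "\<dots> = (\<integral>\<^sup>+z. \<integral>\<^sup>+x. ennreal (?\<eta> z) * ennreal \<bar>u (x + \<delta> n *\<^sub>R z) - u x\<bar> \<partial>lborel \<partial>lborel)"
      by (subst lborel_pair.Fubini') auto
    also have "\<dots> = (\<integral>\<^sup>+z. ennreal (?\<eta> z) * \<omega> (\<delta> n *\<^sub>R z) \<partial>lborel)"
      unfolding \<omega>_def by (intro nn_integral_cong nn_integral_cmult) auto
    finally show ?thesis .
  qed
  define B where "B = 2 * (\<integral>\<^sup>+x. ennreal \<bar>u x\<bar> \<partial>lborel)"
  have B: "B < \<infinity>" using u by (simp add: B_def integrable_iff_bounded ennreal_mult_less_top)
  have \<omega>B: "\<omega> h \<le> B" for h
    using L1_translation_diff_le[of u "\<lambda>x. 0" h] by (simp add: \<omega>_def B_def)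
  have "(\<lambda>n. \<integral>\<^sup>+z. ennreal (?\<eta> z) * \<omega> (\<delta> n *\<^sub>R z) \<partial>lborel) \<longlonglongrightarrow> (\<integral>\<^sup>+z. 0 \<partial>(lborel :: 'a measure))"
  proof (rule nn_integral_dominated_convergence[where w="\<lambda>z. ennreal (?\<eta> z) * B"])
    show "(\<integral>\<^sup>+z. ennreal (?\<eta> z) * B \<partial>lborel) < \<infinity>"
      using B by (simp add: nn_integral_multc mollifier_nn_integral[OF \<rho>])
    show "AE z in lborel. (\<lambda>n. ennreal (?\<eta> z) * \<omega> (\<delta> n *\<^sub>R z)) \<longlonglongrightarrow> 0"
    proof (rule AE_I2)
      fix z :: 'a
      have "(\<lambda>n. \<delta> n *\<^sub>R z) \<longlonglongrightarrow> 0 *\<^sub>R z" by (rule tendsto_scaleR[OF \<delta>(2) tendsto_const])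
      then have "(\<lambda>n. \<omega> (\<delta> n *\<^sub>R z)) \<longlonglongrightarrow> 0"
        unfolding \<omega>_def using L1_translation_continuous[OF u, of "\<lambda>n. \<delta> n *\<^sub>R z"] by simp
      then have "(\<lambda>n. ennreal (?\<eta> z) * \<omega> (\<delta> n *\<^sub>R z)) \<longlonglongrightarrow> ennreal (?\<eta> z) * 0"
        by (intro ennreal_tendsto_cmult) auto
      then show "(\<lambda>n. ennreal (?\<eta> z) * \<omega> (\<delta> n *\<^sub>R z)) \<longlonglongrightarrow> 0" by simp
    qed
    show "AE z in lborel. ennreal (?\<eta> z) * \<omega> (\<delta> n *\<^sub>R z) \<le> ennreal (?\<eta> z) * B" for n
      using \<omega>B by (intro AE_I2 mult_left_mono) auto
  qed auto
  then have lim: "(\<lambda>n. \<integral>\<^sup>+z. ennreal (?\<eta> z) * \<omega> (\<delta> n *\<^sub>R z) \<partial>lborel) \<longlonglongrightarrow> 0"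
    by simp
  show ?thesis
    by (rule tendsto_sandwich[OF _ _ tendsto_const lim]) (simp_all add: le)
qed

text \<open>The weak gradient as used for Borel representatives that vanish off \<open>\<Omega>\<close>, integrated against \<open>lborel\<close>: product measurability and
  Fubini's theorem are available there, in contrast to Lebesgue measure.\<close>

definition weak_grad_lborel :: "'a::euclidean_space set \<Rightarrow> ('a \<Rightarrow> real) \<Rightarrow> ('a \<Rightarrow> 'a) \<Rightarrow> bool" where
  "weak_grad_lborel \<Omega> u G \<longleftrightarrow> (\<forall>\<phi>\<in>test_functions \<Omega>. \<forall>b\<in>Basis.
     (\<integral>x. u x * partial_deriv b \<phi> x \<partial>lborel) = - (\<integral>x. (G x \<bullet> b) * \<phi> x \<partial>lborel))"

lemma test_functionI:
  assumes "smooth \<phi>" "compact K" "K \<subseteq> \<Omega>" "\<And>y. y \<notin> K \<Longrightarrow> \<phi> y = 0"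
  shows "\<phi> \<in> test_functions \<Omega>"
proof -
  have "closure {x. \<phi> x \<noteq> 0} \<subseteq> K"
    using assms by (intro closure_minimal) (auto dest: compact_imp_closed)
  moreover from this have "compact (closure {x. \<phi> x \<noteq> 0})"
    using assms(2) by (metis bounded_subset closed_closure compact_eq_bounded_closed)
  ultimately show ?thesis using assms unfolding test_functions_def smooth_def by auto
qed

text \<open>With \<open>w = (y - x) / s\<close>, the function \<open>cone_field_div\<close> below is, up to the power of \<open>s\<close>, both
  minus the \<open>s\<close>-derivative of \<open>s\<^sup>-\<^sup>N * mollifier w\<close> and the divergence in \<open>y\<close> of the vector field
  \<open>(y - x) * s\<^sup>-\<^sup>N\<^sup>-\<^sup>1 * mollifier w\<close>.\<close>

definition cone_field_div :: "'a::euclidean_space \<Rightarrow> real \<Rightarrow> 'a \<Rightarrow> real" where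
  "cone_field_div e \<rho> w = real DIM('a) * mollifier e \<rho> w
     - 2 * ((w - e) \<bullet> w) * flat 2 (\<rho>\<^sup>2 - (norm (w - e))\<^sup>2) / (\<integral>z. bump e \<rho> z \<partial>lborel)"

lemma cone_field_div_continuous_on: "continuous_on S (cone_field_div e \<rho>)"
  unfolding cone_field_div_def divide_inverse
  by (intro continuous_intros mollifier_continuous_on continuous_on_compose2[OF flat_continuous_on[of UNIV]]) auto

lemma cone_field_div_measurable [measurable]: "cone_field_div e \<rho> \<in> borel_measurable borel"
  by (rule borel_measurable_continuous_onI) (rule cone_field_div_continuous_on)

lemma cone_field_div_bounded:
  assumes "\<rho> > 0" obtains Z where "Z > 0" "\<And>w. \<bar>cone_field_div e \<rho> w\<bar> \<le> Z"
proof -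
  have "bounded (cone_field_div e \<rho> ` cball e \<rho>)"
    by (intro compact_imp_bounded compact_continuous_image cone_field_div_continuous_on) simp
  then obtain Z where Z: "Z > 0" "\<And>w. w \<in> cball e \<rho> \<Longrightarrow> \<bar>cone_field_div e \<rho> w\<bar> \<le> Z"
    unfolding bounded_pos by auto
  have "cone_field_div e \<rho> w = 0" if "w \<notin> cball e \<rho>" for w
  proof -
    have "\<rho> < norm (w - e)" using that by (simp add: dist_norm norm_minus_commute)
    then have "\<rho>\<^sup>2 < (norm (w - e))\<^sup>2" using assms by (intro power_strict_mono) auto
    then show ?thesis using that mollifier_eq_0[OF assms, of w e] 
      by (auto simp: cone_field_div_def flat_def)
  qed
  then have "\<bar>cone_field_div e \<rho> w\<bar> \<le> Z" for w
    using Z by (cases "w \<in> cball e \<rho>") auto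
  with Z that show ?thesis by blast
qed

lemma kernel_has_s_derivative:
  fixes x y :: "'a::euclidean_space"
  assumes "s \<noteq> 0"
  shows "((\<lambda>s. (1 / s) ^ DIM('a) * mollifier e \<rho> ((1 / s) *\<^sub>R (y - x))) has_real_derivative
      - ((1 / s) ^ (DIM('a) + 1) * cone_field_div e \<rho> ((1 / s) *\<^sub>R (y - x)))) (at s)"
proof -
  define v where "v = y - x"
  define w where "w = (1 / s) *\<^sub>R v"
  have a: "((\<lambda>s. 1 / s) has_real_derivative - ((1 / s)\<^sup>2)) (at s)"
    using assms by (auto intro!: derivative_eq_intros simp: field_simps power2_eq_square)
  have n: "(norm (c *\<^sub>R v - e))\<^sup>2 = c\<^sup>2 * (v \<bullet> v) - 2 * c * (v \<bullet> e) + e \<bullet> e" for c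
    unfolding power2_norm_eq_inner by (simp add: inner_simps inner_commute power2_eq_square)
  have "((\<lambda>c. \<rho>\<^sup>2 - (norm (c *\<^sub>R v - e))\<^sup>2) has_real_derivative
      2 * (v \<bullet> e) - 2 * (1 / s) * (v \<bullet> v)) (at (1 / s))"
    unfolding n by (auto intro!: derivative_eq_intros)
  from DERIV_chain2[OF this a] have "((\<lambda>s. \<rho>\<^sup>2 - (norm ((1 / s) *\<^sub>R v - e))\<^sup>2) has_real_derivative
      2 * (1 / s) * ((w - e) \<bullet> w)) (at s)"
    by (rule DERIV_cong) (simp add: w_def inner_simps inner_commute power2_eq_square algebra_simps)
  from DERIV_chain2[OF flat_DERIV[of 0, simplified] this]
  have b: "((\<lambda>s. bump e \<rho> ((1 / s) *\<^sub>R v)) has_real_derivative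
      flat 2 (\<rho>\<^sup>2 - (norm (w - e))\<^sup>2) * (2 * (1 / s) * ((w - e) \<bullet> w))) (at s)"
    by (simp add: bump_def w_def numeral_2_eq_2)
  have c: "((\<lambda>s. (1 / s) ^ DIM('a)) has_real_derivative - (real DIM('a) * (1 / s) ^ (DIM('a) + 1))) (at s)"
    by (rule DERIV_cong[OF DERIV_power[OF a]])
      (cases "DIM('a)"; simp add: power2_eq_square)
  show ?thesis unfolding v_def[symmetric]
    by (rule DERIV_cong[OF DERIV_mult[OF c DERIV_cdivide[OF b, of "\<integral>z. bump e \<rho> z \<partial>lborel", folded mollifier_def]]])
      (simp add: cone_field_div_def mollifier_def algebra_simps flip: w_def)
qed

lemma mollifier_affine_has_derivative:
  fixes x y :: "'a::euclidean_space"
  shows "((\<lambda>y. mollifier e \<rho> (c *\<^sub>R (y - x))) has_derivative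
     (\<lambda>h. - (2 * c * ((c *\<^sub>R (y - x) - e) \<bullet> h) * flat 2 (\<rho>\<^sup>2 - (norm (c *\<^sub>R (y - x) - e))\<^sup>2)
         / (\<integral>z. bump e \<rho> z \<partial>lborel)))) (at y)"
proof -
  have "((\<lambda>y. \<rho>\<^sup>2 - (c *\<^sub>R (y - x) - e) \<bullet> (c *\<^sub>R (y - x) - e)) has_derivative
     (\<lambda>h. - 2 * c * ((c *\<^sub>R (y - x) - e) \<bullet> h))) (at y)"
    by (rule derivative_eq_intros refl | simp)+ (simp add: inner_commute mult.assoc)
  then have q: "((\<lambda>y. \<rho>\<^sup>2 - (norm (c *\<^sub>R (y - x) - e))\<^sup>2) has_derivative
     (\<lambda>h. - 2 * c * ((c *\<^sub>R (y - x) - e) \<bullet> h))) (at y)"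
    by (simp add: power2_norm_eq_inner)
  have f: "DERIV (flat 0) t :> flat 2 t" for t
    using flat_DERIV[of 0 t] by (simp add: numeral_2_eq_2)
  show ?thesis
    unfolding mollifier_def divide_inverse unfolding bump_def
    by (rule has_derivative_eq_rhs[OF has_derivative_mult_left[OF DERIV_compose_FDERIV[OF f q]]])
     (simp add: fun_eq_iff mult_ac)
qed

text \<open>For fixed \<open>y\<close>, the change of the kernel between two scales is the integral of its \<open>s\<close>-derivative. Exchanging the integrals, the
  integral of \<open>u\<close> against that derivative is minus the integral of \<open>u\<close> against the divergence of the
  smooth field \<open>(y - x) * s\<^sup>-\<^sup>N\<^sup>-\<^sup>1 * mollifier e \<rho> ((y - x) / s)\<close>, whose components are test functions on \<open>\<Omega>\<close> by the cone condition. The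
  weak gradient therefore takes over; \<open>norm z \<le> 2\<close> on the support accounts for the factor two.\<close>

lemma avg_diff_le:
  fixes u :: "'a::euclidean_space \<Rightarrow> real"
  assumes u: "integrable lborel u" and G: "integrable lborel G" and wg: "weak_grad_lborel \<Omega> u G"
    and \<rho>: "0 < \<rho>" "\<rho> \<le> 1" and e: "norm e = 1" and \<delta>: "0 < \<delta>" "\<delta> \<le> \<epsilon>"
    and cone: "\<And>s z. \<delta> \<le> s \<Longrightarrow> s \<le> \<epsilon> \<Longrightarrow> z \<in> cball e \<rho> \<Longrightarrow> x + s *\<^sub>R z \<in> \<Omega>"
  shows "ennreal \<bar>avg e \<rho> \<epsilon> u x - avg e \<rho> \<delta> u x\<bar> \<le>
     (\<integral>\<^sup>+s. ennreal (2 * avg e \<rho> s (\<lambda>y. norm (G y)) x) * indicator {\<delta>..\<epsilon>} s \<partial>lborel)"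
proof -
  let ?N = "DIM('a)"
  let ?\<eta> = "mollifier e \<rho>"
  let ?B = "\<integral>z. bump e \<rho> z \<partial>lborel"
  define D where "D s y = - ((1 / s) ^ (?N + 1) * cone_field_div e \<rho> ((1 / s) *\<^sub>R (y - x)))" for s y
  define K where "K s y = (1 / s) ^ ?N * ?\<eta> ((1 / s) *\<^sub>R (y - x))" for s y
  have [measurable]: "u \<in> borel_measurable borel" "G \<in> borel_measurable borel" using u G by auto
  have Dm[measurable]: "(\<lambda>(s, y). D s y) \<in> borel_measurable (borel \<Otimes>\<^sub>M borel)"
    unfolding D_def by measurable
  obtain Z where Z: "Z > 0" "\<And>w. \<bar>cone_field_div e \<rho> w\<bar> \<le> Z"
    using cone_field_div_bounded[OF \<rho>(1), of e] by metis
  define Z' where "Z' = (1 / \<delta>) ^ (?N + 1) * Z"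
  have Z'0: "0 \<le> Z'" using Z \<delta> by (simp add: Z'_def)
  have Db: "\<bar>D s y\<bar> \<le> Z'" if "\<delta> \<le> s" for s y
  proof -
    have "\<bar>D s y\<bar> = (1 / s) ^ (?N + 1) * \<bar>cone_field_div e \<rho> ((1 / s) *\<^sub>R (y - x))\<bar>"
      using that \<delta> by (simp add: D_def abs_mult)
    also have "\<dots> \<le> Z'" unfolding Z'_def
      using that \<delta> Z by (intro mult_mono power_mono) (auto simp: frac_le)
    finally show ?thesis .
  qed
  \<comment> \<open>the fundamental theorem of calculus in \<open>s\<close>\<close>
  have FTC: "(\<integral>s. D s y * indicator {\<delta>..\<epsilon>} s \<partial>lborel) = K \<epsilon> y - K \<delta> y" for y
  proof (rule integral_FTC_Icc_real)
    show "DERIV (\<lambda>s. K s y) s :> D s y" if "\<delta> \<le> s" "s \<le> \<epsilon>" for s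
      unfolding K_def D_def by (rule kernel_has_s_derivative) (use that \<delta> in auto)
    show "isCont (\<lambda>s. D s y) s" if "\<delta> \<le> s" "s \<le> \<epsilon>" for s
      unfolding D_def using that \<delta>
      by (intro continuous_intros isCont_o2[OF _ continuous_on_interior[OF cone_field_div_continuous_on[of UNIV]]]) auto
  qed (fact \<delta>)
  have int: "integrable (lborel \<Otimes>\<^sub>M lborel) (\<lambda>(s, y). u y * (D s y * indicator {\<delta>..\<epsilon>} s))"
  proof (rule integrableI_bounded)
    have "(\<integral>\<^sup>+p. ennreal (norm (case p of (s, y) \<Rightarrow> u y * (D s y * indicator {\<delta>..\<epsilon>} s))) \<partial>(lborel \<Otimes>\<^sub>M lborel))
       = (\<integral>\<^sup>+s. \<integral>\<^sup>+y. ennreal \<bar>u y * (D s y * indicator {\<delta>..\<epsilon>} s)\<bar> \<partial>lborel \<partial>lborel)"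
      by (subst lborel.nn_integral_fst[symmetric]) auto
    also have "\<dots> \<le> (\<integral>\<^sup>+s. \<integral>\<^sup>+y. ennreal \<bar>u y\<bar> * (ennreal Z' * indicator {\<delta>..\<epsilon>} s) \<partial>lborel \<partial>lborel)"
    proof (intro nn_integral_mono)
      fix s y
      show "ennreal \<bar>u y * (D s y * indicator {\<delta>..\<epsilon>} s)\<bar> \<le> ennreal \<bar>u y\<bar> * (ennreal Z' * indicator {\<delta>..\<epsilon>} s)"
        using Db[of s y] Z'0
        by (auto simp: abs_mult indicator_def mult_left_mono simp flip: ennreal_mult intro!: ennreal_leI)
    qed
    also have "\<dots> = (\<integral>\<^sup>+y. ennreal \<bar>u y\<bar> \<partial>lborel) * (ennreal Z' * emeasure lborel {\<delta>..\<epsilon>})"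
      by (simp add: nn_integral_multc nn_integral_cmult)
    also have "\<dots> < \<infinity>"
      using u \<delta> by (simp add: integrable_iff_bounded ennreal_mult_less_top)
    finally show "(\<integral>\<^sup>+p. ennreal (norm (case p of (s, y) \<Rightarrow> u y * (D s y * indicator {\<delta>..\<epsilon>} s))) \<partial>(lborel \<Otimes>\<^sub>M lborel)) < \<infinity>" .
  qed measurable
  obtain C where C: "C > 0" "\<And>z. \<bar>?\<eta> z\<bar> \<le> C" using mollifier_abs_bounded[OF \<rho>(1), of e] by metis
  have Ki: "integrable lborel (\<lambda>y. u y * K s y)" if "s > 0" for s
    unfolding K_def using C that
    by (intro integrable_mult_bounded_fun[OF u, of _ "(1/s)^?N * C"]) (auto simp: abs_mult mult_left_mono)
  have avgK: "avg e \<rho> s v x = (\<integral>y. v y * K s y \<partial>lborel)"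
    if "s > 0" "v \<in> borel_measurable borel" for s and v :: "'a \<Rightarrow> real"
    unfolding avg_eq_convolution[OF that(2,1)] integral_mult_right_zero[symmetric] K_def
    by (simp only: mult.left_commute)
  define F where "F s = (\<integral>y. u y * D s y \<partial>lborel)" for s
  have "avg e \<rho> \<epsilon> u x - avg e \<rho> \<delta> u x = (\<integral>y. u y * K \<epsilon> y - u y * K \<delta> y \<partial>lborel)"
    using \<delta> by (simp add: avgK Ki)
  also have "\<dots> = (\<integral>y. (\<integral>s. u y * (D s y * indicator {\<delta>..\<epsilon>} s) \<partial>lborel) \<partial>lborel)"
    by (simp add: FTC right_diff_distrib)
  also have "\<dots> = (\<integral>s. (\<integral>y. u y * (D s y * indicator {\<delta>..\<epsilon>} s) \<partial>lborel) \<partial>lborel)"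
    using int by (rule lborel_pair.Fubini_integral)
  also have "\<dots> = (\<integral>s. F s * indicator {\<delta>..\<epsilon>} s \<partial>lborel)"
    by (intro Bochner_Integration.integral_cong refl) (simp add: F_def flip: mult.assoc)
  finally have avg_F: "avg e \<rho> \<epsilon> u x - avg e \<rho> \<delta> u x = (\<integral>s. F s * indicator {\<delta>..\<epsilon>} s \<partial>lborel)" .
  have Fi: "integrable lborel (\<lambda>s. F s * indicator {\<delta>..\<epsilon>} s)"
    using lborel_pair.integrable_fst[OF int] by (simp add: F_def flip: mult.assoc)
  have Fb: "\<bar>F s\<bar> \<le> 2 * avg e \<rho> s (\<lambda>y. norm (G y)) x" if s: "\<delta> \<le> s" "s \<le> \<epsilon>" for s
  proof -
    have s0: "s > 0" using s \<delta> by simp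
    define \<phi> where "\<phi> b y = ((y - x) \<bullet> b) * ((1 / s) ^ (?N + 1) * ?\<eta> ((1 / s) *\<^sub>R (y - x)))" for b y
    have sm: "smooth (\<phi> b)" for b
    proof -
      have "smooth (\<lambda>y. (y - x) \<bullet> b)"
        unfolding inner_diff_left by (intro smooth_diff smooth_inner smooth_const)
      then show ?thesis unfolding \<phi>_def by (intro smooth_mult smooth_const mollifier_smooth)
    qed
    have supp: "\<phi> b y = 0" if "y \<notin> (\<lambda>z. x + s *\<^sub>R z) ` cball e \<rho>" for b y
      using mollifier_affine_eq_0[OF \<rho>(1) s0 that] by (simp add: \<phi>_def)
    have test: "\<phi> b \<in> test_functions \<Omega>" for b
      using sm supp cone[OF s]
      by (intro test_functionI[of _ "(\<lambda>z. x + s *\<^sub>R z) ` cball e \<rho>"] compact_continuous_image continuous_intros) auto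
    have pd: "partial_deriv b (\<phi> b) y = (b \<bullet> b) * ((1 / s) ^ (?N + 1) * ?\<eta> ((1 / s) *\<^sub>R (y - x)))
        + ((y - x) \<bullet> b) * ((1 / s) ^ (?N + 1) * (- (2 * (1 / s) * (((1 / s) *\<^sub>R (y - x) - e) \<bullet> b) *
          flat 2 (\<rho>\<^sup>2 - (norm ((1 / s) *\<^sub>R (y - x) - e))\<^sup>2) / ?B)))" for b y
      unfolding \<phi>_def
      by (rule partial_deriv_eq[THEN trans])
        (rule has_derivative_mult[OF has_derivative_inner_left[OF has_derivative_diff[OF has_derivative_ident has_derivative_const]]
          has_derivative_mult_right[OF mollifier_affine_has_derivative]], simp)
    have div: "(\<Sum>b\<in>Basis. partial_deriv b (\<phi> b) y) = - D s y" for y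
    proof -
      define w where "w = (1 / s) *\<^sub>R (y - x)"
      have yx: "y - x = s *\<^sub>R w" using s0 by (simp add: w_def)
      define T where "T = (1 / s) ^ (?N + 1)"
      have D_w: "D s y = - ((1 / s) ^ (?N + 1) * cone_field_div e \<rho> w)" by (simp add: D_def w_def)
      have "(\<Sum>b\<in>Basis. partial_deriv b (\<phi> b) y) = (\<Sum>b\<in>(Basis::'a set). (1 / s) ^ (?N + 1) * ?\<eta> w)
         + (\<Sum>b\<in>Basis. (w \<bullet> b) * ((w - e) \<bullet> b)) * ((1 / s) ^ (?N + 1) * (- (2 * flat 2 (\<rho>\<^sup>2 - (norm (w - e))\<^sup>2) / ?B)))"
        unfolding sum_distrib_right sum.distrib[symmetric]
      proof (rule sum.cong[OF refl])
        fix b :: 'a assume "b \<in> Basis"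
        then show "partial_deriv b (\<phi> b) y = (1 / s) ^ (?N + 1) * ?\<eta> w +
          (w \<bullet> b) * ((w - e) \<bullet> b) * ((1 / s) ^ (?N + 1) * (- (2 * flat 2 (\<rho>\<^sup>2 - (norm (w - e))\<^sup>2) / ?B)))"
          unfolding pd w_def[symmetric] using s0 by (simp add: yx)
      qed
      also have "(\<Sum>b\<in>Basis. (w \<bullet> b) * ((w - e) \<bullet> b)) = (w - e) \<bullet> w"
        by (subst euclidean_inner) (simp add: mult.commute)
      finally show ?thesis
        unfolding D_w cone_field_div_def T_def[symmetric] by (simp add: algebra_simps)
    qed
    have pdb: "\<exists>C. \<forall>y. \<bar>f y\<bar> \<le> C" if f: "f \<in> {\<phi> b, partial_deriv b (\<phi> b)}" and b: "b \<in> Basis" for f and b :: 'a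
    proof -
      let ?S = "(\<lambda>z. x + s *\<^sub>R z) ` cball e \<rho>"
      have cS: "compact ?S" by (intro compact_continuous_image continuous_intros) auto
      have z: "f y = 0" if "y \<notin> ?S" for y
      proof -
        have "partial_deriv b (\<phi> b) y = 0"
        proof (rule partial_deriv_eq)
          show "(\<phi> b has_derivative (\<lambda>h. 0)) (at y)"
            using that supp cS
            by (intro has_derivative_transform_within_open[OF has_derivative_const[of 0], of "- ?S"])
              (auto intro: open_Compl compact_imp_closed)
        qed
        then show ?thesis using f supp[OF that, of b] by blast
      qed
      have "smooth f" using f sm[of b] smooth_partial_deriv[OF sm b] by blast
      then have "bounded (f ` ?S)"
        by (intro compact_imp_bounded compact_continuous_image[OF _ cS] smooth_continuous_on)
      then obtain C where C: "C > 0" "\<And>v. v \<in> f ` ?S \<Longrightarrow> norm v \<le> C"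
        unfolding bounded_pos by blast
      have "\<bar>f y\<bar> \<le> C" for y
        using C(1) C(2)[OF imageI[of y ?S f]] z[of y] by (cases "y \<in> ?S") simp_all
      then show ?thesis by blast
    qed
    have meas: "f \<in> borel_measurable lborel" if "f \<in> {\<phi> b, partial_deriv b (\<phi> b)}" "b \<in> Basis" for f and b :: 'a
      using that sm smooth_partial_deriv[OF sm]
      by (auto intro!: borel_measurable_continuous_onI smooth_continuous_on simp: measurable_lborel1)
    have i1: "integrable lborel (\<lambda>y. u y * partial_deriv b (\<phi> b) y)" if "b \<in> Basis" for b
      using pdb[of "partial_deriv b (\<phi> b)" b] meas[of "partial_deriv b (\<phi> b)" b] that u
      by (auto intro: integrable_mult_bounded_fun)
    have i2: "integrable lborel (\<lambda>y. (G y \<bullet> b) * \<phi> b y)" if "b \<in> Basis" for b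
      using pdb[of "\<phi> b" b] meas[of "\<phi> b" b] that G
      by (auto intro: integrable_mult_bounded_fun)
    have "- F s = (\<integral>y. (\<Sum>b\<in>Basis. u y * partial_deriv b (\<phi> b) y) \<partial>lborel)"
      by (simp add: F_def div flip: sum_distrib_left)
    also have "\<dots> = (\<Sum>b\<in>Basis. (\<integral>y. u y * partial_deriv b (\<phi> b) y \<partial>lborel))"
      using i1 by (rule Bochner_Integration.integral_sum)
    also have "\<dots> = (\<Sum>b\<in>Basis. - (\<integral>y. (G y \<bullet> b) * \<phi> b y \<partial>lborel))"
      using wg test unfolding weak_grad_lborel_def by (intro sum.cong) auto
    finally have "F s = (\<Sum>b\<in>Basis. (\<integral>y. (G y \<bullet> b) * \<phi> b y \<partial>lborel))" by (simp add: sum_negf)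
    also have "\<dots> = (\<integral>y. (\<Sum>b\<in>Basis. (G y \<bullet> b) * \<phi> b y) \<partial>lborel)"
      using i2 by (rule Bochner_Integration.integral_sum[symmetric])
    finally have Feq: "F s = (\<integral>y. (\<Sum>b\<in>Basis. (G y \<bullet> b) * \<phi> b y) \<partial>lborel)" .
    have pt: "norm (\<Sum>b\<in>Basis. (G y \<bullet> b) * \<phi> b y) \<le> 2 * (norm (G y) * K s y)" for y
    proof -
      define w where "w = (1 / s) *\<^sub>R (y - x)"
      have yx: "y - x = s *\<^sub>R w" using s0 by (simp add: w_def)
      have \<eta>0: "0 \<le> ?\<eta> w" by (rule mollifier_nonneg[OF \<rho>(1)])
      have "(\<Sum>b\<in>Basis. (G y \<bullet> b) * \<phi> b y) = (\<Sum>b\<in>Basis. (G y \<bullet> b) * ((y - x) \<bullet> b)) * ((1 / s) ^ (?N + 1) * ?\<eta> w)"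
        unfolding \<phi>_def sum_distrib_right by (simp add: w_def mult.assoc)
      also have "(\<Sum>b\<in>Basis. (G y \<bullet> b) * ((y - x) \<bullet> b)) = G y \<bullet> (y - x)"
        by (rule euclidean_inner[symmetric])
      finally have "norm (\<Sum>b\<in>Basis. (G y \<bullet> b) * \<phi> b y) = \<bar>G y \<bullet> w\<bar> * ((1 / s) ^ ?N * ?\<eta> w)"
        using s0 \<eta>0 by (simp add: yx abs_mult)
      also have "\<dots> \<le> (2 * norm (G y)) * ((1 / s) ^ ?N * ?\<eta> w)"
      proof (cases "w \<in> ball e \<rho>")
        case True
        then have "norm w \<le> 2" using norm_le_2_of_cone[OF e \<rho>(2), of w] by simp
        then have "\<bar>G y \<bullet> w\<bar> \<le> norm (G y) * 2"
          by (meson Cauchy_Schwarz_ineq2 mult_left_mono norm_ge_zero order_trans)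
        then show ?thesis using s0 \<eta>0 by (intro mult_right_mono) auto
      next
        case False
        then show ?thesis using mollifier_eq_0[OF \<rho>(1), of w e] by simp
      qed
      finally show ?thesis by (simp add: K_def w_def)
    qed
    have "\<bar>F s\<bar> \<le> (\<integral>y. norm (\<Sum>b\<in>Basis. (G y \<bullet> b) * \<phi> b y) \<partial>lborel)"
      unfolding Feq using integral_norm_bound[of lborel "\<lambda>y. \<Sum>b\<in>Basis. (G y \<bullet> b) * \<phi> b y"] by simp
    also have "\<dots> \<le> (\<integral>y. 2 * (norm (G y) * K s y) \<partial>lborel)"
    proof (rule integral_mono[OF _ _ pt])
      show "integrable lborel (\<lambda>y. norm (\<Sum>b\<in>Basis. (G y \<bullet> b) * \<phi> b y))"
        using i2 by (intro integrable_norm Bochner_Integration.integrable_sum) auto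
      have "integrable lborel (\<lambda>y. norm (G y) * K s y)"
        unfolding K_def using C s0 G
        by (intro integrable_mult_bounded_fun[of _ _ _ "(1/s)^?N * C"]) (auto simp: abs_mult mult_left_mono)
      then show "integrable lborel (\<lambda>y. 2 * (norm (G y) * K s y))" by simp
    qed
    also have "\<dots> = 2 * avg e \<rho> s (\<lambda>y. norm (G y)) x" using s0 by (simp add: avgK)
    finally show ?thesis .
  qed
  have "ennreal \<bar>avg e \<rho> \<epsilon> u x - avg e \<rho> \<delta> u x\<bar> \<le> (\<integral>\<^sup>+s. ennreal (norm (F s * indicator {\<delta>..\<epsilon>} s)) \<partial>lborel)"
    unfolding avg_F using integral_norm_bound_ennreal[OF Fi] by simp
  also have "\<dots> \<le> (\<integral>\<^sup>+s. ennreal (2 * avg e \<rho> s (\<lambda>y. norm (G y)) x) * indicator {\<delta>..\<epsilon>} s \<partial>lborel)"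
    using Fb by (intro nn_integral_mono) (auto simp: indicator_def intro!: ennreal_leI)
  finally show ?thesis .
qed

section \<open>The error of averaging in a subcritical Lebesgue norm\<close>

lemma nn_integral_powr_Ioc:
  assumes "a > -1" "0 \<le> c"
  shows "(\<integral>\<^sup>+s. ennreal (s powr a) * indicator {0<..c} s \<partial>lborel) = ennreal (c powr (a + 1) / (a + 1))"
proof -
  have "(\<integral>\<^sup>+s. ennreal (s powr a) * indicator {0<..c} s \<partial>lborel) = (\<integral>\<^sup>+s. ennreal (s powr a) * indicator {0..c} s \<partial>lborel)"
    by (intro nn_integral_cong) (auto simp: indicator_def)
  also have "\<dots> = ennreal (c powr (a + 1) / (a + 1))"
    by (rule nn_integral_has_integral_lebesgue'[OF _ has_integral_powr_from_0[OF assms]]) auto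
  finally show ?thesis .
qed

lemma avg_powr_le:
  fixes g :: "'a::euclidean_space \<Rightarrow> real"
  assumes g: "integrable lborel g" "\<And>x. 0 \<le> g x" and \<rho>: "0 < \<rho>" and p: "1 \<le> p" and s: "0 < s"
  shows "ennreal (avg e \<rho> s g x powr p) \<le> ennreal (2 powr p) *
      (\<integral>\<^sup>+z. ennreal (mollifier e \<rho> z * g (x + s *\<^sub>R z) powr p) \<partial>lborel)"
proof -
  have [measurable]: "g \<in> borel_measurable borel" using g by simp
  have "ennreal (avg e \<rho> s g x powr p) \<le> ennreal (2 powr p * 1 powr (p - 1)) *
      (\<integral>\<^sup>+z. ennreal (mollifier e \<rho> z * g (x + s *\<^sub>R z) powr p) \<partial>lborel)"
  proof (rule powr_le_weighted_nn_integral)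
    show "ennreal (avg e \<rho> s g x) \<le> (\<integral>\<^sup>+z. ennreal (mollifier e \<rho> z * g (x + s *\<^sub>R z)) \<partial>lborel)"
      using avg_integrand_integrable[OF g(1) \<rho> s, of x e] g(2) mollifier_nonneg[OF \<rho>, of e]
      by (subst nn_integral_eq_integral) (simp_all add: avg_def mult.commute)
  qed (use g p \<rho> in \<open>auto simp: mollifier_nonneg mollifier_nn_integral avg_nonneg\<close>)
  then show ?thesis by simp
qed

text \<open>Subcriticality of \<open>r\<close> says \<open>r + N - N * (r / p) > 0\<close>, the value of the left-hand side plus one at
  \<open>b = 1\<close>; there is room to take \<open>b\<close> slightly smaller.\<close>

lemma exponent_room:
  fixes N p r :: real
  assumes "1 \<le> p" "p \<le> r" "r * (N - p) < N * p"
  obtains b where "0 < b" "b < 1" "- b + b * r - N * (r / p - 1) > -1"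
proof -
  define \<tau> where "\<tau> = r + N - N * (r / p)"
  have "p * \<tau> > 0" using assms by (simp add: \<tau>_def algebra_simps)
  then have \<tau>: "\<tau> > 0" using assms by (simp add: zero_less_mult_iff)
  \<comment> \<open>\<open>a = 1 - b\<close> is small enough that \<open>a * (r - 1)\<close> does not use up \<open>\<tau>\<close>\<close>
  define a where "a = min (1/2) (\<tau> / (2 * r))"
  have a: "0 < a" "a \<le> 1/2" using \<tau> assms by (auto simp: a_def)
  have "a * (r - 1) \<le> \<tau> / (2 * r) * r"
    using assms \<tau> by (intro mult_mono) (auto simp: a_def)
  also have "\<dots> < \<tau>" using assms \<tau> by simp
  finally have "- (1 - a) + (1 - a) * r - N * (r / p - 1) > -1"
    by (simp add: \<tau>_def algebra_simps)
  with a that[of "1 - a"] show ?thesis by auto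
qed

text \<open>Letting the inner scale tend to zero along a sequence: by Fatou's lemma almost every \<open>x\<close> has
  scales at which the average is arbitrarily close to \<open>u x\<close>.\<close>

lemma diff_avg_le:
  fixes u :: "'a::euclidean_space \<Rightarrow> real"
  assumes u: "integrable lborel u" and G: "integrable lborel G" and wg: "weak_grad_lborel \<Omega> u G"
    and \<rho>: "0 < \<rho>" "\<rho> \<le> 1" and e: "norm e = 1" and \<epsilon>: "0 < \<epsilon>"
    and [measurable]: "A' \<in> sets borel" and A': "A' \<subseteq> \<Omega>"
    and cone: "\<And>x s z. x \<in> A \<Longrightarrow> 0 < s \<Longrightarrow> s \<le> \<epsilon> \<Longrightarrow> z \<in> cball e \<rho> \<Longrightarrow> x + s *\<^sub>R z \<in> A'"
  shows "AE x in lborel. x \<in> A \<longrightarrow> ennreal \<bar>u x - avg e \<rho> \<epsilon> u x\<bar> \<le>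
     (\<integral>\<^sup>+s. ennreal (2 * avg e \<rho> s (\<lambda>y. norm (G y) * indicator A' y) x) * indicator {0<..\<epsilon>} s \<partial>lborel)"
proof -
  have [measurable]: "u \<in> borel_measurable borel" "G \<in> borel_measurable borel" using u G by auto
  define \<delta> where "\<delta> n = \<epsilon> / real (Suc n)" for n
  have \<delta>: "0 < \<delta> n" "\<delta> n \<le> \<epsilon>" for n using \<epsilon> by (auto simp: \<delta>_def field_simps)
  have \<delta>0: "\<delta> \<longlonglongrightarrow> 0" unfolding \<delta>_def by (rule LIMSEQ_Suc[OF lim_const_over_n])
  let ?a = "\<lambda>n x. ennreal \<bar>avg e \<rho> (\<delta> n) u x - u x\<bar>"
  have "(\<integral>\<^sup>+x. liminf (\<lambda>n. ?a n x) \<partial>lborel) \<le> liminf (\<lambda>n. \<integral>\<^sup>+x. ?a n x \<partial>lborel)"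
    by (rule nn_integral_liminf) measurable
  also have "\<dots> = 0"
    using avg_tendsto_L1[OF u \<rho>(1) \<delta>(1) \<delta>0, of e] by (rule lim_imp_Liminf[OF sequentially_bot])
  finally have "AE x in lborel. liminf (\<lambda>n. ?a n x) = 0"
    by (subst (asm) le_zero_eq, subst (asm) nn_integral_0_iff_AE) auto
  then show ?thesis
  proof (rule eventually_mono, intro impI)
    fix x assume lim: "liminf (\<lambda>n. ?a n x) = 0" and x: "x \<in> A"
    let ?R = "\<integral>\<^sup>+s. ennreal (2 * avg e \<rho> s (\<lambda>y. norm (G y) * indicator A' y) x) * indicator {0<..\<epsilon>} s \<partial>lborel"
    show "ennreal \<bar>u x - avg e \<rho> \<epsilon> u x\<bar> \<le> ?R"
    proof (rule ennreal_le_epsilon)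
      fix c :: real assume c: "0 < c"
      obtain n where n: "?a n x < ennreal c"
      proof (rule ccontr)
        assume "\<not> thesis"
        then have "\<forall>n. ennreal c \<le> ?a n x" using that by (meson not_le)
        then have "ennreal c \<le> liminf (\<lambda>n. ?a n x)" by (intro Liminf_bounded) auto
        then show False using lim c by simp
      qed
      have "ennreal \<bar>avg e \<rho> \<epsilon> u x - avg e \<rho> (\<delta> n) u x\<bar> \<le>
         (\<integral>\<^sup>+s. ennreal (2 * avg e \<rho> s (\<lambda>y. norm (G y)) x) * indicator {\<delta> n..\<epsilon>} s \<partial>lborel)"
        by (rule avg_diff_le[OF u G wg \<rho> e \<delta>]) (use cone[OF x] \<delta>[of n] A' in force)
      also have "\<dots> \<le> ?R"
      proof (rule nn_integral_mono)
        fix s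
        show "ennreal (2 * avg e \<rho> s (\<lambda>y. norm (G y)) x) * indicator {\<delta> n..\<epsilon>} s
          \<le> ennreal (2 * avg e \<rho> s (\<lambda>y. norm (G y) * indicator A' y) x) * indicator {0<..\<epsilon>} s"
        proof (cases "s \<in> {\<delta> n..\<epsilon>}")
          case True
          then have "avg e \<rho> s (\<lambda>y. norm (G y)) x = avg e \<rho> s (\<lambda>y. norm (G y) * indicator A' y) x"
            using cone[OF x, of s] \<delta>[of n] by (intro avg_cong[OF \<rho>(1)]) auto
          then show ?thesis using True \<delta>[of n] by simp
        qed simp
      qed
      finally have "ennreal \<bar>avg e \<rho> \<epsilon> u x - avg e \<rho> (\<delta> n) u x\<bar> \<le> ?R" .
      moreover have "ennreal \<bar>u x - avg e \<rho> \<epsilon> u x\<bar> \<le> ennreal \<bar>avg e \<rho> \<epsilon> u x - avg e \<rho> (\<delta> n) u x\<bar> + ?a n x"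
        by (simp flip: ennreal_plus)
      ultimately show "ennreal \<bar>u x - avg e \<rho> \<epsilon> u x\<bar> \<le> ?R + ennreal c"
        using n by (meson add_mono less_imp_le order_trans)
    qed
  qed
qed

text \<open>Write \<open>g\<close> for the norm of the gradient on the piece and \<open>Q s x\<close> for the average of \<open>g powr p\<close>. Jensen's inequality with the weight
  \<open>s powr (- b)\<close> on \<open>{0<..\<epsilon>}\<close> bounds the \<open>r\<close>-th power of the error by an integral over \<open>s\<close> of \<open>(avg g) powr r\<close>. One factor
  \<open>(avg g) powr p\<close> is kept and integrated in \<open>x\<close>, the remaining power is bounded pointwise by \<open>Q s x \<le> const * s powr (- N)\<close>. What
  is left is a power of \<open>s\<close> that is integrable at zero, by \<open>exponent_room\<close>.\<close>

proposition avg_error_Lr: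
  fixes e :: "'a::euclidean_space"
  assumes \<rho>: "0 < \<rho>" "\<rho> \<le> 1" and e: "norm e = 1"
    and pr: "1 \<le> p" "p \<le> r" "r * (real DIM('a) - p) < real DIM('a) * p" and K: "0 < K"
  obtains C \<theta> where "0 < C" "0 < \<theta>"
    "\<And>u G \<Omega> A A' \<epsilon>. \<lbrakk>integrable lborel u; integrable lborel G; weak_grad_lborel \<Omega> u G;
       A \<in> sets borel; A' \<in> sets borel; A' \<subseteq> \<Omega>; 0 < \<epsilon>; \<epsilon> \<le> 1;
       \<And>x s z. x \<in> A \<Longrightarrow> 0 < s \<Longrightarrow> s \<le> \<epsilon> \<Longrightarrow> z \<in> cball e \<rho> \<Longrightarrow> x + s *\<^sub>R z \<in> A';
       (\<integral>\<^sup>+y. ennreal (norm (G y) powr p) * indicator A' y \<partial>lborel) \<le> ennreal K\<rbrakk> \<Longrightarrow>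
       (\<integral>\<^sup>+x. ennreal (\<bar>u x - avg e \<rho> \<epsilon> u x\<bar> powr r) * indicator A x \<partial>lborel) \<le> ennreal (C * \<epsilon> powr \<theta>)"
proof -
  let ?N = "real DIM('a)"
  let ?\<eta> = "mollifier e \<rho>"
  obtain b where b: "0 < b" "b < 1" "- b + b * r - ?N * (r / p - 1) > -1"
    using exponent_room[OF pr] by blast
  define \<alpha> where "\<alpha> = - b + b * r - ?N * (r / p - 1)"
  obtain M where M: "M > 0" "\<And>z. ?\<eta> z \<le> M" using mollifier_bounded[OF \<rho>(1), of e] by blast
  \<comment> \<open>\<open>W\<close> bounds the mass of the weight \<open>s powr (- b)\<close>; \<open>c1\<close> comes from the pointwise bound, \<open>c3\<close> from Jensen in \<open>s\<close>\<close>
  define W where "W = 1 / (1 - b)"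
  define c1 where "c1 = 2 powr p * (M * K)"
  define c2 where "c2 = 2 powr r * (c1 powr (r / p - 1) * 2 powr p)"
  define c3 where "c3 = 2 powr r * W powr (r - 1)"
  define C where "C = c3 * (c2 * (K / (\<alpha> + 1)))"
  have pos: "W > 0" "c1 > 0" "c2 > 0" "c3 > 0" "\<alpha> + 1 > 0"
    using b M K by (auto simp: W_def c1_def c2_def c3_def \<alpha>_def)
  then have C: "C > 0" using K by (simp add: C_def)
  show ?thesis
  proof (rule that[OF C pos(5)])
    fix u G \<Omega> A A' and \<epsilon> :: real
    assume u: "integrable lborel u" and G: "integrable lborel G" and wg: "weak_grad_lborel \<Omega> u G"
      and [measurable]: "A \<in> sets borel" "A' \<in> sets borel" and A': "A' \<subseteq> \<Omega>" and \<epsilon>: "0 < \<epsilon>" "\<epsilon> \<le> 1"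
      and cone: "\<And>x s z. x \<in> A \<Longrightarrow> 0 < s \<Longrightarrow> s \<le> \<epsilon> \<Longrightarrow> z \<in> cball e \<rho> \<Longrightarrow> x + s *\<^sub>R z \<in> A'"
      and GK: "(\<integral>\<^sup>+y. ennreal (norm (G y) powr p) * indicator A' y \<partial>lborel) \<le> ennreal K"
    have [measurable]: "u \<in> borel_measurable borel" "G \<in> borel_measurable borel" using u G by auto
    define g where "g y = norm (G y) * indicator A' y" for y
    have g0: "0 \<le> g y" for y by (simp add: g_def)
    have gi: "integrable lborel g"
      unfolding g_def using G by (intro integrable_mult_bounded_fun[where C=1]) (auto simp: indicator_def)
    have [measurable]: "g \<in> borel_measurable borel" using gi by simp
    have gK: "(\<integral>\<^sup>+y. ennreal (g y powr p) \<partial>lborel) \<le> ennreal K"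
      using GK by (rule order_trans[rotated]) (auto simp: g_def indicator_def intro!: nn_integral_mono)
    define Q where "Q s x = (\<integral>\<^sup>+z. ennreal (?\<eta> z * g (x + s *\<^sub>R z) powr p) \<partial>lborel)" for s x
    have [measurable]: "(\<lambda>(s, x). Q s x) \<in> borel_measurable (borel \<Otimes>\<^sub>M borel)"
      unfolding Q_def by measurable
    have avgQ: "ennreal (avg e \<rho> s g x powr p) \<le> ennreal (2 powr p) * Q s x" if "0 < s" for s x
      unfolding Q_def by (rule avg_powr_le[OF gi g0 \<rho>(1) pr(1) that])
    have Qsup: "Q s x \<le> ennreal (M * K * s powr (- ?N))" if s: "0 < s" for s x
    proof -
      have "Q s x \<le> (\<integral>\<^sup>+z. ennreal M * ennreal (g (x + s *\<^sub>R z) powr p) \<partial>lborel)"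
        unfolding Q_def using M
        by (intro nn_integral_mono) (auto simp flip: ennreal_mult intro!: ennreal_leI mult_right_mono)
      also have "\<dots> = ennreal M * (ennreal ((1 / s) ^ DIM('a)) * (\<integral>\<^sup>+y. ennreal (g y powr p) \<partial>lborel))"
        using nn_integral_rescale[of "\<lambda>y. ennreal (g y powr p)" s x] s by (simp add: nn_integral_cmult)
      also have "\<dots> \<le> ennreal M * (ennreal ((1 / s) ^ DIM('a)) * ennreal K)"
        using gK by (intro mult_left_mono) auto
      also have "\<dots> = ennreal (M * K * s powr (- ?N))"
        using M K s by (simp add: powr_minus powr_realpow power_one_over field_simps flip: ennreal_mult)
      finally show ?thesis .
    qed
    have Qint: "(\<integral>\<^sup>+x. Q s x \<partial>lborel) \<le> ennreal K" for s
    proof -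
      have "(\<integral>\<^sup>+x. Q s x \<partial>lborel) = (\<integral>\<^sup>+z. \<integral>\<^sup>+x. ennreal (?\<eta> z * g (x + s *\<^sub>R z) powr p) \<partial>lborel \<partial>lborel)"
        unfolding Q_def by (subst lborel_pair.Fubini') auto
      also have "\<dots> = (\<integral>\<^sup>+z. ennreal (?\<eta> z) * (\<integral>\<^sup>+x. ennreal (g (x + s *\<^sub>R z) powr p) \<partial>lborel) \<partial>lborel)"
        by (intro nn_integral_cong, subst nn_integral_cmult[symmetric])
          (auto simp: mollifier_nonneg[OF \<rho>(1)] ennreal_mult)
      also have "\<dots> = (\<integral>\<^sup>+z. ennreal (?\<eta> z) * (\<integral>\<^sup>+x. ennreal (g x powr p) \<partial>lborel) \<partial>lborel)"
        by (subst nn_integral_translate[of "\<lambda>x. ennreal (g x powr p)"]) auto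
      also have "\<dots> = (\<integral>\<^sup>+x. ennreal (g x powr p) \<partial>lborel)"
        by (simp add: nn_integral_multc mollifier_nn_integral[OF \<rho>(1)])
      finally show ?thesis using gK by simp
    qed
    define w where "w s = s powr (- b) * indicator {0<..\<epsilon>} s" for s :: real
    have [measurable]: "w \<in> borel_measurable borel" unfolding w_def by measurable
    define f where "f x s = s powr b * (2 * avg e \<rho> s g x)" for x and s :: real
    have [measurable]: "(\<lambda>(x, s). f x s) \<in> borel_measurable (borel \<Otimes>\<^sub>M borel)" unfolding f_def by measurable
    have wW: "(\<integral>\<^sup>+s. ennreal (w s) \<partial>lborel) \<le> ennreal W"
    proof -
      have "(\<integral>\<^sup>+s. ennreal (w s) \<partial>lborel) = (\<integral>\<^sup>+s. ennreal (s powr (- b)) * indicator {0<..\<epsilon>} s \<partial>lborel)"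
        by (intro nn_integral_cong) (auto simp: w_def indicator_def)
      also have "\<dots> = ennreal (\<epsilon> powr (- b + 1) / (- b + 1))"
        by (rule nn_integral_powr_Ioc) (use b \<epsilon> in auto)
      also have "\<dots> \<le> ennreal W"
        using \<epsilon> b powr_mono2[of "- b + 1" \<epsilon> 1] unfolding W_def
        by (intro ennreal_leI) (simp add: divide_right_mono)
      finally show ?thesis .
    qed
    have wf: "ennreal (w s * f x s powr r) \<le> ennreal (c2 * s powr \<alpha>) * indicator {0<..\<epsilon>} s * Q s x" for s x
    proof (cases "s \<in> {0<..\<epsilon>}")
      case True
      then have s: "s > 0" by simp
      define a where "a = avg e \<rho> s g x"
      have a0: "0 \<le> a" unfolding a_def by (rule avg_nonneg[OF \<rho>(1) g0])
      have "ennreal (a powr p) \<le> ennreal (2 powr p) * ennreal (M * K * s powr (- ?N))"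
        using avgQ[OF s, of x] Qsup[OF s, of x] unfolding a_def
        by (meson mult_left_mono order_trans zero_le)
      also have "\<dots> = ennreal (c1 * s powr (- ?N))" using M K by (simp add: c1_def mult.assoc flip: ennreal_mult)
      finally have "a powr p \<le> c1 * s powr (- ?N)" using pos by (subst (asm) ennreal_le_iff) auto
      then have "(a powr p) powr (r / p - 1) \<le> (c1 * s powr (- ?N)) powr (r / p - 1)"
        using pr by (intro powr_mono2) auto
      also have "\<dots> = c1 powr (r / p - 1) * s powr (- (?N * (r / p - 1)))"
        using pos by (simp add: powr_mult powr_powr)
      finally have ap: "(a powr p) powr (r / p - 1) \<le> c1 powr (r / p - 1) * s powr (- (?N * (r / p - 1)))" .
      have ar: "a powr r = (a powr p) powr (r / p - 1) * a powr p"
        using pr by (cases "a = 0") (simp_all add: powr_powr algebra_simps flip: powr_add)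
      have "w s * f x s powr r = (s powr (- b + b * r) * 2 powr r) * (a powr p) powr (r / p - 1) * a powr p"
        using True a0
        by (simp add: w_def f_def powr_mult powr_powr powr_diff powr_minus divide_inverse ar mult_ac flip: a_def)
      also have "\<dots> \<le> (s powr (- b + b * r) * 2 powr r) * (c1 powr (r / p - 1) * s powr (- (?N * (r / p - 1)))) * a powr p"
        using ap by (intro mult_right_mono mult_left_mono) auto
      also have "\<dots> = (2 powr r * c1 powr (r / p - 1) * s powr \<alpha>) * a powr p"
        by (simp add: \<alpha>_def powr_add powr_diff powr_minus divide_inverse)
      finally have "ennreal (w s * f x s powr r) \<le> ennreal (2 powr r * c1 powr (r / p - 1) * s powr \<alpha>) * ennreal (a powr p)"
        by (simp flip: ennreal_mult)
      also have "\<dots> \<le> ennreal (2 powr r * c1 powr (r / p - 1) * s powr \<alpha>) * (ennreal (2 powr p) * Q s x)"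
        unfolding a_def by (intro mult_left_mono avgQ s) auto
      also have "\<dots> = ennreal (c2 * s powr \<alpha>) * Q s x"
        unfolding mult.assoc[symmetric]
        by (subst ennreal_mult[symmetric]) (auto simp: c2_def mult_ac)
      finally show ?thesis using True by simp
    qed (simp add: w_def)
    have pt: "AE x in lborel. ennreal (\<bar>u x - avg e \<rho> \<epsilon> u x\<bar> powr r) * indicator A x \<le>
      ennreal c3 * (\<integral>\<^sup>+s. ennreal (c2 * s powr \<alpha>) * indicator {0<..\<epsilon>} s * Q s x \<partial>lborel)"
    proof (rule eventually_mono[OF diff_avg_le[OF u G wg \<rho> e \<epsilon>(1) _ A' cone]])
      fix x assume "x \<in> A \<longrightarrow> ennreal \<bar>u x - avg e \<rho> \<epsilon> u x\<bar> \<le>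
         (\<integral>\<^sup>+s. ennreal (2 * avg e \<rho> s (\<lambda>y. norm (G y) * indicator A' y) x) * indicator {0<..\<epsilon>} s \<partial>lborel)"
      then have d: "ennreal \<bar>u x - avg e \<rho> \<epsilon> u x\<bar> \<le>
         (\<integral>\<^sup>+s. ennreal (2 * avg e \<rho> s g x) * indicator {0<..\<epsilon>} s \<partial>lborel)" if "x \<in> A"
        using that unfolding g_def by blast
      show "ennreal (\<bar>u x - avg e \<rho> \<epsilon> u x\<bar> powr r) * indicator A x \<le>
         ennreal c3 * (\<integral>\<^sup>+s. ennreal (c2 * s powr \<alpha>) * indicator {0<..\<epsilon>} s * Q s x \<partial>lborel)"
      proof (cases "x \<in> A")
        case True
        have "(\<integral>\<^sup>+s. ennreal (2 * avg e \<rho> s g x) * indicator {0<..\<epsilon>} s \<partial>lborel) = (\<integral>\<^sup>+s. ennreal (w s * f x s) \<partial>lborel)"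
          by (intro nn_integral_cong) (auto simp: w_def f_def indicator_def powr_minus field_simps)
        then have "ennreal (\<bar>u x - avg e \<rho> \<epsilon> u x\<bar> powr r) \<le> ennreal c3 * (\<integral>\<^sup>+s. ennreal (w s * f x s powr r) \<partial>lborel)"
          unfolding c3_def using d[OF True] wW pos pr
          by (intro powr_le_weighted_nn_integral) (auto simp: w_def f_def avg_nonneg[OF \<rho>(1) g0])
        also have "\<dots> \<le> ennreal c3 * (\<integral>\<^sup>+s. ennreal (c2 * s powr \<alpha>) * indicator {0<..\<epsilon>} s * Q s x \<partial>lborel)"
          using wf by (intro mult_left_mono nn_integral_mono) auto
        finally show ?thesis using True by simp
      qed simp
    qed auto
    have "(\<integral>\<^sup>+x. ennreal (\<bar>u x - avg e \<rho> \<epsilon> u x\<bar> powr r) * indicator A x \<partial>lborel) \<le>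
       (\<integral>\<^sup>+x. ennreal c3 * (\<integral>\<^sup>+s. ennreal (c2 * s powr \<alpha>) * indicator {0<..\<epsilon>} s * Q s x \<partial>lborel) \<partial>lborel)"
      by (rule nn_integral_mono_AE[OF pt])
    also have "\<dots> = ennreal c3 * (\<integral>\<^sup>+s. \<integral>\<^sup>+x. ennreal (c2 * s powr \<alpha>) * indicator {0<..\<epsilon>} s * Q s x \<partial>lborel \<partial>lborel)"
      by (subst nn_integral_cmult, measurable, subst lborel_pair.Fubini') auto
    also have "\<dots> = ennreal c3 * (\<integral>\<^sup>+s. ennreal (c2 * s powr \<alpha>) * indicator {0<..\<epsilon>} s * (\<integral>\<^sup>+x. Q s x \<partial>lborel) \<partial>lborel)"
      by (subst nn_integral_cmult) auto
    also have "\<dots> \<le> ennreal c3 * (\<integral>\<^sup>+s. ennreal (c2 * s powr \<alpha>) * indicator {0<..\<epsilon>} s * ennreal K \<partial>lborel)"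
      using Qint by (intro mult_left_mono nn_integral_mono) auto
    also have "\<dots> = ennreal c3 * (ennreal c2 * (ennreal K * (\<integral>\<^sup>+s. ennreal (s powr \<alpha>) * indicator {0<..\<epsilon>} s \<partial>lborel)))"
      using pos by (simp add: nn_integral_multc nn_integral_cmult ennreal_mult mult_ac)
    also have "\<dots> = ennreal c3 * (ennreal c2 * (ennreal K * ennreal (\<epsilon> powr (\<alpha> + 1) / (\<alpha> + 1))))"
      using pos \<epsilon> by (subst nn_integral_powr_Ioc) auto
    also have "\<dots> = ennreal (C * \<epsilon> powr (\<alpha> + 1))"
      using pos K by (simp add: C_def flip: ennreal_mult)
    finally show "(\<integral>\<^sup>+x. ennreal (\<bar>u x - avg e \<rho> \<epsilon> u x\<bar> powr r) * indicator A x \<partial>lborel) \<le> ennreal (C * \<epsilon> powr (\<alpha> + 1))" .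
  qed
qed

section \<open>Compactness on one piece of the domain\<close>

text \<open>At a fixed scale the averages are convolutions of functions bounded in \<open>L\<^sup>1\<close> with one fixed kernel, hence
  uniformly bounded and equicontinuous.\<close>

lemma avg_uniformly_cauchy_subseq:
  fixes u :: "nat \<Rightarrow> 'a::euclidean_space \<Rightarrow> real"
  assumes u: "\<And>n. integrable lborel (u n)" and B: "\<And>n. (\<integral>x. \<bar>u n x\<bar> \<partial>lborel) \<le> B"
    and S: "compact S" "\<And>n x. x \<notin> S \<Longrightarrow> u n x = 0" and \<rho>: "0 < \<rho>" and s: "0 < s"
  obtains k where "strict_mono (k :: nat \<Rightarrow> nat)"
    "\<And>c. 0 < c \<Longrightarrow> \<exists>N. \<forall>m\<ge>N. \<forall>n\<ge>N. \<forall>x\<in>S. \<bar>avg e \<rho> s (u (k m)) x - avg e \<rho> s (u (k n)) x\<bar> < c"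
proof -
  let ?\<eta> = "mollifier e \<rho>"
  let ?D = "(1 / s) ^ DIM('a)"
  have [measurable]: "u n \<in> borel_measurable borel" for n using u[of n] by simp
  obtain C where C: "C > 0" "\<And>z. \<bar>?\<eta> z\<bar> \<le> C" using mollifier_abs_bounded[OF \<rho>, of e] by blast
  have B0: "0 \<le> B" using B[of 0] by (rule order_trans[rotated]) simp
  have conv: "avg e \<rho> s (u n) x = ?D * (\<integral>y. u n y * ?\<eta> ((1 / s) *\<^sub>R (y - x)) \<partial>lborel)" for n x
    by (rule avg_eq_convolution[OF _ s]) simp
  have i: "integrable lborel (\<lambda>y. u n y * ?\<eta> ((1 / s) *\<^sub>R (y - x)))" for n x
    by (rule integrable_mult_bounded_fun[OF u, of _ C]) (use C in auto)
  have D: "?D > 0" using s by simp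
  have bd: "\<bar>\<integral>y. u n y * h y \<partial>lborel\<bar> \<le> c * B"
    if [measurable]: "h \<in> borel_measurable borel" and h: "\<And>y. y \<in> S \<Longrightarrow> \<bar>h y\<bar> \<le> c" and c: "0 \<le> c" for h c n
  proof -
    have le: "\<bar>u n y * h y\<bar> \<le> c * \<bar>u n y\<bar>" for y
      using h[of y] S(2)[of y n] mult_left_mono[of "\<bar>h y\<bar>" c "\<bar>u n y\<bar>"]
      by (cases "y \<in> S") (auto simp: abs_mult mult.commute)
    have "\<bar>\<integral>y. u n y * h y \<partial>lborel\<bar> \<le> (\<integral>y. \<bar>u n y * h y\<bar> \<partial>lborel)"
      by (rule integral_abs_bound)
    also have "\<dots> \<le> (\<integral>y. c * \<bar>u n y\<bar> \<partial>lborel)"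
    proof (rule integral_mono'[OF _ le])
      show "integrable lborel (\<lambda>y. c * \<bar>u n y\<bar>)" using u[of n] by simp
    qed (use c in auto)
    also have "\<dots> \<le> c * B" using B[of n] c by (simp add: mult_left_mono)
    finally show ?thesis .
  qed
  obtain g k where k: "strict_mono (k :: nat \<Rightarrow> nat)"
    and lim: "\<And>c. 0 < c \<Longrightarrow> \<exists>N. \<forall>n x. n \<ge> N \<and> x \<in> S \<longrightarrow> norm (avg e \<rho> s (u (k n)) x - g x) < c"
  proof (rule Arzela_Ascoli[OF S(1), of "\<lambda>n. avg e \<rho> s (u n)" "?D * (C * B)"])
    show "norm (avg e \<rho> s (u n) x) \<le> ?D * (C * B)" for n x
      unfolding conv using bd[of "\<lambda>y. ?\<eta> ((1 / s) *\<^sub>R (y - x))" C n] C D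
      by (simp add: abs_mult)
  next
    fix x and c :: real assume x: "x \<in> S" and c: "0 < c"
    define T where "T = (\<lambda>(x, y). (1 / s) *\<^sub>R (y - x)) ` (S \<times> S)"
    have "compact T" unfolding T_def split_def
      by (intro compact_continuous_image compact_Times S continuous_intros)
    then have "uniformly_continuous_on T ?\<eta>"
      by (intro compact_uniformly_continuous mollifier_continuous_on)
    moreover define c' where "c' = c / (2 * ?D * (B + 1))"
    moreover have c': "c' > 0" using c D B0 by (auto simp: c'_def)
    ultimately obtain d where d: "d > 0" "\<And>a b. a \<in> T \<Longrightarrow> b \<in> T \<Longrightarrow> dist b a < d \<Longrightarrow> dist (?\<eta> b) (?\<eta> a) < c'"
      unfolding uniformly_continuous_on_def by metis
    show "\<exists>d>0. \<forall>n y. y \<in> S \<and> norm (x - y) < d \<longrightarrow> norm (avg e \<rho> s (u n) x - avg e \<rho> s (u n) y) < c"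
    proof (intro exI[of _ "d * s"] conjI allI impI)
      show "d * s > 0" using d s by simp
      fix n x' assume x': "x' \<in> S \<and> norm (x - x') < d * s"
      have "\<bar>?\<eta> ((1 / s) *\<^sub>R (y - x)) - ?\<eta> ((1 / s) *\<^sub>R (y - x'))\<bar> \<le> c'" if "y \<in> S" for y
      proof -
        have "dist ((1 / s) *\<^sub>R (y - x)) ((1 / s) *\<^sub>R (y - x')) = (1 / s) * norm (x - x')"
          using s by (simp add: dist_norm flip: scaleR_diff_right) (metis norm_minus_commute)
        also have "\<dots> < d" using x' s by (simp add: field_simps)
        finally have "dist ((1 / s) *\<^sub>R (y - x)) ((1 / s) *\<^sub>R (y - x')) < d" .
        moreover have "(1 / s) *\<^sub>R (y - z) \<in> T" if "z \<in> S" for z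
          unfolding T_def using that \<open>y \<in> S\<close> by (intro image_eqI[of _ _ "(z, y)"]) auto
        ultimately have "dist (?\<eta> ((1 / s) *\<^sub>R (y - x))) (?\<eta> ((1 / s) *\<^sub>R (y - x'))) < c'"
          using x x' by (intro d(2)) auto
        then show ?thesis by (simp add: dist_real_def)
      qed
      then have "\<bar>\<integral>y. u n y * (?\<eta> ((1 / s) *\<^sub>R (y - x)) - ?\<eta> ((1 / s) *\<^sub>R (y - x'))) \<partial>lborel\<bar> \<le> c' * B"
        using c' by (intro bd) auto
      moreover have "avg e \<rho> s (u n) x - avg e \<rho> s (u n) x' =
          ?D * (\<integral>y. u n y * (?\<eta> ((1 / s) *\<^sub>R (y - x)) - ?\<eta> ((1 / s) *\<^sub>R (y - x'))) \<partial>lborel)"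
        unfolding conv by (simp only: right_diff_distrib Bochner_Integration.integral_diff[OF i i])
      ultimately have "\<bar>avg e \<rho> s (u n) x - avg e \<rho> s (u n) x'\<bar> \<le> ?D * (c' * B)"
        using D by (simp add: abs_mult)
      also have "\<dots> = c * (B / (2 * (B + 1)))" using s by (simp add: c'_def)
      also have "\<dots> < c * 1" using c B0 by (intro mult_strict_left_mono) (auto simp: field_simps)
      finally show "norm (avg e \<rho> s (u n) x - avg e \<rho> s (u n) x') < c" by simp
    qed
  qed (use that in auto)
  show ?thesis
  proof (rule that[OF k])
    fix c :: real assume "0 < c"
    then obtain N where N: "\<And>n x. n \<ge> N \<Longrightarrow> x \<in> S \<Longrightarrow> norm (avg e \<rho> s (u (k n)) x - g x) < c / 2"
      using lim[of "c / 2"] by auto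
    have "\<bar>avg e \<rho> s (u (k m)) x - avg e \<rho> s (u (k n)) x\<bar> < c" if "m \<ge> N" "n \<ge> N" "x \<in> S" for m n x
      using N[OF that(1,3)] N[OF that(2,3)] unfolding real_norm_def by linarith
    then show "\<exists>N. \<forall>m\<ge>N. \<forall>n\<ge>N. \<forall>x\<in>S. \<bar>avg e \<rho> s (u (k m)) x - avg e \<rho> s (u (k n)) x\<bar> < c" by blast
  qed
qed

lemma powr_add3_le:
  fixes a b c r :: real
  assumes "0 \<le> a" "0 \<le> b" "0 \<le> c" "0 \<le> r"
  shows "(a + b + c) powr r \<le> 3 powr r * (a powr r + b powr r + c powr r)"
proof -
  define m where "m = max a (max b c)"
  have "(a + b + c) powr r \<le> (3 * m) powr r"
    using assms by (intro powr_mono2) (auto simp: m_def)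
  also have "\<dots> = 3 powr r * m powr r" using assms by (simp add: powr_mult m_def)
  also have "m powr r \<le> a powr r + b powr r + c powr r"
    unfolding m_def max_def by (auto intro: add_nonneg_nonneg)
  finally show ?thesis by simp
qed

definition Lr_cauchy :: "'a::euclidean_space set \<Rightarrow> real \<Rightarrow> (nat \<Rightarrow> 'a \<Rightarrow> real) \<Rightarrow> bool" where
  "Lr_cauchy A r u \<longleftrightarrow> (\<forall>c>0. \<exists>N. \<forall>m\<ge>N. \<forall>n\<ge>N.
     (\<integral>\<^sup>+x. ennreal (\<bar>u m x - u n x\<bar> powr r) * indicator A x \<partial>lborel) \<le> ennreal c)"

text \<open>A diagonal subsequence works for countably many scales \<open>\<epsilon> i\<close> and tolerances \<open>t i\<close> that tend to zero together, so a single index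
  makes both the averaging error and the uniform distance of the averages small.\<close>

proposition Lr_cauchy_subseq:
  fixes e :: "'a::euclidean_space" and u :: "nat \<Rightarrow> 'a \<Rightarrow> real"
  assumes \<rho>: "0 < \<rho>" "\<rho> \<le> 1" and e: "norm e = 1"
    and pr: "1 \<le> p" "p \<le> r" "r * (real DIM('a) - p) < real DIM('a) * p"
    and u: "\<And>n. integrable lborel (u n)" and G: "\<And>n. integrable lborel (G n)"
    and wg: "\<And>n. weak_grad_lborel \<Omega> (u n) (G n)"
    and B: "\<And>n. (\<integral>x. \<bar>u n x\<bar> \<partial>lborel) \<le> B"
    and S: "compact S" "\<And>n x. x \<notin> S \<Longrightarrow> u n x = 0"
    and A[measurable]: "A \<in> sets borel" "A' \<in> sets borel" "A' \<subseteq> \<Omega>" "A \<subseteq> S" and h: "0 < h" "h \<le> 1"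
    and cone: "\<And>x s z. x \<in> A \<Longrightarrow> 0 < s \<Longrightarrow> s \<le> h \<Longrightarrow> z \<in> cball e \<rho> \<Longrightarrow> x + s *\<^sub>R z \<in> A'"
    and K: "\<And>n. (\<integral>\<^sup>+y. ennreal (norm (G n y) powr p) * indicator A' y \<partial>lborel) \<le> ennreal K"
  obtains k where "strict_mono (k :: nat \<Rightarrow> nat)" "Lr_cauchy A r (u \<circ> k)"
proof -
  have K': "(\<integral>\<^sup>+y. ennreal (norm (G n y) powr p) * indicator A' y \<partial>lborel) \<le> ennreal (\<bar>K\<bar> + 1)" for n
    by (rule order_trans[OF K ennreal_leI]) simp
  obtain C \<theta> where C: "0 < C" "0 < \<theta>" and est:
    "\<And>n \<epsilon>. 0 < \<epsilon> \<Longrightarrow> \<epsilon> \<le> h \<Longrightarrow>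
      (\<integral>\<^sup>+x. ennreal (\<bar>u n x - avg e \<rho> \<epsilon> (u n) x\<bar> powr r) * indicator A x \<partial>lborel) \<le> ennreal (C * \<epsilon> powr \<theta>)"
  proof (rule avg_error_Lr[OF \<rho> e pr, of "\<bar>K\<bar> + 1"])
    show "0 < \<bar>K\<bar> + 1" by simp
    fix C \<theta> :: real
    assume C: "0 < C" "0 < \<theta>" and est0:
      "\<And>u G \<Omega> A A' \<epsilon>. \<lbrakk>integrable lborel u; integrable lborel G; weak_grad_lborel \<Omega> u G;
         A \<in> sets borel; A' \<in> sets borel; A' \<subseteq> \<Omega>; 0 < \<epsilon>; \<epsilon> \<le> 1;
         \<And>x s z. x \<in> A \<Longrightarrow> 0 < s \<Longrightarrow> s \<le> \<epsilon> \<Longrightarrow> z \<in> cball e \<rho> \<Longrightarrow> x + s *\<^sub>R z \<in> A';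
         (\<integral>\<^sup>+y. ennreal (norm (G y) powr p) * indicator A' y \<partial>lborel) \<le> ennreal (\<bar>K\<bar> + 1)\<rbrakk> \<Longrightarrow>
         (\<integral>\<^sup>+x. ennreal (\<bar>u x - avg e \<rho> \<epsilon> u x\<bar> powr r) * indicator A x \<partial>lborel) \<le> ennreal (C * \<epsilon> powr \<theta>)"
    show thesis
    proof (rule that[OF C])
      fix n and \<epsilon> :: real assume \<epsilon>: "0 < \<epsilon>" "\<epsilon> \<le> h"
      show "(\<integral>\<^sup>+x. ennreal (\<bar>u n x - avg e \<rho> \<epsilon> (u n) x\<bar> powr r) * indicator A x \<partial>lborel) \<le> ennreal (C * \<epsilon> powr \<theta>)"
        by (rule est0[OF u G wg A(1,2,3) \<epsilon>(1) _ cone K']) (use \<epsilon> h in auto)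
    qed
  qed
  have [measurable]: "u n \<in> borel_measurable borel" for n using u[of n] by simp
  define \<epsilon> where "\<epsilon> i = h / real (Suc i)" for i
  define t where "t i = 1 / real (Suc i)" for i
  have \<epsilon>: "0 < \<epsilon> i" "\<epsilon> i \<le> h" for i using h by (auto simp: \<epsilon>_def field_simps)
  have t: "0 < t i" for i by (simp add: t_def)
  define P where "P i \<sigma> \<longleftrightarrow> (\<exists>N. \<forall>m\<ge>N. \<forall>n\<ge>N. \<forall>x\<in>S.
     \<bar>avg e \<rho> (\<epsilon> i) (u (\<sigma> m)) x - avg e \<rho> (\<epsilon> i) (u (\<sigma> n)) x\<bar> < t i)" for i and \<sigma> :: "nat \<Rightarrow> nat"
  obtain k where k: "strict_mono (k :: nat \<Rightarrow> nat)" and P: "\<And>i. P i (id \<circ> k)"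
  proof (rule subsequence_diagonalization_lemma[of P id])
    fix i and \<sigma> :: "nat \<Rightarrow> nat"
    obtain k where "strict_mono (k :: nat \<Rightarrow> nat)"
      "\<And>c. 0 < c \<Longrightarrow> \<exists>N. \<forall>m\<ge>N. \<forall>n\<ge>N. \<forall>x\<in>S.
         \<bar>avg e \<rho> (\<epsilon> i) ((u \<circ> \<sigma>) (k m)) x - avg e \<rho> (\<epsilon> i) ((u \<circ> \<sigma>) (k n)) x\<bar> < c"
      by (rule avg_uniformly_cauchy_subseq[of "u \<circ> \<sigma>" B S \<rho> "\<epsilon> i" e]) (use u B S \<rho> \<epsilon> in auto)
    then show "\<exists>k. strict_mono k \<and> P i (\<sigma> \<circ> k)"
      using t[of i] unfolding P_def by (intro exI[of _ k]) auto
  next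
    fix i and \<sigma> k1 k2 :: "nat \<Rightarrow> nat" and N
    assume Pk1: "P i (\<sigma> \<circ> k1)" and sub: "\<And>j. N \<le> j \<Longrightarrow> \<exists>j'\<ge>j. k2 j = k1 j'"
    obtain N' where N': "\<And>m n x. m \<ge> N' \<Longrightarrow> n \<ge> N' \<Longrightarrow> x \<in> S \<Longrightarrow>
      \<bar>avg e \<rho> (\<epsilon> i) (u (\<sigma> (k1 m))) x - avg e \<rho> (\<epsilon> i) (u (\<sigma> (k1 n))) x\<bar> < t i"
      using Pk1 unfolding P_def o_def by blast
    have "\<bar>avg e \<rho> (\<epsilon> i) (u (\<sigma> (k2 m))) x - avg e \<rho> (\<epsilon> i) (u (\<sigma> (k2 n))) x\<bar> < t i"
      if mn: "m \<ge> max N N'" "n \<ge> max N N'" and x: "x \<in> S" for m n x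
    proof -
      obtain m' n' where "m' \<ge> m" "n' \<ge> n" "k2 m = k1 m'" "k2 n = k1 n'"
        using sub[of m] sub[of n] mn by auto
      then show ?thesis using N'[of m' n' x] mn x by auto
    qed
    then show "P i (\<sigma> \<circ> k2)" unfolding P_def o_def by blast
  qed (rule that)
  have "Lr_cauchy A r (u \<circ> k)"
    unfolding Lr_cauchy_def
  proof (intro allI impI)
    fix c :: real assume c: "c > 0"
    define v where "v = measure lborel A"
    have Afin: "emeasure lborel A < \<infinity>"
      by (rule emeasure_bounded_finite[OF bounded_subset[OF compact_imp_bounded[OF S(1)] A(4)]])
    have eA: "emeasure lborel A = ennreal v" 
      unfolding v_def using Afin by (simp add: emeasure_eq_ennreal_measure less_top)
    have v0: "0 \<le> v" by (simp add: v_def)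
    have "(\<lambda>i. 3 powr r * (2 * (C * \<epsilon> i powr \<theta>) + t i powr r * v)) \<longlonglongrightarrow> 3 powr r * (2 * (C * 0 powr \<theta>) + 0 powr r * v)"
    proof (intro tendsto_intros)
      show "\<epsilon> \<longlonglongrightarrow> 0" unfolding \<epsilon>_def by (rule LIMSEQ_Suc[OF lim_const_over_n])
      show "t \<longlonglongrightarrow> 0" unfolding t_def by (rule LIMSEQ_Suc[OF lim_const_over_n])
    qed (use C pr \<epsilon> t in \<open>auto intro!: always_eventually less_imp_le\<close>)
    then have "\<forall>\<^sub>F i in sequentially. 3 powr r * (2 * (C * \<epsilon> i powr \<theta>) + t i powr r * v) < c"
      using c pr C by (intro order_tendstoD(2)) auto
    then obtain i where i: "3 powr r * (2 * (C * \<epsilon> i powr \<theta>) + t i powr r * v) < c"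
      by (auto simp: eventually_sequentially)
    let ?a = "\<lambda>n. avg e \<rho> (\<epsilon> i) (u (k n))"
    obtain N where N: "\<And>m n x. m \<ge> N \<Longrightarrow> n \<ge> N \<Longrightarrow> x \<in> S \<Longrightarrow> \<bar>?a m x - ?a n x\<bar> < t i"
      using P[of i] unfolding P_def by auto
    have "(\<integral>\<^sup>+x. ennreal (\<bar>(u \<circ> k) m x - (u \<circ> k) n x\<bar> powr r) * indicator A x \<partial>lborel) \<le> ennreal c"
      if mn: "m \<ge> N" "n \<ge> N" for m n
    proof -
      have "(\<integral>\<^sup>+x. ennreal (\<bar>(u \<circ> k) m x - (u \<circ> k) n x\<bar> powr r) * indicator A x \<partial>lborel) \<le>
        (\<integral>\<^sup>+x. ennreal (3 powr r) * (ennreal (\<bar>u (k m) x - ?a m x\<bar> powr r) * indicator A x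
           + ennreal (\<bar>u (k n) x - ?a n x\<bar> powr r) * indicator A x + ennreal (t i powr r) * indicator A x) \<partial>lborel)"
      proof (rule nn_integral_mono)
        fix x
        show "ennreal (\<bar>(u \<circ> k) m x - (u \<circ> k) n x\<bar> powr r) * indicator A x \<le>
          ennreal (3 powr r) * (ennreal (\<bar>u (k m) x - ?a m x\<bar> powr r) * indicator A x
           + ennreal (\<bar>u (k n) x - ?a n x\<bar> powr r) * indicator A x + ennreal (t i powr r) * indicator A x)"
        proof (cases "x \<in> A")
          case True
          then have x: "x \<in> S" using A by auto
          have "\<bar>u (k m) x - u (k n) x\<bar> \<le> \<bar>u (k m) x - ?a m x\<bar> + \<bar>u (k n) x - ?a n x\<bar> + t i"
            using N[OF mn x] by linarith
          then have "\<bar>u (k m) x - u (k n) x\<bar> powr r \<le> (\<bar>u (k m) x - ?a m x\<bar> + \<bar>u (k n) x - ?a n x\<bar> + t i) powr r"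
            using pr by (intro powr_mono2) auto
          also have "\<dots> \<le> 3 powr r * (\<bar>u (k m) x - ?a m x\<bar> powr r + \<bar>u (k n) x - ?a n x\<bar> powr r + t i powr r)"
            using t[of i] pr by (intro powr_add3_le) auto
          finally show ?thesis using True
            by (simp flip: ennreal_plus ennreal_mult add: ennreal_leI)
        qed simp
      qed
      also have "\<dots> = ennreal (3 powr r) * ((\<integral>\<^sup>+x. ennreal (\<bar>u (k m) x - ?a m x\<bar> powr r) * indicator A x \<partial>lborel)
         + (\<integral>\<^sup>+x. ennreal (\<bar>u (k n) x - ?a n x\<bar> powr r) * indicator A x \<partial>lborel) + ennreal (t i powr r) * emeasure lborel A)"
        by (simp add: nn_integral_cmult nn_integral_add nn_integral_cmult_indicator)
      also have "\<dots> \<le> ennreal (3 powr r) * (ennreal (C * \<epsilon> i powr \<theta>) + ennreal (C * \<epsilon> i powr \<theta>) + ennreal (t i powr r) * ennreal v)"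
        unfolding eA using \<epsilon>[of i] by (intro mult_left_mono add_mono est) auto
      also have "\<dots> = ennreal (3 powr r * (2 * (C * \<epsilon> i powr \<theta>) + t i powr r * v))"
        using C v0 by (simp flip: ennreal_plus ennreal_mult)
      also have "\<dots> \<le> ennreal c" using i by (intro ennreal_leI) simp
      finally show ?thesis .
    qed
    then show "\<exists>N. \<forall>m\<ge>N. \<forall>n\<ge>N.
      (\<integral>\<^sup>+x. ennreal (\<bar>(u \<circ> k) m x - (u \<circ> k) n x\<bar> powr r) * indicator A x \<partial>lborel) \<le> ennreal c" by blast
  qed
  with k show ?thesis by (rule that)
qed

lemma Lr_cauchy_subseq_mono:
  assumes "Lr_cauchy A r u" "strict_mono k" shows "Lr_cauchy A r (u \<circ> k)"
  unfolding Lr_cauchy_def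
proof (intro allI impI)
  fix c :: real assume "c > 0"
  then obtain N where N: "\<And>m n. m \<ge> N \<Longrightarrow> n \<ge> N \<Longrightarrow> 
     (\<integral>\<^sup>+x. ennreal (\<bar>u m x - u n x\<bar> powr r) * indicator A x \<partial>lborel) \<le> ennreal c"
    using assms(1) unfolding Lr_cauchy_def by blast
  have k: "n \<ge> N \<Longrightarrow> k n \<ge> N" for n using seq_suble[OF assms(2), of n] by simp
  show "\<exists>N. \<forall>m\<ge>N. \<forall>n\<ge>N.
     (\<integral>\<^sup>+x. ennreal (\<bar>(u \<circ> k) m x - (u \<circ> k) n x\<bar> powr r) * indicator A x \<partial>lborel) \<le> ennreal c"
    unfolding o_def by (intro exI[of _ N] allI impI N k)
qed

lemma finite_common_subseq:
  assumes "finite F"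
    and sub: "\<And>i \<sigma>. i \<in> F \<Longrightarrow> \<exists>k. strict_mono (k :: nat \<Rightarrow> nat) \<and> P i (\<sigma> \<circ> k)"
    and mono: "\<And>i \<sigma> k. P i \<sigma> \<Longrightarrow> strict_mono (k :: nat \<Rightarrow> nat) \<Longrightarrow> P i (\<sigma> \<circ> k)"
  shows "\<exists>k. strict_mono (k :: nat \<Rightarrow> nat) \<and> (\<forall>i\<in>F. P i k)"
  using assms(1,2)
proof (induction rule: finite_induct)
  case empty
  show ?case using strict_mono_id by blast
next
  case (insert j F)
  then obtain k where k: "strict_mono k" "\<forall>i\<in>F. P i k" by auto
  obtain k' where k': "strict_mono k'" "P j (k \<circ> k')" using insert.prems[of j k] by blast
  have "strict_mono (k \<circ> k')" using k k' by (simp add: strict_mono_o)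
  moreover have "\<forall>i\<in>insert j F. P i (k \<circ> k')" using k k' mono by blast
  ultimately show ?case by blast
qed

section \<open>The local cone property and subcritical exponents\<close>

text \<open>At a boundary point the axis is that of the local graph and \<open>\<rho> = 1 / (1 + L)\<close>: moving by \<open>s *\<^sub>R z\<close> raises the last coordinate by at least
  \<open>s * (1 - \<rho>)\<close>, and the graph by at most \<open>L * s * \<rho>\<close>, which is the same number.\<close>

lemma local_cone_property:
  fixes \<Omega> :: "'a::euclidean_space set"
  assumes \<Omega>: "bounded_lipschitz_domain \<Omega>" and x0: "x0 \<in> closure \<Omega>"
  obtains r \<rho> and e :: 'a where "0 < r" "norm e = 1" "0 < \<rho>" "\<rho> \<le> 1"
    "\<And>x s z. x \<in> \<Omega> \<Longrightarrow> x \<in> ball x0 r \<Longrightarrow> 0 < s \<Longrightarrow> s \<le> r \<Longrightarrow> z \<in> cball e \<rho> \<Longrightarrow> x + s *\<^sub>R z \<in> \<Omega>"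
proof -
  have op: "open \<Omega>" and lip: "lipschitz_boundary \<Omega>"
    using \<Omega> by (auto simp: bounded_lipschitz_domain_def)
  have near: "x + s *\<^sub>R z \<in> ball x0 R"
    if "x \<in> ball x0 (R / 4)" "0 < s" "s \<le> R / 4" "norm e = 1" "\<rho> \<le> 1" "z \<in> cball e \<rho>" for x z e s R \<rho>
    using cone_step_in_ball[OF that(4-6) that(1-3)] that(2,3) by simp
  show ?thesis
  proof (cases "x0 \<in> \<Omega>")
    case True
    then obtain R where R: "R > 0" "ball x0 R \<subseteq> \<Omega>" using op by (auto simp: open_contains_ball)
    obtain e :: 'a where e: "e \<in> Basis" using nonempty_Basis by blast
    show ?thesis
      by (rule that[of "R / 4" e 1]) (use R e near[of _ R _ e 1] in auto)
  next
    case False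
    then have "x0 \<in> frontier \<Omega>" using x0 op by (simp add: frontier_def interior_open)
    then obtain e R L \<gamma> where e: "norm e = 1" and R: "R > 0"
      and L: "L-lipschitz_on {y. y \<bullet> e = 0} \<gamma>"
      and eq: "\<Omega> \<inter> ball x0 R = {x \<in> ball x0 R. \<gamma> (x - (x \<bullet> e) *\<^sub>R e) < x \<bullet> e}"
      using lip unfolding lipschitz_boundary_def by blast
    have L0: "0 \<le> L" using L by (rule lipschitz_on_nonneg)
    define \<rho> where "\<rho> = 1 / (1 + L)"
    have \<rho>: "0 < \<rho>" "\<rho> \<le> 1" "L * \<rho> = 1 - \<rho>" using L0 by (auto simp: \<rho>_def field_simps)
    have ee: "e \<bullet> e = 1" using e by (simp add: norm_eq_1)
    show ?thesis
    proof (rule that[of "R / 4" e \<rho>])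
      fix x s z assume x: "x \<in> \<Omega>" "x \<in> ball x0 (R / 4)" and s: "0 < s" "s \<le> R / 4" and z: "z \<in> cball e \<rho>"
      define w where "w = z - e"
      have w: "norm w \<le> \<rho>" using z by (simp add: w_def dist_norm norm_minus_commute)
      define \<pi> where "\<pi> v = v - (v \<bullet> e) *\<^sub>R e" for v
      have \<pi>0: "\<pi> v \<in> {y. y \<bullet> e = 0}" for v using ee by (simp add: \<pi>_def inner_simps)
      have "(norm (\<pi> w))\<^sup>2 = (norm w)\<^sup>2 - (w \<bullet> e)\<^sup>2"
        using ee unfolding \<pi>_def power2_norm_eq_inner
        by (simp add: inner_simps inner_commute power2_eq_square algebra_simps)
      then have "(norm (\<pi> w))\<^sup>2 \<le> (norm w)\<^sup>2" using zero_le_power2[of "w \<bullet> e"] by linarith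
      then have "norm (\<pi> w) \<le> norm w" by (rule power2_le_imp_le) simp
      then have \<pi>w: "norm (\<pi> w) \<le> \<rho>" using w by simp
      have "\<pi> (x + s *\<^sub>R z) - \<pi> x = s *\<^sub>R \<pi> w"
        using ee by (simp add: \<pi>_def w_def inner_simps algebra_simps)
      then have d: "dist (\<pi> (x + s *\<^sub>R z)) (\<pi> x) \<le> s * \<rho>"
        using \<pi>w s by (simp add: dist_norm)
      have "\<bar>\<gamma> (\<pi> (x + s *\<^sub>R z)) - \<gamma> (\<pi> x)\<bar> \<le> L * dist (\<pi> (x + s *\<^sub>R z)) (\<pi> x)"
        using lipschitz_onD[OF L \<pi>0 \<pi>0] by (simp add: dist_real_def)
      also have "\<dots> \<le> L * (s * \<rho>)" using d L0 by (rule mult_left_mono)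
      also have "\<dots> = s * (1 - \<rho>)" using \<rho>(3) by (metis mult.left_commute)
      finally have 1: "\<gamma> (\<pi> (x + s *\<^sub>R z)) \<le> \<gamma> (\<pi> x) + s * (1 - \<rho>)" by linarith
      have "x \<in> ball x0 R" using x R by simp
      then have "x \<in> {x \<in> ball x0 R. \<gamma> (x - (x \<bullet> e) *\<^sub>R e) < x \<bullet> e}"
        using x(1) unfolding eq[symmetric] by blast
      then have 2: "\<gamma> (\<pi> x) < x \<bullet> e" unfolding \<pi>_def by blast
      have "\<bar>w \<bullet> e\<bar> \<le> norm w * norm e" by (rule Cauchy_Schwarz_ineq2)
      then have "w \<bullet> e \<ge> - \<rho>" using w e by simp
      then have "s * (1 - \<rho>) \<le> s * (1 + w \<bullet> e)" using s by (intro mult_left_mono) auto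
      also have "s * (1 + w \<bullet> e) = s * (z \<bullet> e)" using ee by (simp add: w_def inner_simps)
      finally have "\<gamma> (\<pi> (x + s *\<^sub>R z)) < (x + s *\<^sub>R z) \<bullet> e"
        using 1 2 by (simp add: inner_simps)
      with near[OF x(2) s e \<rho>(2) z] have "x + s *\<^sub>R z \<in> \<Omega> \<inter> ball x0 R"
        unfolding eq \<pi>_def by blast
      then show "x + s *\<^sub>R z \<in> \<Omega>" by blast
    qed (use R e \<rho> in auto)
  qed
qed

lemma C_plus_gt_1:
  assumes D: "compact D" and f: "f \<in> C_plus D" and x: "x \<in> D"
  shows "1 < f x"
proof -
  have "bounded (f ` D)"
    using f D by (auto simp: C_plus_def intro!: compact_imp_bounded compact_continuous_image)
  then have "(INF x\<in>D. f x) \<le> f x" using x by (intro cINF_lower bounded_imp_bdd_below)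
  then show ?thesis using f by (simp add: C_plus_def)
qed

lemma subcritical_room:
  fixes N P Q :: real
  assumes "1 < P" "P \<le> Q" "Q * (N - P) < N * P"
  obtains \<delta> where "0 < \<delta>" "1 \<le> P - \<delta>" "(Q + 2 * \<delta>) * (N - (P - \<delta>)) < N * (P - \<delta>)"
proof -
  let ?f = "\<lambda>\<delta>. (Q + 2 * \<delta>) * (N - (P - \<delta>)) - N * (P - \<delta>)"
  have "isCont ?f 0" by (intro continuous_intros)
  then have "(?f \<longlongrightarrow> ?f 0) (at_right 0)"
    unfolding isCont_def by (rule filterlim_mono) (auto intro: at_le)
  then have "\<forall>\<^sub>F \<delta> in at_right 0. ?f \<delta> < 0" using assms by (intro order_tendstoD(2)) auto
  moreover have "\<forall>\<^sub>F \<delta> in at_right 0. \<delta> < P - 1" 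
    using assms by (auto simp: eventually_at_right_field intro!: exI[of _ "P - 1"])
  moreover have "\<forall>\<^sub>F \<delta> in at_right (0::real). 0 < \<delta>" by (rule eventually_at_right_less)
  ultimately have "\<forall>\<^sub>F \<delta> in at_right (0::real). 0 < \<delta> \<and> \<delta> < P - 1 \<and> ?f \<delta> < 0"
    by eventually_elim auto
  then obtain \<delta> where "0 < \<delta>" "\<delta> < P - 1" "?f \<delta> < 0"
    by (metis (no_types, lifting) eventually_happens trivial_limit_at_right_real)
  then show ?thesis by (intro that[of \<delta>]) auto
qed

text \<open>This form of \<open>q < p\<^sup>*\<close> does not distinguish \<open>p < N\<close> from \<open>p \<ge> N\<close> and is continuous in both exponents.\<close>

lemma subcritical_condition:
  fixes p :: "'a::euclidean_space \<Rightarrow> real"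
  assumes "ereal (q x) < crit_exponent p x" "1 < p x" "p x \<le> q x"
  shows "q x * (real DIM('a) - p x) < real DIM('a) * p x"
proof (cases "p x < real DIM('a)")
  case True
  then show ?thesis using assms by (simp add: crit_exponent_def field_simps)
next
  case False
  then have "q x * (real DIM('a) - p x) \<le> 0"
    using assms by (intro mult_nonneg_nonpos) auto
  also have "0 < real DIM('a) * p x" using assms by simp
  finally show ?thesis .
qed

text \<open>A piece of the domain around \<open>x0\<close> on which a constant exponent \<open>r\<close> strictly above \<open>q\<close> is
  subcritical for a constant exponent \<open>p1\<close> below \<open>p\<close>, and which has a uniform cone.\<close>

definition good_piece where
  "good_piece \<Omega> p q x0 = (\<lambda>(h, e, \<rho>, p1, r, \<kappa>).
    0 < h \<and> h \<le> (1::real) \<and> norm (e::'a::euclidean_space) = 1 \<and> 0 < \<rho> \<and> \<rho> \<le> (1::real) \<and>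
    1 \<le> p1 \<and> p1 \<le> r \<and> r * (real DIM('a) - p1) < real DIM('a) * p1 \<and> 0 < (\<kappa>::real) \<and>
    (\<forall>x s z. x \<in> \<Omega> \<inter> ball x0 h \<longrightarrow> 0 < s \<longrightarrow> s \<le> h \<longrightarrow> z \<in> cball e \<rho> \<longrightarrow>
       x + s *\<^sub>R z \<in> \<Omega> \<inter> ball x0 (3 * h)) \<and>
    (\<forall>x\<in>\<Omega> \<inter> ball x0 (3 * h). p1 \<le> p x) \<and> (\<forall>x\<in>\<Omega> \<inter> ball x0 h. q x + \<kappa> \<le> r))"

lemma good_piece_exists:
  fixes \<Omega> :: "'a::euclidean_space set"
  assumes \<Omega>: "bounded_lipschitz_domain \<Omega>"
    and p: "p \<in> C_plus (closure \<Omega>)" and q: "q \<in> C_plus (closure \<Omega>)"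
    and pq: "\<And>x. x \<in> closure \<Omega> \<Longrightarrow> p x \<le> q x \<and> ereal (q x) < crit_exponent p x"
    and x0: "x0 \<in> closure \<Omega>"
  shows "\<exists>d. good_piece \<Omega> p q x0 d"
proof -
  have comp: "compact (closure \<Omega>)"
    using \<Omega> by (auto simp: bounded_lipschitz_domain_def)
  have p1: "1 < p x0" by (rule C_plus_gt_1[OF comp p x0])
  have "p x0 \<le> q x0" "q x0 * (real DIM('a) - p x0) < real DIM('a) * p x0"
    using pq[OF x0] subcritical_condition[of q x0 p] p1 by auto
  then obtain \<delta> where \<delta>: "0 < \<delta>" "1 \<le> p x0 - \<delta>"
    "(q x0 + 2 * \<delta>) * (real DIM('a) - (p x0 - \<delta>)) < real DIM('a) * (p x0 - \<delta>)"
    using subcritical_room[OF p1] by blast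
  obtain R e \<rho> where R: "0 < R" "norm e = 1" "0 < \<rho>" "\<rho> \<le> 1" and cone:
    "\<And>x s z. x \<in> \<Omega> \<Longrightarrow> x \<in> ball x0 R \<Longrightarrow> 0 < s \<Longrightarrow> s \<le> R \<Longrightarrow> z \<in> cball e \<rho> \<Longrightarrow> x + s *\<^sub>R z \<in> \<Omega>"
    by (rule local_cone_property[OF \<Omega> x0], rule that[rotated 4])
  have cont: "continuous_on (closure \<Omega>) p" "continuous_on (closure \<Omega>) q"
    using p q by (auto simp: C_plus_def)
  obtain d1 where d1: "d1 > 0" "\<forall>x\<in>closure \<Omega>. dist x x0 < d1 \<longrightarrow> dist (p x) (p x0) < \<delta>"
    using cont(1)[unfolded continuous_on_iff, rule_format, OF x0 \<delta>(1)] by blast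
  obtain d2 where d2: "d2 > 0" "\<forall>x\<in>closure \<Omega>. dist x x0 < d2 \<longrightarrow> dist (q x) (q x0) < \<delta>"
    using cont(2)[unfolded continuous_on_iff, rule_format, OF x0 \<delta>(1)] by blast
  \<comment> \<open>cones with apex in \<open>ball x0 h\<close> reach into \<open>ball x0 (3 * h)\<close>, where \<open>p\<close> has to be controlled\<close>
  define h where "h = min (min 1 R) (min (d1 / 3) d2)"
  have h: "0 < h" "h \<le> 1" "h \<le> R" "3 * h \<le> d1" "h \<le> d2" using R d1 d2 by (auto simp: h_def)
  have sub: "\<Omega> \<subseteq> closure \<Omega>" by (rule closure_subset)
  have cone': "x + s *\<^sub>R z \<in> \<Omega> \<inter> ball x0 (3 * h)"
    if x: "x \<in> \<Omega> \<inter> ball x0 h" and s: "0 < s" "s \<le> h" and z: "z \<in> cball e \<rho>" for x s z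
    using cone[of x s z] cone_step_in_ball[OF R(2,4) z, of x x0 h s] x s z h by auto
  have p': "p x0 - \<delta> \<le> p x" if "x \<in> \<Omega> \<inter> ball x0 (3 * h)" for x
    using bspec[OF d1(2), of x] that sub h by (auto simp: dist_real_def dist_commute)
  have q': "q x + \<delta> \<le> q x0 + 2 * \<delta>" if "x \<in> \<Omega> \<inter> ball x0 h" for x
    using bspec[OF d2(2), of x] that sub h by (auto simp: dist_real_def dist_commute)
  have "good_piece \<Omega> p q x0 (h, e, \<rho>, p x0 - \<delta>, q x0 + 2 * \<delta>, \<delta>)"
    unfolding good_piece_def prod.case
    using h R \<delta> cone' p' q' pq[OF x0] by (intro conjI allI impI ballI) auto
  then show ?thesis ..
qed

section \<open>The function H and its Luxemburg norms\<close>

lemma ln_e_add_ge_1: "0 \<le> t \<Longrightarrow> 1 \<le> ln (exp 1 + t)" for t :: real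
  by (subst ln_ge_iff) (auto intro: add_pos_nonneg)

lemma H_log_nonneg: "0 \<le> \<mu> x \<Longrightarrow> 0 \<le> t \<Longrightarrow> 0 \<le> H_log p q \<mu> x t"
  using ln_e_add_ge_1[of t] by (simp add: H_log_def)

lemma H_log_mono:
  assumes "0 \<le> \<mu> x" "0 \<le> p x" "0 \<le> q x" "0 \<le> s" "s \<le> t"
  shows "H_log p q \<mu> x s \<le> H_log p q \<mu> x t"
proof -
  have "ln (exp 1 + s) \<le> ln (exp 1 + t)" using assms by (subst ln_le_cancel_iff) (auto intro: add_pos_nonneg)
  then show ?thesis
    unfolding H_log_def using assms ln_e_add_ge_1[of s]
    by (intro add_mono mult_mono powr_mono2) auto
qed

lemma H_log_ge_powr: "0 \<le> \<mu> x \<Longrightarrow> 0 \<le> t \<Longrightarrow> t powr p x \<le> H_log p q \<mu> x t"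
  using ln_e_add_ge_1[of t] by (simp add: H_log_def)

lemma le_1_add_H_log: "0 \<le> \<mu> x \<Longrightarrow> 1 \<le> p x \<Longrightarrow> 0 \<le> t \<Longrightarrow> t \<le> 1 + H_log p q \<mu> x t"
  using H_log_ge_powr[of \<mu> x t p q] le_add_powr[of t 1 "p x"] by simp

lemma H_log_contract:
  assumes "0 \<le> \<mu> x" "1 \<le> p x" "1 \<le> q x" "0 \<le> c" "c \<le> 1" "0 \<le> t"
  shows "H_log p q \<mu> x (c * t) \<le> c * H_log p q \<mu> x t"
proof -
  have c: "c powr a \<le> c" if "1 \<le> a" for a
    using that assms powr_le_one_le[of c a] by (cases "c = 0") auto
  have "ln (exp 1 + c * t) \<le> ln (exp 1 + t)"
    using assms by (subst ln_le_cancel_iff) (auto intro!: add_pos_nonneg mult_left_le_one_le)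
  then have "H_log p q \<mu> x (c * t) \<le> c * t powr p x + \<mu> x * (c * t powr q x) * ln (exp 1 + t)"
    unfolding H_log_def using assms ln_e_add_ge_1[of "c * t"] c
    by (simp add: powr_mult, intro add_mono mult_mono) (auto intro!: mult_right_mono mult_nonneg_nonneg)
  then show ?thesis by (simp add: H_log_def algebra_simps)
qed

text \<open>The doubling property: \<open>ln (exp 1 + c * t) \<le> c * ln (exp 1 + t)\<close> because the logarithm on the right is
  at least one.\<close>

lemma H_log_expand:
  assumes "0 \<le> \<mu> x" "p x \<le> Q" "q x \<le> Q" "1 \<le> c" "0 \<le> t"
  shows "H_log p q \<mu> x (c * t) \<le> c powr (Q + 1) * H_log p q \<mu> x t"
proof -
  have L: "1 \<le> ln (exp 1 + t)" using assms ln_e_add_ge_1[of t] by simp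
  have pos: "0 < exp 1 + t" "0 < exp 1 + c * t" using assms by (auto intro!: add_pos_nonneg)
  have "exp 1 + c * t \<le> c * (exp 1 + t)" using assms by (simp add: algebra_simps)
  then have "ln (exp 1 + c * t) \<le> ln (c * (exp 1 + t))"
    using assms pos by (subst ln_le_cancel_iff) auto
  also have "\<dots> = ln c + ln (exp 1 + t)"
    using assms by (intro ln_mult_pos) (auto intro: add_pos_nonneg)
  also have "\<dots> \<le> (c - 1) * 1 + ln (exp 1 + t)" using assms ln_le_minus_one[of c] by simp
  also have "\<dots> \<le> (c - 1) * ln (exp 1 + t) + ln (exp 1 + t)"
    using assms L by (intro add_right_mono mult_left_mono) auto
  finally have ln: "ln (exp 1 + c * t) \<le> c * ln (exp 1 + t)" by (simp add: algebra_simps)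
  have cQ: "c powr (Q + 1) = c powr Q * c" using assms by (simp add: powr_add)
  have "c powr p x \<le> c powr Q * c"
    using assms powr_mono[of "p x" "Q + 1" c] by (simp flip: cQ)
  then have 1: "(c * t) powr p x \<le> c powr Q * c * t powr p x"
    using assms by (simp add: powr_mult mult_right_mono)
  have "\<mu> x * (c * t) powr q x * ln (exp 1 + c * t) \<le> \<mu> x * (c powr Q * t powr q x) * (c * ln (exp 1 + t))"
    using assms ln ln_e_add_ge_1[of "c * t"] powr_mono[of "q x" Q c]
    by (intro mult_mono) (auto simp: powr_mult intro!: mult_right_mono mult_nonneg_nonneg)
  with 1 show ?thesis unfolding H_log_def cQ by (simp add: algebra_simps)
qed

lemma ln_e_add_le_powr:
  fixes t \<kappa> :: real
  assumes "1 \<le> t" "0 < \<kappa>"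
  shows "ln (exp 1 + t) \<le> (2 + 1 / \<kappa>) * t powr \<kappa>"
proof -
  have "exp 1 + t \<le> exp 1 * (2 * t)"
  proof -
    have "exp 1 \<le> exp 1 * t" using assms by simp
    moreover have "t \<le> exp 1 * t" using assms by simp
    ultimately have "exp 1 + t \<le> exp 1 * t + exp 1 * t" by (rule add_mono)
    then show ?thesis by (simp add: mult_ac)
  qed
  also have "\<dots> \<le> exp 1 * (exp 1 * t)"
    using assms exp_ge_add_one_self[of 1] by (intro mult_left_mono mult_right_mono) auto
  finally have "ln (exp 1 + t) \<le> ln (exp 2 * t)"
    using assms by (subst ln_le_cancel_iff) (auto intro: add_pos_pos simp flip: exp_add mult.assoc)
  also have "\<dots> = 2 + ln t" using assms by (subst ln_mult_pos) auto
  also have "\<dots> \<le> 2 * t powr \<kappa> + t powr \<kappa> / \<kappa>"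
    using ln_powr_bound[OF assms] ge_one_powr_ge_zero[of t \<kappa>] assms by (intro add_mono) auto
  finally show ?thesis by (simp add: algebra_simps)
qed

text \<open>The logarithm costs an arbitrarily small power \<open>t powr \<kappa>\<close> for large \<open>t\<close>; for \<open>t \<le> 1\<close> all exponents are at least one and
  everything is bounded by a multiple of \<open>t\<close>.\<close>

lemma H_log_growth:
  assumes "0 \<le> \<mu> x" "\<mu> x \<le> M" "1 \<le> p x" "p x \<le> q x" "q x + \<kappa> \<le> r" "0 < \<kappa>" "0 \<le> t"
  shows "H_log p q \<mu> x t \<le> (1 + M * (2 + 1 / \<kappa>)) * (t + t powr r)"
proof -
  have M: "0 \<le> M" using assms by simp
  have "t powr p x \<le> t + t powr r \<and> t powr q x * ln (exp 1 + t) \<le> (2 + 1 / \<kappa>) * (t + t powr r)"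
  proof (cases "t \<le> 1")
    case True
    have pw: "t powr a \<le> t" if "1 \<le> a" for a
      using that assms True powr_le_one_le[of t a] by (cases "t = 0") auto
    have "ln (exp 1 + t) \<le> ln (exp 1 * exp 1)"
      using True assms exp_ge_add_one_self[of 1]
      by (subst ln_le_cancel_iff) (auto intro!: add_pos_nonneg order_trans[OF _ mult_left_mono[of 2 "exp 1" "exp 1"]])
    also have "\<dots> = 2" by (simp flip: exp_add)
    finally have ln2: "ln (exp 1 + t) \<le> 2" .
    have "t powr q x * ln (exp 1 + t) \<le> t * 2"
      using pw[of "q x"] assms ln2 ln_e_add_ge_1[of t] by (intro mult_mono) auto
    also have "\<dots> \<le> (2 + 1 / \<kappa>) * (t + t powr r)"
      using assms by (simp add: algebra_simps)
    finally show ?thesis using pw[of "p x"] assms by (simp add: add_increasing2)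
  next
    case False
    then have t: "1 \<le> t" by simp
    have "t powr p x \<le> t powr r" using t assms by (intro powr_mono) auto
    moreover have "t powr q x * ln (exp 1 + t) \<le> t powr q x * ((2 + 1 / \<kappa>) * t powr \<kappa>)"
      using ln_e_add_le_powr[OF t \<open>0 < \<kappa>\<close>] by (intro mult_left_mono) auto
    moreover have "t powr q x * ((2 + 1 / \<kappa>) * t powr \<kappa>) = (2 + 1 / \<kappa>) * t powr (q x + \<kappa>)"
      by (simp add: powr_add mult_ac)
    moreover have "(2 + 1 / \<kappa>) * t powr (q x + \<kappa>) \<le> (2 + 1 / \<kappa>) * (t + t powr r)"
      using t assms by (intro mult_left_mono add_increasing powr_mono) auto
    ultimately show ?thesis using t by linarith
  qed
  then have 1: "t powr p x \<le> t + t powr r" and 2: "t powr q x * ln (exp 1 + t) \<le> (2 + 1 / \<kappa>) * (t + t powr r)"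
    by auto
  have "\<mu> x * (t powr q x * ln (exp 1 + t)) \<le> M * ((2 + 1 / \<kappa>) * (t + t powr r))"
    using assms ln_e_add_ge_1[of t] by (intro mult_mono[OF assms(2) 2 M]) auto
  with 1 show ?thesis by (simp add: H_log_def algebra_simps)
qed

lemma H_log_tendsto:
  assumes "0 < p x" "0 < q x" and f: "(f \<longlongrightarrow> t) F" and "0 \<le> t" "\<And>i. 0 \<le> f i"
  shows "((\<lambda>i. H_log p q \<mu> x (f i)) \<longlongrightarrow> H_log p q \<mu> x t) F"
proof -
  have "exp 1 + t \<noteq> 0" using assms(4) exp_gt_zero[of "1::real"] by linarith
  then show ?thesis
  unfolding H_log_def using assms
  by (intro tendsto_intros f tendsto_powr') auto
qed

text \<open>Both norms are infima of this shape, with an antitone \<open>m\<close>; a witness is required because the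
  infimum of the empty set carries no information.\<close>

lemma Luxemburg_le:
  assumes "0 < l" "m l \<le> (1::ennreal)" shows "Inf {l::real. l > 0 \<and> m l \<le> 1} \<le> l"
  using assms by (intro cInf_lower) (auto intro!: bdd_belowI[of _ 0])

lemma Luxemburg_nonneg:
  assumes "0 < l" "m l \<le> (1::ennreal)" shows "0 \<le> Inf {l::real. l > 0 \<and> m l \<le> 1}"
  using assms by (intro cInf_greatest) auto

lemma Luxemburg_less:
  assumes l0: "0 < l0" "m l0 \<le> (1::ennreal)"
    and anti: "\<And>k l. 0 < k \<Longrightarrow> k \<le> l \<Longrightarrow> m l \<le> m k"
    and l: "Inf {l::real. l > 0 \<and> m l \<le> 1} < l"
  shows "0 < l" "m l \<le> 1"
proof -
  obtain k where k: "0 < k" "m k \<le> 1" "k < l"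
    using cInf_lessD[OF _ l] l0 by auto
  then show "0 < l" "m l \<le> 1" using anti[of k l] by auto
qed

section \<open>Borel representatives\<close>

lemma AE_lebesgue_on_iff:
  fixes \<Omega> :: "'a::euclidean_space set"
  assumes "\<Omega> \<in> sets borel"
  shows "(AE x in lebesgue_on \<Omega>. P x) \<longleftrightarrow> (AE x in lborel. x \<in> \<Omega> \<longrightarrow> P x)"
  using assms by (subst AE_restrict_space_iff) (auto simp: AE_completion_iff)

lemma nn_integral_lebesgue_on:
  fixes \<Omega> :: "'a::euclidean_space set"
  assumes "\<Omega> \<in> sets borel"
  shows "(\<integral>\<^sup>+x. f x \<partial>lebesgue_on \<Omega>) = (\<integral>\<^sup>+x. f x * indicator \<Omega> x \<partial>lborel)"
  using assms by (subst nn_integral_restrict_space) (auto simp: nn_integral_completion)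

lemma integral_lebesgue_on_eq_lborel:
  fixes f f' :: "'a::euclidean_space \<Rightarrow> real"
  assumes \<Omega>: "\<Omega> \<in> sets borel" and f: "f \<in> borel_measurable (lebesgue_on \<Omega>)"
    and f': "f' \<in> borel_measurable borel" and ae: "AE x in lebesgue_on \<Omega>. f x = f' x"
    and off: "\<And>x. x \<notin> \<Omega> \<Longrightarrow> f' x = 0"
  shows "(\<integral>x. f x \<partial>lebesgue_on \<Omega>) = (\<integral>x. f' x \<partial>lborel)"
proof -
  have "(\<integral>x. f x \<partial>lebesgue_on \<Omega>) = (\<integral>x. f' x \<partial>lebesgue_on \<Omega>)"
    using f' by (intro integral_cong_AE f ae) (auto intro!: measurable_restrict_space1 measurable_completion)
  also have "\<dots> = (\<integral>x. indicator \<Omega> x *\<^sub>R f' x \<partial>lebesgue)"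
    using \<Omega> by (intro integral_restrict_space) auto
  also have "(\<lambda>x. indicator \<Omega> x *\<^sub>R f' x) = f'"
    using off by (auto simp: indicator_def fun_eq_iff)
  also have "(\<integral>x. f' x \<partial>lebesgue) = (\<integral>x. f' x \<partial>lborel)"
    using f' by (intro integral_completion) auto
  finally show ?thesis .
qed

text \<open>Modulars, norms and weak gradients only see functions up to null sets on \<open>\<Omega>\<close>, while integration over product spaces
  requires Borel functions.\<close>

lemma borel_representative:
  fixes f :: "'a::euclidean_space \<Rightarrow> 'b::euclidean_space"
  assumes \<Omega>: "\<Omega> \<in> sets borel" and f: "f \<in> borel_measurable (lebesgue_on \<Omega>)"
  obtains f' where "f' \<in> borel_measurable borel" "\<And>x. x \<notin> \<Omega> \<Longrightarrow> f' x = 0"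
    "AE x in lebesgue_on \<Omega>. f x = f' x"
proof -
  define g where "g x = (if x \<in> \<Omega> then f x else 0)" for x
  have "g \<in> borel_measurable lebesgue"
    unfolding g_def using borel_measurable_if[of \<Omega> f] \<Omega> f by auto
  then have "(\<lambda>x. g x \<bullet> b) \<in> borel_measurable lebesgue" for b by measurable
  then have "\<exists>h. h \<in> borel_measurable lborel \<and> (AE x in lborel. g x \<bullet> b = h x)" for b
    using completion_ex_borel_measurable_real[of "\<lambda>x. g x \<bullet> b" lborel] by blast
  then obtain h where h: "\<And>b. h b \<in> borel_measurable lborel" "\<And>b. AE x in lborel. g x \<bullet> b = h b x"
    by metis
  define f' where "f' x = (\<Sum>b\<in>Basis. (h b x * indicator \<Omega> x) *\<^sub>R b)" for x
  have [measurable]: "h b \<in> borel_measurable borel" "\<Omega> \<in> sets borel" for b using h \<Omega> by auto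
  show ?thesis
  proof
    show "f' \<in> borel_measurable borel" unfolding f'_def by measurable
    show "f' x = 0" if "x \<notin> \<Omega>" for x using that by (simp add: f'_def)
    have "AE x in lborel. \<forall>b\<in>Basis. g x \<bullet> b = h b x"
      using h(2) by (intro AE_finite_allI) auto
    then have "AE x in lborel. x \<in> \<Omega> \<longrightarrow> f x = f' x"
    proof (rule eventually_mono, intro impI)
      fix x assume "\<forall>b\<in>Basis. g x \<bullet> b = h b x" "x \<in> \<Omega>"
      then have "f' x = (\<Sum>b\<in>Basis. (f x \<bullet> b) *\<^sub>R b)" by (simp add: f'_def g_def)
      then show "f x = f' x" by (simp add: euclidean_representation)
    qed
    then show "AE x in lebesgue_on \<Omega>. f x = f' x" by (simp add: AE_lebesgue_on_iff[OF \<Omega>])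
  qed
qed

text \<open>Local integrability only speaks about compact sets, but countably many of them exhaust an open set.\<close>

lemma locally_integrable_measurable:
  fixes f :: "'a::euclidean_space \<Rightarrow> 'b::euclidean_space"
  assumes \<Omega>: "open \<Omega>" and f: "locally_integrable \<Omega> f"
  shows "f \<in> borel_measurable (lebesgue_on \<Omega>)"
proof -
  obtain C where C: "countable C" "C \<subseteq> Pow \<Omega>" "\<And>X. X \<in> C \<Longrightarrow> \<exists>a b. X = cbox a b" "\<Union>C = \<Omega>"
    using open_countable_Union_open_cbox[OF \<Omega>] by metis
  show ?thesis
  proof (rule measurable_piecewise_restrict[OF C(1)])
    fix X assume X: "X \<in> C"
    then obtain a b where X': "X = cbox a b" using C(3) by blast
    have "X \<subseteq> \<Omega>" using C X by auto
    then have "integrable (lebesgue_on X) f" using f X' by (auto simp: locally_integrable_def)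
    moreover have "restrict_space (lebesgue_on \<Omega>) X = lebesgue_on X"
      using \<open>X \<subseteq> \<Omega>\<close> \<Omega> by (simp add: restrict_restrict_space Int_absorb1 X')
    ultimately show "f \<in> borel_measurable (restrict_space (lebesgue_on \<Omega>) X)" by simp
    show "X \<inter> space (lebesgue_on \<Omega>) \<in> sets (lebesgue_on \<Omega>)"
      using \<open>X \<subseteq> \<Omega>\<close> \<Omega> X' by (auto simp: sets_restrict_space intro!: image_eqI[of _ _ X])
  qed (use C in auto)
qed

lemma test_function_smooth: "\<phi> \<in> test_functions \<Omega> \<Longrightarrow> smooth \<phi>"
  by (simp add: test_functions_def smooth_def)

lemma smooth_borel_measurable: "smooth f \<Longrightarrow> f \<in> borel_measurable borel"
  by (intro borel_measurable_continuous_onI smooth_continuous_on)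

lemma borel_measurable_lebesgue_on:
  fixes f :: "'a::euclidean_space \<Rightarrow> 'b::topological_space"
  shows "f \<in> borel_measurable borel \<Longrightarrow> f \<in> borel_measurable (lebesgue_on \<Omega>)"
  by (intro measurable_restrict_space1 measurable_completion) auto

lemma has_weak_gradient_lborel:
  fixes \<Omega> :: "'a::euclidean_space set"
  assumes \<Omega>: "open \<Omega>" and wg: "has_weak_gradient \<Omega> u g"
    and U: "U \<in> borel_measurable borel" "\<And>x. x \<notin> \<Omega> \<Longrightarrow> U x = 0" "AE x in lebesgue_on \<Omega>. u x = U x"
    and G: "G \<in> borel_measurable borel" "\<And>x. x \<notin> \<Omega> \<Longrightarrow> G x = 0" "AE x in lebesgue_on \<Omega>. g x = G x"
  shows "weak_grad_lborel \<Omega> U G"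
  unfolding weak_grad_lborel_def
proof (intro ballI)
  fix \<phi> and b :: 'a assume \<phi>: "\<phi> \<in> test_functions \<Omega>" and b: "b \<in> Basis"
  have \<Omega>': "\<Omega> \<in> sets borel" using \<Omega> by simp
  have [measurable]: "\<phi> \<in> borel_measurable borel" "partial_deriv b \<phi> \<in> borel_measurable borel"
    using test_function_smooth[OF \<phi>] smooth_partial_deriv[OF _ b] by (auto intro: smooth_borel_measurable)
  note [measurable] = U(1) G(1) borel_measurable_lebesgue_on[of \<phi> \<Omega>] borel_measurable_lebesgue_on[of "partial_deriv b \<phi>" \<Omega>]
  have [measurable]: "u \<in> borel_measurable (lebesgue_on \<Omega>)" "g \<in> borel_measurable (lebesgue_on \<Omega>)"
    using wg by (auto simp: has_weak_gradient_def intro: locally_integrable_measurable[OF \<Omega>])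
  have "(\<integral>x. U x * partial_deriv b \<phi> x \<partial>lborel) = (\<integral>x. u x * partial_deriv b \<phi> x \<partial>lebesgue_on \<Omega>)"
    using U by (intro integral_lebesgue_on_eq_lborel[OF \<Omega>', symmetric]) auto
  also have "\<dots> = - (\<integral>x. (g x \<bullet> b) * \<phi> x \<partial>lebesgue_on \<Omega>)"
    using wg \<phi> b by (auto simp: has_weak_gradient_def)
  also have "(\<integral>x. (g x \<bullet> b) * \<phi> x \<partial>lebesgue_on \<Omega>) = (\<integral>x. (G x \<bullet> b) * \<phi> x \<partial>lborel)"
    using G by (intro integral_lebesgue_on_eq_lborel[OF \<Omega>']) auto
  finally show "(\<integral>x. U x * partial_deriv b \<phi> x \<partial>lborel) = - (\<integral>x. (G x \<bullet> b) * \<phi> x \<partial>lborel)" .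
qed

section \<open>Modulars and norms\<close>

locale log_double_phase =
  fixes \<Omega> :: "'a::euclidean_space set" and p q \<mu> :: "'a \<Rightarrow> real"
  assumes domain: "bounded_lipschitz_domain \<Omega>"
    and p_C_plus: "p \<in> C_plus (closure \<Omega>)" and q_C_plus: "q \<in> C_plus (closure \<Omega>)"
    and subcritical: "\<And>x. x \<in> closure \<Omega> \<Longrightarrow> p x \<le> q x \<and> ereal (q x) < crit_exponent p x"
    and \<mu>_L_infty: "\<mu> \<in> L_infty \<Omega>" and \<mu>_nonneg: "AE x in lebesgue_on \<Omega>. 0 \<le> \<mu> x"
begin

abbreviation "J \<equiv> modular_H \<Omega> p q \<mu>"
abbreviation "H \<equiv> H_log p q \<mu>"

definition vol :: real where "vol = measure lborel \<Omega>"

lemma open_\<Omega>: "open \<Omega>" and bounded_\<Omega>: "bounded \<Omega>"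
  using domain by (auto simp: bounded_lipschitz_domain_def)

lemma \<Omega>_borel [measurable]: "\<Omega> \<in> sets borel"
  using open_\<Omega> by simp

lemma compact_closure_\<Omega>: "compact (closure \<Omega>)"
  using bounded_\<Omega> by simp

lemma emeasure_\<Omega>: "emeasure lborel \<Omega> = ennreal vol"
  unfolding vol_def using emeasure_bounded_finite[OF bounded_\<Omega>]
  by (simp add: emeasure_eq_ennreal_measure less_top)

lemma vol_nonneg: "0 \<le> vol" by (simp add: vol_def)

lemma p_gt_1: "x \<in> \<Omega> \<Longrightarrow> 1 < p x"
  using C_plus_gt_1[OF compact_closure_\<Omega> p_C_plus, of x] closure_subset[of \<Omega>] by blast

lemma p_le_q: "x \<in> \<Omega> \<Longrightarrow> p x \<le> q x"
  using subcritical[of x] closure_subset[of \<Omega>] by blast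

lemma q_bounded: obtains Q where "1 \<le> Q" "\<And>x. x \<in> \<Omega> \<Longrightarrow> q x \<le> Q"
proof -
  have "bounded (q ` closure \<Omega>)"
    using q_C_plus compact_closure_\<Omega>
    by (auto simp: C_plus_def intro!: compact_imp_bounded compact_continuous_image)
  then obtain Q where Q: "\<And>y. y \<in> q ` closure \<Omega> \<Longrightarrow> norm y \<le> Q" unfolding bounded_iff by blast
  have "q x \<le> max 1 Q" if "x \<in> \<Omega>" for x
  proof -
    have "x \<in> closure \<Omega>" using that closure_subset by blast
    then have "norm (q x) \<le> Q" by (intro Q imageI)
    then show ?thesis by simp
  qed
  then show ?thesis by (intro that[of "max 1 Q"]) auto
qed

lemma \<mu>_bounded: obtains M where "AE x in lebesgue_on \<Omega>. 0 \<le> \<mu> x \<and> \<mu> x \<le> M"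
proof -
  obtain M where "AE x in lebesgue_on \<Omega>. \<bar>\<mu> x\<bar> \<le> M" using \<mu>_L_infty by (auto simp: L_infty_def)
  with \<mu>_nonneg have "AE x in lebesgue_on \<Omega>. 0 \<le> \<mu> x \<and> \<mu> x \<le> M" by eventually_elim auto
  then show ?thesis by (rule that)
qed

lemma AE_in_\<Omega>: "AE x in lebesgue_on \<Omega>. x \<in> \<Omega>"
  by (simp add: AE_lebesgue_on_iff)

lemma AE_regular: "AE x in lebesgue_on \<Omega>. x \<in> \<Omega> \<and> 1 < p x \<and> p x \<le> q x \<and> 0 \<le> \<mu> x"
  using AE_in_\<Omega> \<mu>_nonneg by eventually_elim (auto simp: p_gt_1 p_le_q)

lemma exponents_measurable [measurable]:
  "p \<in> borel_measurable (lebesgue_on \<Omega>)" "q \<in> borel_measurable (lebesgue_on \<Omega>)"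
  "\<mu> \<in> borel_measurable (lebesgue_on \<Omega>)"
proof -
  have "continuous_on \<Omega> p" "continuous_on \<Omega> q"
    using p_C_plus q_C_plus closure_subset by (auto simp: C_plus_def intro: continuous_on_subset)
  then show "p \<in> borel_measurable (lebesgue_on \<Omega>)" "q \<in> borel_measurable (lebesgue_on \<Omega>)"
    using open_\<Omega> by (auto intro: continuous_imp_measurable_on_sets_lebesgue)
  show "\<mu> \<in> borel_measurable (lebesgue_on \<Omega>)" using \<mu>_L_infty by (simp add: L_infty_def)
qed

lemma H_measurable [measurable]:
  assumes [measurable]: "u \<in> borel_measurable (lebesgue_on \<Omega>)"
  shows "(\<lambda>x. H x (u x)) \<in> borel_measurable (lebesgue_on \<Omega>)"
  unfolding H_log_def by measurable

lemma modular_mono_AE: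
  assumes "AE x in lebesgue_on \<Omega>. \<bar>u x\<bar> \<le> \<bar>v x\<bar>" shows "J u \<le> J v"
  unfolding modular_H_def
proof (rule nn_integral_mono_AE)
  show "AE x in lebesgue_on \<Omega>. ennreal (H x \<bar>u x\<bar>) \<le> ennreal (H x \<bar>v x\<bar>)"
    using AE_regular assms by eventually_elim (auto intro!: ennreal_leI H_log_mono)
qed

lemma modular_cong_AE: "AE x in lebesgue_on \<Omega>. u x = v x \<Longrightarrow> J u = J v"
  by (intro antisym modular_mono_AE; erule eventually_mono) auto

lemma modular_antimono_scale:
  assumes "0 < k" "k \<le> l" shows "J (\<lambda>x. u x / l) \<le> J (\<lambda>x. u x / k)"
proof (intro modular_mono_AE always_eventually allI)
  show "\<bar>u x / l\<bar> \<le> \<bar>u x / k\<bar>" for x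
    unfolding abs_divide using assms by (intro frac_le) auto
qed

lemma modular_contract:
  assumes [measurable]: "u \<in> borel_measurable (lebesgue_on \<Omega>)" and c: "0 \<le> c" "c \<le> 1"
  shows "J (\<lambda>x. c * u x) \<le> ennreal c * J u"
proof -
  have "J (\<lambda>x. c * u x) \<le> (\<integral>\<^sup>+x. ennreal c * ennreal (H x \<bar>u x\<bar>) \<partial>lebesgue_on \<Omega>)"
    unfolding modular_H_def
  proof (rule nn_integral_mono_AE)
    show "AE x in lebesgue_on \<Omega>. ennreal (H x \<bar>c * u x\<bar>) \<le> ennreal c * ennreal (H x \<bar>u x\<bar>)"
      using AE_regular
    proof eventually_elim
      case (elim x)
      then have "H x (c * \<bar>u x\<bar>) \<le> c * H x \<bar>u x\<bar>" using c by (intro H_log_contract) auto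
      then show ?case using c H_log_nonneg[of \<mu> x "\<bar>u x\<bar>" p q] elim
        by (simp add: abs_mult ennreal_leI flip: ennreal_mult)
    qed
  qed
  then show ?thesis by (simp add: modular_H_def nn_integral_cmult)
qed

lemma modular_expand_finite:
  assumes [measurable]: "u \<in> borel_measurable (lebesgue_on \<Omega>)" and fin: "J u < \<infinity>"
  shows "J (\<lambda>x. c * u x) < \<infinity>"
proof -
  obtain Q where Q: "1 \<le> Q" "\<And>x. x \<in> \<Omega> \<Longrightarrow> q x \<le> Q" using q_bounded by blast
  define d where "d = max 1 \<bar>c\<bar>"
  have "J (\<lambda>x. c * u x) \<le> (\<integral>\<^sup>+x. ennreal (d powr (Q + 1)) * ennreal (H x \<bar>u x\<bar>) \<partial>lebesgue_on \<Omega>)"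
    unfolding modular_H_def
  proof (rule nn_integral_mono_AE)
    show "AE x in lebesgue_on \<Omega>. ennreal (H x \<bar>c * u x\<bar>) \<le> ennreal (d powr (Q + 1)) * ennreal (H x \<bar>u x\<bar>)"
      using AE_regular
    proof eventually_elim
      case (elim x)
      have "H x \<bar>c * u x\<bar> \<le> H x (d * \<bar>u x\<bar>)"
        using elim by (intro H_log_mono) (auto simp: d_def abs_mult intro!: mult_right_mono)
      also have "\<dots> \<le> d powr (Q + 1) * H x \<bar>u x\<bar>"
        using elim Q(2)[of x] by (intro H_log_expand) (auto simp: d_def)
      finally show ?case using H_log_nonneg[of \<mu> x "\<bar>u x\<bar>" p q] elim
        by (simp add: ennreal_leI flip: ennreal_mult)
    qed
  qed
  also have "\<dots> = ennreal (d powr (Q + 1)) * J u" by (simp add: modular_H_def nn_integral_cmult)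
  also have "\<dots> < \<infinity>" using fin by (simp add: ennreal_mult_less_top)
  finally show ?thesis .
qed

lemma modular_add_le:
  assumes [measurable]: "v \<in> borel_measurable (lebesgue_on \<Omega>)" "w \<in> borel_measurable (lebesgue_on \<Omega>)"
    and le: "AE x in lebesgue_on \<Omega>. \<bar>u x\<bar> \<le> \<bar>v x\<bar> + \<bar>w x\<bar>"
  shows "J u \<le> J (\<lambda>x. 2 * v x) + J (\<lambda>x. 2 * w x)"
proof -
  have "J u \<le> (\<integral>\<^sup>+x. ennreal (H x \<bar>2 * v x\<bar>) + ennreal (H x \<bar>2 * w x\<bar>) \<partial>lebesgue_on \<Omega>)"
    unfolding modular_H_def
  proof (rule nn_integral_mono_AE)
    show "AE x in lebesgue_on \<Omega>. ennreal (H x \<bar>u x\<bar>) \<le> ennreal (H x \<bar>2 * v x\<bar>) + ennreal (H x \<bar>2 * w x\<bar>)"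
      using AE_regular le
    proof eventually_elim
      case (elim x)
      then have "\<bar>u x\<bar> \<le> \<bar>2 * v x\<bar> \<or> \<bar>u x\<bar> \<le> \<bar>2 * w x\<bar>" by auto
      then have "H x \<bar>u x\<bar> \<le> H x \<bar>2 * v x\<bar> \<or> H x \<bar>u x\<bar> \<le> H x \<bar>2 * w x\<bar>"
        using elim by (auto intro!: H_log_mono)
      then show ?case by (auto intro: add_increasing add_increasing2 ennreal_leI)
    qed
  qed
  also have "\<dots> = J (\<lambda>x. 2 * v x) + J (\<lambda>x. 2 * w x)"
    unfolding modular_H_def by (rule nn_integral_add) measurable
  finally show ?thesis .
qed

text \<open>With \<open>w = 0\<close> or \<open>w = v\<close> this gives closure under domination, and with two different functions closure under sums; it rests on the
  doubling property.\<close>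

lemma L_H_dominated:
  assumes v: "v \<in> L_H \<Omega> p q \<mu>" and w: "w \<in> L_H \<Omega> p q \<mu>" and u: "u \<in> borel_measurable (lebesgue_on \<Omega>)"
    and le: "AE x in lebesgue_on \<Omega>. \<bar>u x\<bar> \<le> \<bar>v x\<bar> + \<bar>w x\<bar>"
  shows "u \<in> L_H \<Omega> p q \<mu>"
proof -
  have m: "v \<in> borel_measurable (lebesgue_on \<Omega>)" "w \<in> borel_measurable (lebesgue_on \<Omega>)"
    using v w by (auto simp: L_H_def)
  have "J u \<le> J (\<lambda>x. 2 * v x) + J (\<lambda>x. 2 * w x)" by (rule modular_add_le[OF m le])
  also have "\<dots> < \<infinity>" using v w modular_expand_finite[OF m(1)] modular_expand_finite[OF m(2)] by (simp add: L_H_def)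
  finally show ?thesis using u by (simp add: L_H_def)
qed

lemma L_H_scale:
  assumes "u \<in> L_H \<Omega> p q \<mu>" shows "(\<lambda>x. c * u x) \<in> L_H \<Omega> p q \<mu>"
proof -
  have [measurable]: "u \<in> borel_measurable (lebesgue_on \<Omega>)" using assms by (simp add: L_H_def)
  have "(\<lambda>x. c * u x) \<in> borel_measurable (lebesgue_on \<Omega>)" by measurable
  then show ?thesis using modular_expand_finite[of u c] assms by (simp add: L_H_def)
qed

lemma modular_small:
  assumes u: "u \<in> L_H \<Omega> p q \<mu>" and "0 < e"
  shows "\<exists>l\<ge>1. \<forall>k\<ge>l. J (\<lambda>x. u x / k) \<le> ennreal e"
proof -
  have [measurable]: "u \<in> borel_measurable (lebesgue_on \<Omega>)" and fin: "J u < \<infinity>"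
    using u by (auto simp: L_H_def)
  obtain j where j: "J u = ennreal j" "0 \<le> j" using fin by (cases "J u") auto
  define l where "l = max 1 (j / e)"
  have "J (\<lambda>x. u x / k) \<le> ennreal e" if k: "k \<ge> l" for k
  proof -
    have k1: "k \<ge> 1" "k \<ge> j / e" using k by (auto simp: l_def)
    have "J (\<lambda>x. u x / k) \<le> ennreal (1 / k) * J u"
      using modular_contract[of u "1 / k"] k1 by simp
    also have "\<dots> = ennreal (j / k)" using j k1 by (simp flip: ennreal_mult)
    also have "\<dots> \<le> ennreal e" using k1 assms(2) by (intro ennreal_leI) (auto simp: field_simps)
    finally show ?thesis .
  qed
  then show ?thesis by (intro exI[of _ l]) (auto simp: l_def)
qed

text \<open>Controls the \<open>L\<^sup>1\<close> norm by the Luxemburg norm, since \<open>t \<le> 1 + t powr p x\<close>.\<close>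

lemma nn_integral_abs_le:
  assumes [measurable]: "u \<in> borel_measurable (lebesgue_on \<Omega>)" and l: "0 < l" and J: "J (\<lambda>x. u x / l) \<le> 1"
  shows "(\<integral>\<^sup>+x. ennreal \<bar>u x\<bar> \<partial>lebesgue_on \<Omega>) \<le> ennreal (l * (vol + 1))"
proof -
  have [measurable]: "indicator \<Omega> \<in> borel_measurable (lebesgue_on \<Omega>)"
    by (intro borel_measurable_lebesgue_on borel_measurable_indicator \<Omega>_borel)
  have "(\<integral>\<^sup>+x. ennreal \<bar>u x\<bar> \<partial>lebesgue_on \<Omega>)
      \<le> (\<integral>\<^sup>+x. ennreal l * (indicator \<Omega> x + ennreal (H x \<bar>u x / l\<bar>)) \<partial>lebesgue_on \<Omega>)"
  proof (rule nn_integral_mono_AE)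
    show "AE x in lebesgue_on \<Omega>. ennreal \<bar>u x\<bar> \<le> ennreal l * (indicator \<Omega> x + ennreal (H x \<bar>u x / l\<bar>))"
      using AE_regular
    proof eventually_elim
      case (elim x)
      have "\<bar>u x / l\<bar> \<le> 1 + H x \<bar>u x / l\<bar>" using elim by (intro le_1_add_H_log) auto
      then have "l * \<bar>u x / l\<bar> \<le> l * (1 + H x \<bar>u x / l\<bar>)" using l by (intro mult_left_mono) auto
      then have "ennreal \<bar>u x\<bar> \<le> ennreal (l * (1 + H x \<bar>u x / l\<bar>))"
        using l unfolding abs_divide by (intro ennreal_leI) simp
      then show ?case using elim l H_log_nonneg[of \<mu> x "\<bar>u x / l\<bar>" p q]
        by (simp add: ennreal_mult)
    qed
  qed
  also have "\<dots> = ennreal l * ((\<integral>\<^sup>+x. indicator \<Omega> x \<partial>lebesgue_on \<Omega>) + J (\<lambda>x. u x / l))"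
    by (simp add: modular_H_def nn_integral_cmult nn_integral_add)
  also have "(\<integral>\<^sup>+x. indicator \<Omega> x \<partial>lebesgue_on \<Omega>) = ennreal vol"
    by (subst nn_integral_lebesgue_on[OF \<Omega>_borel])
      (simp add: emeasure_\<Omega> flip: indicator_inter_arith)
  also have "ennreal l * (ennreal vol + J (\<lambda>x. u x / l)) \<le> ennreal l * (ennreal vol + ennreal 1)"
    using J by (intro mult_left_mono add_mono) auto
  also have "\<dots> = ennreal (l * (vol + 1))"
    using l vol_nonneg by (simp only: ennreal_plus[symmetric] ennreal_mult[symmetric])
  finally show ?thesis .
qed

lemma norm_H_le: "0 < l \<Longrightarrow> J (\<lambda>x. u x / l) \<le> 1 \<Longrightarrow> norm_H \<Omega> p q \<mu> u \<le> l"
  unfolding norm_H_def by (rule Luxemburg_le)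

lemma norm_H_nonneg:
  assumes "u \<in> L_H \<Omega> p q \<mu>" shows "0 \<le> norm_H \<Omega> p q \<mu> u"
proof -
  obtain l where "1 \<le> l" "J (\<lambda>x. u x / l) \<le> 1" using modular_small[OF assms, of 1] by auto
  then show ?thesis
    unfolding norm_H_def by (intro Luxemburg_nonneg[where m="\<lambda>l. J (\<lambda>x. u x / l)" and l=l]) auto
qed

lemma modular_le_1_of_norm_H_less:
  assumes u: "u \<in> L_H \<Omega> p q \<mu>" and l: "norm_H \<Omega> p q \<mu> u < l"
  shows "0 < l" "J (\<lambda>x. u x / l) \<le> 1"
proof -
  obtain l0 where l0: "l0 \<ge> 1" "J (\<lambda>x. u x / l0) \<le> 1" using modular_small[OF u, of 1] by auto
  have l0': "0 < l0" using l0 by simp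
  show "0 < l" "J (\<lambda>x. u x / l) \<le> 1"
    using Luxemburg_less[of l0 "\<lambda>l. J (\<lambda>x. u x / l)" l, OF l0' l0(2) modular_antimono_scale] l
    by (simp_all add: norm_H_def)
qed

abbreviation "JW u l \<equiv> J (\<lambda>x. u x / l) + J (\<lambda>x. norm (weak_gradient \<Omega> u x) / l)"

lemma norm_W1_H_eq: "norm_W1_H \<Omega> p q \<mu> u = Inf {l. l > 0 \<and> JW u l \<le> 1}"
  by (simp add: norm_W1_H_def)

lemma JW_small:
  assumes u: "u \<in> W1_H \<Omega> p q \<mu>" shows "\<exists>l>0. JW u l \<le> 1"
proof -
  have "u \<in> L_H \<Omega> p q \<mu>" "(\<lambda>x. norm (weak_gradient \<Omega> u x)) \<in> L_H \<Omega> p q \<mu>"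
    using u by (auto simp: W1_H_def)
  then obtain l1 l2 where l: "l1 \<ge> 1" "\<And>k. k \<ge> l1 \<Longrightarrow> J (\<lambda>x. u x / k) \<le> ennreal (1/2)"
     "l2 \<ge> 1" "\<And>k. k \<ge> l2 \<Longrightarrow> J (\<lambda>x. norm (weak_gradient \<Omega> u x) / k) \<le> ennreal (1/2)"
    using modular_small[of _ "1/2"] by (metis half_gt_zero zero_less_one)
  have "JW u (max l1 l2) \<le> ennreal (1/2) + ennreal (1/2)" by (intro add_mono l) auto
  also have "\<dots> = ennreal (1 / 2 + 1 / 2)" by (rule ennreal_plus[symmetric]) auto
  finally show ?thesis using l by (intro exI[of _ "max l1 l2"]) auto
qed

lemma JW_le_1_of_norm_less:
  assumes u: "u \<in> W1_H \<Omega> p q \<mu>" and l: "norm_W1_H \<Omega> p q \<mu> u < l"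
  shows "0 < l" "JW u l \<le> 1"
proof -
  obtain l0 where l0: "l0 > 0" "JW u l0 \<le> 1" using JW_small[OF u] by auto
  have anti: "JW u m \<le> JW u k" if "0 < k" "k \<le> m" for k m
    using that by (intro add_mono modular_antimono_scale)
  show "0 < l" "JW u l \<le> 1"
    using Luxemburg_less[of l0 "JW u" l, OF l0 anti] l by (simp_all add: norm_W1_H_eq)
qed

lemma norm_H_le_norm_W1_H:
  assumes u: "u \<in> W1_H \<Omega> p q \<mu>"
  shows "norm_H \<Omega> p q \<mu> u \<le> norm_W1_H \<Omega> p q \<mu> u"
proof (rule dense_ge)
  fix l assume "norm_W1_H \<Omega> p q \<mu> u < l"
  from JW_le_1_of_norm_less[OF u this] have "0 < l" "JW u l \<le> 1" by auto
  then show "norm_H \<Omega> p q \<mu> u \<le> l"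
    by (intro norm_H_le) (auto elim: order_trans[rotated] intro: add_increasing2)
qed

lemma norm_H_tendsto_0:
  assumes "\<And>l. 0 < l \<Longrightarrow> \<forall>\<^sub>F n in sequentially. J (\<lambda>x. w n x / l) \<le> 1"
  shows "(\<lambda>n. norm_H \<Omega> p q \<mu> (w n)) \<longlonglongrightarrow> 0"
proof (rule LIMSEQ_I)
  fix e :: real assume e: "0 < e"
  have "\<forall>\<^sub>F n in sequentially. J (\<lambda>x. w n x / (e / 2)) \<le> 1" using e by (intro assms) simp
  then have "\<forall>\<^sub>F n in sequentially. norm (norm_H \<Omega> p q \<mu> (w n) - 0) < e"
  proof (rule eventually_mono)
    fix n assume n: "J (\<lambda>x. w n x / (e / 2)) \<le> 1"
    have e2: "0 < e / 2" using e by simp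
    have "norm_H \<Omega> p q \<mu> (w n) \<le> e / 2" by (rule norm_H_le[OF e2 n])
    moreover have "0 \<le> norm_H \<Omega> p q \<mu> (w n)"
      unfolding norm_H_def by (rule Luxemburg_nonneg[where m="\<lambda>l. J (\<lambda>x. w n x / l)", OF e2 n])
    ultimately show "norm (norm_H \<Omega> p q \<mu> (w n) - 0) < e" using e by simp
  qed
  then show "\<exists>n0. \<forall>n\<ge>n0. norm (norm_H \<Omega> p q \<mu> (w n) - 0) < e" by (simp add: eventually_sequentially)
qed

lemma norm_H_cong_AE:
  assumes "AE x in lebesgue_on \<Omega>. u x = v x" shows "norm_H \<Omega> p q \<mu> u = norm_H \<Omega> p q \<mu> v"
proof -
  have "J (\<lambda>x. u x / l) = J (\<lambda>x. v x / l)" for l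
    by (rule modular_cong_AE) (use assms in \<open>eventually_elim, simp\<close>)
  then show ?thesis by (simp add: norm_H_def)
qed

end

section \<open>From local Lebesgue norms to the modular\<close>

context log_double_phase
begin

lemma W1_H_has_weak_gradient:
  assumes "u \<in> W1_H \<Omega> p q \<mu>" shows "has_weak_gradient \<Omega> u (weak_gradient \<Omega> u)"
proof -
  obtain g where "has_weak_gradient \<Omega> u g" using assms unfolding W1_H_def by blast
  then show ?thesis unfolding weak_gradient_def by (rule someI[of "has_weak_gradient \<Omega> u"])
qed

lemma nn_integral_lborel_abs_le:
  assumes U[measurable]: "U \<in> borel_measurable borel" and off: "\<And>x. x \<notin> \<Omega> \<Longrightarrow> U x = 0"
    and b: "0 < b" "J (\<lambda>x. U x / b) \<le> 1"
  shows "(\<integral>\<^sup>+x. ennreal \<bar>U x\<bar> \<partial>lborel) \<le> ennreal (b * (vol + 1))"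
proof -
  have "(\<integral>\<^sup>+x. ennreal \<bar>U x\<bar> \<partial>lborel) = (\<integral>\<^sup>+x. ennreal \<bar>U x\<bar> * indicator \<Omega> x \<partial>lborel)"
    using off by (intro nn_integral_cong) (auto simp: indicator_def)
  also have "\<dots> = (\<integral>\<^sup>+x. ennreal \<bar>U x\<bar> \<partial>lebesgue_on \<Omega>)"
    by (rule nn_integral_lebesgue_on[OF \<Omega>_borel, symmetric])
  also have "\<dots> \<le> ennreal (b * (vol + 1))"
    by (intro nn_integral_abs_le borel_measurable_lebesgue_on U b)
  finally show ?thesis .
qed

lemma integrable_of_modular:
  assumes U[measurable]: "U \<in> borel_measurable borel" and off: "\<And>x. x \<notin> \<Omega> \<Longrightarrow> U x = 0"
    and b: "0 < b" "J (\<lambda>x. U x / b) \<le> 1"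
  shows "integrable lborel U" "(\<integral>x. \<bar>U x\<bar> \<partial>lborel) \<le> b * (vol + 1)"
proof -
  have le: "(\<integral>\<^sup>+x. ennreal \<bar>U x\<bar> \<partial>lborel) \<le> ennreal (b * (vol + 1))"
    by (rule nn_integral_lborel_abs_le[OF U off b])
  show i: "integrable lborel U"
    unfolding integrable_iff_bounded using le_less_trans[OF le ennreal_less_top] by simp
  have "ennreal (\<integral>x. \<bar>U x\<bar> \<partial>lborel) = (\<integral>\<^sup>+x. ennreal \<bar>U x\<bar> \<partial>lborel)"
    using i by (intro nn_integral_eq_integral[symmetric]) auto
  also note le
  finally show "(\<integral>x. \<bar>U x\<bar> \<partial>lborel) \<le> b * (vol + 1)"
    by (rule ennreal_le_iff[THEN iffD1, rotated]) (use b(1) vol_nonneg in \<open>intro mult_nonneg_nonneg add_nonneg_nonneg; simp\<close>)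
qed

lemma W1_H_representative:
  assumes u: "u \<in> W1_H \<Omega> p q \<mu>" and b: "0 < b" "JW u b \<le> 1"
  obtains U G where "U \<in> borel_measurable borel" "\<And>x. x \<notin> \<Omega> \<Longrightarrow> U x = 0" "AE x in lebesgue_on \<Omega>. u x = U x"
    "integrable lborel U" "(\<integral>x. \<bar>U x\<bar> \<partial>lborel) \<le> b * (vol + 1)"
    "G \<in> borel_measurable borel" "AE x in lebesgue_on \<Omega>. weak_gradient \<Omega> u x = G x"
    "integrable lborel G" "(\<integral>x. norm (G x) \<partial>lborel) \<le> b * (vol + 1)"
    "J (\<lambda>x. norm (G x) / b) \<le> 1" "weak_grad_lborel \<Omega> U G"
proof -
  let ?g = "weak_gradient \<Omega> u"
  have wg: "has_weak_gradient \<Omega> u ?g" by (rule W1_H_has_weak_gradient[OF u])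
  have m: "u \<in> borel_measurable (lebesgue_on \<Omega>)" "?g \<in> borel_measurable (lebesgue_on \<Omega>)"
    using wg by (auto simp: has_weak_gradient_def intro: locally_integrable_measurable[OF open_\<Omega>])
  obtain U where
    U: "U \<in> borel_measurable borel" "\<And>x. x \<notin> \<Omega> \<Longrightarrow> U x = 0" "AE x in lebesgue_on \<Omega>. u x = U x"
    by (rule borel_representative[OF \<Omega>_borel m(1)]) (rule that)
  obtain G where
    G: "G \<in> borel_measurable borel" "\<And>x. x \<notin> \<Omega> \<Longrightarrow> G x = 0" "AE x in lebesgue_on \<Omega>. ?g x = G x"
    by (rule borel_representative[OF \<Omega>_borel m(2)]) (rule that)
  have "J (\<lambda>x. U x / b) = J (\<lambda>x. u x / b)"
    by (rule modular_cong_AE, rule eventually_mono[OF U(3)]) simp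
  moreover have "J (\<lambda>x. norm (G x) / b) = J (\<lambda>x. norm (?g x) / b)"
    by (rule modular_cong_AE, rule eventually_mono[OF G(3)]) simp
  moreover have "J (\<lambda>x. u x / b) \<le> JW u b" "J (\<lambda>x. norm (?g x) / b) \<le> JW u b"
    by (auto intro: add_increasing2 add_increasing)
  ultimately have J: "J (\<lambda>x. U x / b) \<le> 1" "J (\<lambda>x. norm (G x) / b) \<le> 1"
    using order_trans[OF _ b(2)] by simp_all
  have nG: "(\<lambda>x. norm (G x)) \<in> borel_measurable borel" using G(1) by measurable
  have Gi: "integrable lborel (\<lambda>x. norm (G x))" "(\<integral>x. \<bar>norm (G x)\<bar> \<partial>lborel) \<le> b * (vol + 1)"
    using integrable_of_modular[OF nG _ b(1) J(2)] G(2) by auto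
  show ?thesis
  proof (rule that[OF U _ _ G(1,3) _ _ J(2)])
    show "integrable lborel U" "(\<integral>x. \<bar>U x\<bar> \<partial>lborel) \<le> b * (vol + 1)"
      using integrable_of_modular[OF U(1,2) b(1) J(1)] by simp_all
    show "integrable lborel G" using Gi(1) G(1) by (simp add: integrable_norm_iff)
    show "(\<integral>x. norm (G x) \<partial>lborel) \<le> b * (vol + 1)" using Gi(2) by simp
    show "weak_grad_lborel \<Omega> U G" by (rule has_weak_gradient_lborel[OF open_\<Omega> wg U G])
  qed
qed

lemma nn_integral_one_lebesgue_on: "(\<integral>\<^sup>+x. 1 \<partial>lebesgue_on \<Omega>) = ennreal vol"
  by (subst nn_integral_lebesgue_on[OF \<Omega>_borel]) (simp add: emeasure_\<Omega>)

text \<open>Turns a modular bound into a bound in the constant exponent \<open>p1\<close> below \<open>p\<close>, by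
  \<open>t powr p1 \<le> 1 + t powr p x\<close>.\<close>

lemma nn_integral_powr_le:
  assumes G[measurable]: "g \<in> borel_measurable borel" "\<And>x. 0 \<le> g x" and b: "0 < b" "J (\<lambda>x. g x / b) \<le> 1"
    and A': "A' \<subseteq> \<Omega>" and p1: "0 \<le> p1" "\<And>x. x \<in> A' \<Longrightarrow> p1 \<le> p x"
  shows "(\<integral>\<^sup>+x. ennreal (g x powr p1) * indicator A' x \<partial>lborel) \<le> ennreal (b powr p1 * (vol + 1))"
proof -
  have [measurable]: "g \<in> borel_measurable (lebesgue_on \<Omega>)" by (intro borel_measurable_lebesgue_on G)
  have "(\<integral>\<^sup>+x. ennreal (g x powr p1) * indicator A' x \<partial>lborel)
      = (\<integral>\<^sup>+x. ennreal (g x powr p1) * indicator A' x * indicator \<Omega> x \<partial>lborel)"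
    using A' by (intro nn_integral_cong) (auto simp: indicator_def)
  also have "\<dots> = (\<integral>\<^sup>+x. ennreal (g x powr p1) * indicator A' x \<partial>lebesgue_on \<Omega>)"
    by (rule nn_integral_lebesgue_on[OF \<Omega>_borel, symmetric])
  also have "\<dots> \<le> (\<integral>\<^sup>+x. ennreal (b powr p1) * (1 + ennreal (H x \<bar>g x / b\<bar>)) \<partial>lebesgue_on \<Omega>)"
  proof (rule nn_integral_mono_AE)
    show "AE x in lebesgue_on \<Omega>. ennreal (g x powr p1) * indicator A' x
        \<le> ennreal (b powr p1) * (1 + ennreal (H x \<bar>g x / b\<bar>))"
      using AE_regular
    proof eventually_elim
      case (elim x)
      show ?case
      proof (cases "x \<in> A'")
        case True
        define t where "t = \<bar>g x / b\<bar>"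
        have t0: "0 \<le> t" by (simp add: t_def)
        have gt: "g x = b * t" using b G(2)[of x] by (simp add: t_def)
        have "t powr p1 \<le> 1 + t powr p x"
        proof (cases "t \<le> 1")
          case True
          then have "t powr p1 \<le> 1 powr p1" using p1 t0 by (intro powr_mono2) auto
          then show ?thesis by (simp add: add_increasing2)
        next
          case False
          then have "t powr p1 \<le> t powr p x" using p1(2)[OF True] by (intro powr_mono) auto
          then show ?thesis by simp
        qed
        also have "\<dots> \<le> 1 + H x t" using H_log_ge_powr[of \<mu> x t p q] elim t0 by simp
        finally have "g x powr p1 \<le> b powr p1 * (1 + H x t)"
          using b t0 unfolding gt by (simp add: powr_mult mult_left_mono)
        moreover have "0 \<le> H x t" using elim t0 by (intro H_log_nonneg) auto
        ultimately have "ennreal (g x powr p1) \<le> ennreal (b powr p1) * (1 + ennreal (H x t))"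
          by (simp add: ennreal_leI flip: ennreal_mult ennreal_1 ennreal_plus)
        then show ?thesis using True by (simp add: t_def)
      qed simp
    qed
  qed
  also have "\<dots> = ennreal (b powr p1) * (ennreal vol + J (\<lambda>x. g x / b))"
    by (simp add: modular_H_def nn_integral_cmult nn_integral_add nn_integral_one_lebesgue_on del: nn_integral_const)
  also have "\<dots> \<le> ennreal (b powr p1) * (ennreal vol + ennreal 1)"
    using b by (intro mult_left_mono add_mono) auto
  also have "\<dots> = ennreal (b powr p1 * (vol + 1))"
    using vol_nonneg by (simp only: ennreal_plus[symmetric] ennreal_mult[symmetric] powr_ge_zero zero_le_one add_nonneg_nonneg)
  finally show ?thesis .
qed

text \<open>On a piece where \<open>q\<close> stays below \<open>r\<close>, smallness in \<open>L\<^sup>r\<close> forces smallness of the modular: the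
  growth bound \<open>H x t \<le> C * (t + t powr r)\<close> is turned into \<open>small + large * t powr r\<close>.\<close>

lemma modular_piece_small:
  assumes A: "A \<in> sets borel" "A \<subseteq> \<Omega>" and r: "1 \<le> r" and \<kappa>: "0 < \<kappa>" "\<And>x. x \<in> A \<Longrightarrow> q x + \<kappa> \<le> r"
    and c: "0 < c" and l: "0 < l"
  shows "\<exists>d>0. \<forall>w\<in>borel_measurable borel. (\<integral>\<^sup>+x. ennreal (\<bar>w x\<bar> powr r) * indicator A x \<partial>lborel) \<le> ennreal d \<longrightarrow>
    (\<integral>\<^sup>+x. ennreal (H x \<bar>w x / l\<bar>) * indicator A x \<partial>lebesgue_on \<Omega>) \<le> ennreal c"
proof -
  obtain M0 where M0: "AE x in lebesgue_on \<Omega>. 0 \<le> \<mu> x \<and> \<mu> x \<le> M0" using \<mu>_bounded by blast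
  define M where "M = max 0 M0"
  have M: "0 \<le> M" "AE x in lebesgue_on \<Omega>. \<mu> x \<le> M"
    using M0 by (auto simp: M_def elim: eventually_mono)
  define C where "C = 1 + M * (2 + 1 / \<kappa>)"
  have C: "1 \<le> C" using M \<kappa> by (simp add: C_def)
  \<comment> \<open>the constant \<open>k\<close> leaves \<open>c / 2\<close> for the \<open>L\<^sup>r\<close> term, which \<open>d\<close> then achieves\<close>
  define k where "k = c / (2 * C * (vol + 1))"
  have k: "0 < k" using c C vol_nonneg by (simp add: k_def)
  define D where "D = C * (k powr (1 - r) + 1) * (1 / l) powr r"
  have D: "0 \<le> D" using C by (simp add: D_def)
  define d where "d = c / (2 * (D + 1))"
  have d: "0 < d" using c D by (simp add: d_def)
  have total: "C * k * vol + D * d \<le> c"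
  proof -
    have "C * k * vol = c / 2 * (vol / (vol + 1))" using C by (simp add: k_def)
    also have "\<dots> \<le> c / 2 * 1" using c vol_nonneg by (intro mult_left_mono) auto
    finally have 1: "C * k * vol \<le> c / 2" by simp
    have "D * d = c / 2 * (D / (D + 1))" by (simp add: d_def)
    also have "\<dots> \<le> c / 2 * 1" using c D by (intro mult_left_mono) auto
    finally show ?thesis using 1 by simp
  qed
  have "(\<integral>\<^sup>+x. ennreal (H x \<bar>w x / l\<bar>) * indicator A x \<partial>lebesgue_on \<Omega>) \<le> ennreal c"
    if w: "w \<in> borel_measurable borel" and small: "(\<integral>\<^sup>+x. ennreal (\<bar>w x\<bar> powr r) * indicator A x \<partial>lborel) \<le> ennreal d" for w
  proof -
    have [measurable]: "w \<in> borel_measurable (lebesgue_on \<Omega>)" "(indicator A :: 'a \<Rightarrow> ennreal) \<in> borel_measurable (lebesgue_on \<Omega>)"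
      using w A by (auto intro!: borel_measurable_lebesgue_on)
    have "(\<integral>\<^sup>+x. ennreal (H x \<bar>w x / l\<bar>) * indicator A x \<partial>lebesgue_on \<Omega>) \<le>
       (\<integral>\<^sup>+x. ennreal (C * k) * 1 + ennreal D * (ennreal (\<bar>w x\<bar> powr r) * indicator A x) \<partial>lebesgue_on \<Omega>)"
    proof (rule nn_integral_mono_AE)
      show "AE x in lebesgue_on \<Omega>. ennreal (H x \<bar>w x / l\<bar>) * indicator A x
          \<le> ennreal (C * k) * 1 + ennreal D * (ennreal (\<bar>w x\<bar> powr r) * indicator A x)"
        using AE_regular M(2)
      proof eventually_elim
        case (elim x)
        show ?case
        proof (cases "x \<in> A")
          case True
          define t where "t = \<bar>w x / l\<bar>"
          have t0: "0 \<le> t" by (simp add: t_def)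
          have "H x t \<le> C * (t + t powr r)"
            unfolding C_def using elim \<kappa>(1) \<kappa>(2)[OF True] t0 by (intro H_log_growth) auto
          also have "\<dots> \<le> C * ((k + k powr (1 - r) * t powr r) + t powr r)"
            using C le_add_powr[OF t0 k r] by (intro mult_left_mono add_right_mono) auto
          also have "\<dots> = C * k + C * (k powr (1 - r) + 1) * t powr r" by (simp add: algebra_simps)
          also have "t = (1 / l) * \<bar>w x\<bar>" using l by (simp add: t_def abs_divide)
          also have "C * (k powr (1 - r) + 1) * ((1 / l) * \<bar>w x\<bar>) powr r = D * \<bar>w x\<bar> powr r"
            using l by (simp only: D_def powr_mult mult.assoc)
          finally have "ennreal (H x t) \<le> ennreal (C * k + D * \<bar>w x\<bar> powr r)"
            using l by (intro ennreal_leI) (simp add: t_def abs_divide)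
          also have "\<dots> = ennreal (C * k) + ennreal D * ennreal (\<bar>w x\<bar> powr r)"
            using C k D by (simp add: ennreal_mult)
          finally show ?thesis using True by (simp add: t_def)
        qed simp
      qed
    qed
    also have "\<dots> = ennreal (C * k) * (\<integral>\<^sup>+x. 1 \<partial>lebesgue_on \<Omega>)
        + ennreal D * (\<integral>\<^sup>+x. ennreal (\<bar>w x\<bar> powr r) * indicator A x \<partial>lebesgue_on \<Omega>)"
      by (subst nn_integral_add; (subst nn_integral_cmult)?) (auto simp: nn_integral_cmult)
    also have "(\<integral>\<^sup>+x. ennreal (\<bar>w x\<bar> powr r) * indicator A x \<partial>lebesgue_on \<Omega>)
        = (\<integral>\<^sup>+x. ennreal (\<bar>w x\<bar> powr r) * indicator A x * indicator \<Omega> x \<partial>lborel)"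
      by (rule nn_integral_lebesgue_on[OF \<Omega>_borel])
    also have "\<dots> = (\<integral>\<^sup>+x. ennreal (\<bar>w x\<bar> powr r) * indicator A x \<partial>lborel)"
      using A(2) by (intro nn_integral_cong) (auto simp: indicator_def)
    also have "ennreal (C * k) * (\<integral>\<^sup>+x. 1 \<partial>lebesgue_on \<Omega>) + ennreal D * \<dots> \<le> ennreal (C * k) * ennreal vol + ennreal D * ennreal d"
      using small unfolding nn_integral_one_lebesgue_on by (intro add_mono mult_left_mono) auto
    also have "\<dots> = ennreal (C * k * vol + D * d)"
      using C k D d vol_nonneg by (simp add: ennreal_mult)
    also have "\<dots> \<le> ennreal c" by (rule ennreal_leI[OF total])
    finally show ?thesis .
  qed
  with d show ?thesis by blast
qed

definition modular_cauchy :: "(nat \<Rightarrow> 'a \<Rightarrow> real) \<Rightarrow> bool" where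
  "modular_cauchy W \<longleftrightarrow> (\<forall>l>0. \<forall>c>0. \<exists>N. \<forall>m\<ge>N. \<forall>n\<ge>N. J (\<lambda>x. (W m x - W n x) / l) \<le> ennreal c)"

lemma modular_cauchy_of_pieces:
  assumes F: "finite F" "\<Omega> \<subseteq> (\<Union>i\<in>F. A i)"
    and A: "\<And>i. i \<in> F \<Longrightarrow> A i \<in> sets borel" "\<And>i. i \<in> F \<Longrightarrow> A i \<subseteq> \<Omega>"
    and r: "\<And>i. i \<in> F \<Longrightarrow> 1 \<le> r i" "\<And>i. i \<in> F \<Longrightarrow> 0 < \<kappa> i"
      "\<And>i x. i \<in> F \<Longrightarrow> x \<in> A i \<Longrightarrow> q x + \<kappa> i \<le> r i"
    and W: "\<And>n. W n \<in> borel_measurable borel" and cauchy: "\<And>i. i \<in> F \<Longrightarrow> Lr_cauchy (A i) (r i) W"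
  shows "modular_cauchy W"
  unfolding modular_cauchy_def
proof (intro allI impI)
  fix l c :: real assume l: "0 < l" and c: "0 < c"
  define c' where "c' = c / (real (card F) + 1)"
  have c': "0 < c'" using c by (simp add: c'_def)
  let ?I = "\<lambda>i m n. \<integral>\<^sup>+x. ennreal (H x \<bar>(W m x - W n x) / l\<bar>) * indicator (A i) x \<partial>lebesgue_on \<Omega>"
  have "\<forall>i\<in>F. \<forall>\<^sub>F N in sequentially. \<forall>m\<ge>N. \<forall>n\<ge>N. ?I i m n \<le> ennreal c'"
  proof
    fix i assume i: "i \<in> F"
    obtain d where d: "d > 0" and dw: "\<And>w. w \<in> borel_measurable borel \<Longrightarrow>
        (\<integral>\<^sup>+x. ennreal (\<bar>w x\<bar> powr r i) * indicator (A i) x \<partial>lborel) \<le> ennreal d \<Longrightarrow>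
        (\<integral>\<^sup>+x. ennreal (H x \<bar>w x / l\<bar>) * indicator (A i) x \<partial>lebesgue_on \<Omega>) \<le> ennreal c'"
      using modular_piece_small[OF A[OF i] r(1)[OF i] r(2)[OF i] r(3)[OF i] c' l] by blast
    obtain N where N: "\<And>m n. m \<ge> N \<Longrightarrow> n \<ge> N \<Longrightarrow>
        (\<integral>\<^sup>+x. ennreal (\<bar>W m x - W n x\<bar> powr r i) * indicator (A i) x \<partial>lborel) \<le> ennreal d"
      using cauchy[OF i] d unfolding Lr_cauchy_def by blast
    have "?I i m n \<le> ennreal c'" if "m \<ge> N" "n \<ge> N" for m n
      by (rule dw[OF borel_measurable_diff[OF W W] N[OF that]])
    then show "\<forall>\<^sub>F N in sequentially. \<forall>m\<ge>N. \<forall>n\<ge>N. ?I i m n \<le> ennreal c'"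
      unfolding eventually_sequentially by (meson order_trans)
  qed
  then have "\<forall>\<^sub>F N in sequentially. \<forall>i\<in>F. \<forall>m\<ge>N. \<forall>n\<ge>N. ?I i m n \<le> ennreal c'"
    using F(1) by (simp add: eventually_ball_finite)
  then obtain N where N: "\<And>i m n. i \<in> F \<Longrightarrow> m \<ge> N \<Longrightarrow> n \<ge> N \<Longrightarrow> ?I i m n \<le> ennreal c'"
    unfolding eventually_sequentially by blast
  have "J (\<lambda>x. (W m x - W n x) / l) \<le> ennreal c" if mn: "m \<ge> N" "n \<ge> N" for m n
  proof -
    have [measurable]: "W n \<in> borel_measurable (lebesgue_on \<Omega>)" for n by (intro borel_measurable_lebesgue_on W)
    have Am: "(indicator (A i) :: 'a \<Rightarrow> ennreal) \<in> borel_measurable (lebesgue_on \<Omega>)" if "i \<in> F" for i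
      using A(1)[OF that] by (intro borel_measurable_lebesgue_on borel_measurable_indicator)
    have "J (\<lambda>x. (W m x - W n x) / l) \<le>
        (\<integral>\<^sup>+x. (\<Sum>i\<in>F. ennreal (H x \<bar>(W m x - W n x) / l\<bar>) * indicator (A i) x) \<partial>lebesgue_on \<Omega>)"
      unfolding modular_H_def
    proof (rule nn_integral_mono_AE)
      show "AE x in lebesgue_on \<Omega>. ennreal (H x \<bar>(W m x - W n x) / l\<bar>) \<le>
         (\<Sum>i\<in>F. ennreal (H x \<bar>(W m x - W n x) / l\<bar>) * indicator (A i) x)"
        using AE_in_\<Omega>
      proof eventually_elim
        case (elim x)
        then obtain i where i: "i \<in> F" "x \<in> A i" using F(2) by auto
        have "ennreal (H x \<bar>(W m x - W n x) / l\<bar>) = ennreal (H x \<bar>(W m x - W n x) / l\<bar>) * indicator (A i) x"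
          using i by simp
        also have "\<dots> \<le> (\<Sum>i\<in>F. ennreal (H x \<bar>(W m x - W n x) / l\<bar>) * indicator (A i) x)"
          by (rule member_le_sum[OF i(1) _ F(1)]) simp
        finally show ?case .
      qed
    qed
    also have "\<dots> = (\<Sum>i\<in>F. ?I i m n)"
      by (intro nn_integral_sum borel_measurable_times_ennreal Am) measurable
    also have "\<dots> \<le> (\<Sum>i\<in>F. ennreal c')" using mn by (intro sum_mono N)
    also have "\<dots> = ennreal (real (card F) * c')" using c' by (simp add: ennreal_mult ennreal_of_nat_eq_real_of_nat)
    also have "\<dots> \<le> ennreal c" using c by (intro ennreal_leI) (simp add: c'_def field_simps)
    finally show ?thesis .
  qed
  then show "\<exists>N. \<forall>m\<ge>N. \<forall>n\<ge>N. J (\<lambda>x. (W m x - W n x) / l) \<le> ennreal c" by blast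
qed

text \<open>The \<open>L\<^sup>1\<close> bound gives an almost everywhere convergent subsequence, and Fatou's lemma carries the modular estimates to the
  limit.\<close>

lemma modular_complete:
  assumes W: "\<And>n. W n \<in> borel_measurable borel" "\<And>n x. x \<notin> \<Omega> \<Longrightarrow> W n x = 0" "\<And>n. integrable lborel (W n)"
    and cauchy: "modular_cauchy W"
  obtains v where "v \<in> borel_measurable borel"
    "\<And>l c. 0 < l \<Longrightarrow> 0 < c \<Longrightarrow> \<exists>N. \<forall>n\<ge>N. J (\<lambda>x. (W n x - v x) / l) \<le> ennreal c"
proof -
  obtain k where k: "strict_mono k" "AE x in lborel. Cauchy (\<lambda>i. W (k i) x)"
  proof (rule cauchy_L1_AE_cauchy_subseq[of lborel W])
    fix e :: real assume e: "0 < e"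
    define l where "l = e / (2 * (vol + 1))"
    have l: "0 < l" "l * (vol + 1) < e" using e vol_nonneg by (auto simp: l_def field_simps intro: add_pos_nonneg)
    obtain N where N: "\<And>m n. m \<ge> N \<Longrightarrow> n \<ge> N \<Longrightarrow> J (\<lambda>x. (W m x - W n x) / l) \<le> ennreal 1"
      using cauchy l unfolding modular_cauchy_def by (meson zero_less_one)
    have "(LINT x|lborel. norm (W i x - W j x)) < e" if "i \<ge> N" "j \<ge> N" for i j
      using integrable_of_modular(2)[OF borel_measurable_diff[OF W(1) W(1)] _ l(1), of i j]
        N[OF that] l W(2) by simp
    then show "\<exists>N. \<forall>i\<ge>N. \<forall>j\<ge>N. (LINT x|lborel. norm (W i x - W j x)) < e" by blast
  qed (use W in auto)
  define v where "v x = lim (\<lambda>i. W (k i) x)" for x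
  have v: "v \<in> borel_measurable borel" unfolding v_def using W(1) by (intro borel_measurable_lim_metric)
  have conv: "AE x in lebesgue_on \<Omega>. (\<lambda>i. W (k i) x) \<longlonglongrightarrow> v x"
    unfolding AE_lebesgue_on_iff[OF \<Omega>_borel] using k(2)
    by eventually_elim (auto simp: v_def convergent_LIMSEQ_iff[symmetric] Cauchy_convergent)
  show ?thesis
  proof (rule that[OF v])
    fix l c :: real assume l: "0 < l" and c: "0 < c"
    then obtain N where N: "\<And>m n. m \<ge> N \<Longrightarrow> n \<ge> N \<Longrightarrow> J (\<lambda>x. (W m x - W n x) / l) \<le> ennreal c"
      using cauchy unfolding modular_cauchy_def by meson
    have [measurable]: "W n \<in> borel_measurable (lebesgue_on \<Omega>)" for n by (intro borel_measurable_lebesgue_on W)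
    have "J (\<lambda>x. (W n x - v x) / l) \<le> ennreal c" if n: "n \<ge> N" for n
    proof -
      let ?h = "\<lambda>i x. ennreal (H x \<bar>(W n x - W (k i) x) / l\<bar>)"
      have "J (\<lambda>x. (W n x - v x) / l) \<le> (\<integral>\<^sup>+x. liminf (\<lambda>i. ?h i x) \<partial>lebesgue_on \<Omega>)"
        unfolding modular_H_def
      proof (rule nn_integral_mono_AE)
        show "AE x in lebesgue_on \<Omega>. ennreal (H x \<bar>(W n x - v x) / l\<bar>) \<le> liminf (\<lambda>i. ?h i x)"
          using AE_regular conv
        proof eventually_elim
          case (elim x)
          have "(\<lambda>i. \<bar>(W n x - W (k i) x) / l\<bar>) \<longlonglongrightarrow> \<bar>(W n x - v x) / l\<bar>"
            using elim l by (intro tendsto_intros) auto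
          then have "(\<lambda>i. ?h i x) \<longlonglongrightarrow> ennreal (H x \<bar>(W n x - v x) / l\<bar>)"
            using elim by (intro tendsto_ennrealI H_log_tendsto) auto
          then show ?case using lim_imp_Liminf[OF sequentially_bot] by (metis order_refl)
        qed
      qed
      also have "\<dots> \<le> liminf (\<lambda>i. \<integral>\<^sup>+x. ?h i x \<partial>lebesgue_on \<Omega>)"
        by (rule nn_integral_liminf) measurable
      also have "\<dots> \<le> limsup (\<lambda>i. \<integral>\<^sup>+x. ?h i x \<partial>lebesgue_on \<Omega>)"
        by (rule Liminf_le_Limsup) simp
      also have "\<dots> \<le> ennreal c"
      proof (rule Limsup_bounded)
        show "\<forall>\<^sub>F i in sequentially. (\<integral>\<^sup>+x. ?h i x \<partial>lebesgue_on \<Omega>) \<le> ennreal c"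
          unfolding eventually_sequentially
        proof (intro exI[of _ N] allI impI)
          fix i assume "N \<le> i"
          then have "N \<le> k i" using seq_suble[OF k(1), of i] by simp
          then show "(\<integral>\<^sup>+x. ?h i x \<partial>lebesgue_on \<Omega>) \<le> ennreal c"
            using N[OF n] unfolding modular_H_def by blast
        qed
      qed
      finally show ?thesis .
    qed
    then show "\<exists>N. \<forall>n\<ge>N. J (\<lambda>x. (W n x - v x) / l) \<le> ennreal c" by blast
  qed
qed

end

section \<open>Calculus of test functions and weak gradients\<close>

definition gradient :: "('a::euclidean_space \<Rightarrow> real) \<Rightarrow> 'a \<Rightarrow> 'a" where
  "gradient \<phi> x = (\<Sum>b\<in>Basis. partial_deriv b \<phi> x *\<^sub>R b)"

lemma gradient_inner: "b \<in> Basis \<Longrightarrow> gradient \<phi> x \<bullet> b = partial_deriv b \<phi> x"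
  by (simp add: gradient_def inner_sum_left inner_Basis if_distrib cong: if_cong)

lemma test_function_zero_outside: "\<phi> \<in> test_functions \<Omega> \<Longrightarrow> x \<notin> \<Omega> \<Longrightarrow> \<phi> x = 0"
  using closure_subset[of "{x. \<phi> x \<noteq> 0}"] unfolding test_functions_def by blast

lemma partial_deriv_test_function:
  assumes \<phi>: "\<phi> \<in> test_functions \<Omega>" and b: "b \<in> Basis"
  shows "partial_deriv b \<phi> \<in> test_functions \<Omega>"
proof (rule test_functionI)
  let ?K = "closure {x. \<phi> x \<noteq> 0}"
  show "smooth (partial_deriv b \<phi>)" by (rule smooth_partial_deriv[OF test_function_smooth[OF \<phi>] b])
  show "compact ?K" "?K \<subseteq> \<Omega>" using \<phi> by (auto simp: test_functions_def)
  fix y assume y: "y \<notin> ?K"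
  have z: "\<phi> x = 0" if "x \<notin> ?K" for x using that closure_subset[of "{x. \<phi> x \<noteq> 0}"] by blast
  show "partial_deriv b \<phi> y = 0"
  proof (rule partial_deriv_eq)
    show "(\<phi> has_derivative (\<lambda>h. 0)) (at y)"
    proof (rule has_derivative_transform_within_open[OF has_derivative_const[of 0], of "- ?K"])
      show "open (- ?K)" by (rule open_Compl[OF closed_closure])
      show "0 = \<phi> x" if "x \<in> - ?K" for x using z[of x] that by simp
    qed (use y in simp)
  qed
qed

lemma test_function_integrable:
  fixes \<phi> :: "'a::euclidean_space \<Rightarrow> real"
  assumes \<phi>: "\<phi> \<in> test_functions \<Omega>" shows "integrable lborel \<phi>"
proof -
  let ?K = "closure {x. \<phi> x \<noteq> 0}"
  have "integrable lborel (\<lambda>x. indicator ?K x *\<^sub>R \<phi> x)"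
    using \<phi> by (intro borel_integrable_compact smooth_continuous_on test_function_smooth) (auto simp: test_functions_def)
  moreover have "(\<lambda>x. indicator ?K x *\<^sub>R \<phi> x) = \<phi>"
  proof
    show "indicator ?K x *\<^sub>R \<phi> x = \<phi> x" for x
      using closure_subset[of "{x. \<phi> x \<noteq> 0}"] by (auto simp: indicator_def)
  qed
  ultimately show ?thesis by (simp only:)
qed

lemma test_function_bounded:
  fixes \<phi> :: "'a::euclidean_space \<Rightarrow> real"
  assumes \<phi>: "\<phi> \<in> test_functions \<Omega>" obtains C where "0 \<le> C" "\<And>x. \<bar>\<phi> x\<bar> \<le> C"
proof -
  let ?K = "closure {x. \<phi> x \<noteq> 0}"
  have "bounded (\<phi> ` ?K)"
    using \<phi> by (intro compact_imp_bounded compact_continuous_image smooth_continuous_on test_function_smooth)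
      (auto simp: test_functions_def)
  then obtain C where C: "0 < C" "\<And>v. v \<in> \<phi> ` ?K \<Longrightarrow> norm v \<le> C" unfolding bounded_pos by blast
  have "\<bar>\<phi> x\<bar> \<le> C" for x
    using C(1) C(2)[OF imageI, of x] closure_subset[of "{x. \<phi> x \<noteq> 0}"]
    by (cases "\<phi> x = 0") auto
  with C(1) show ?thesis by (intro that[of C]) auto
qed

lemma test_function_mult:
  assumes \<phi>: "\<phi> \<in> test_functions \<Omega>" and \<psi>: "smooth \<psi>"
  shows "(\<lambda>x. \<phi> x * \<psi> x) \<in> test_functions \<Omega>"
proof (rule test_functionI)
  let ?K = "closure {x. \<phi> x \<noteq> 0}"
  show "smooth (\<lambda>x. \<phi> x * \<psi> x)" by (intro smooth_mult test_function_smooth[OF \<phi>] \<psi>)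
  show "compact ?K" "?K \<subseteq> \<Omega>" using \<phi> by (auto simp: test_functions_def)
  show "\<phi> x * \<psi> x = 0" if "x \<notin> ?K" for x
    using that closure_subset[of "{x. \<phi> x \<noteq> 0}"] by auto
qed

lemma integral_partial_deriv_line:
  fixes \<phi> :: "'a::euclidean_space \<Rightarrow> real"
  assumes \<phi>: "smooth \<phi>" and b: "b \<in> Basis" and T: "0 \<le> T"
  shows "(\<integral>t. partial_deriv b \<phi> (x + t *\<^sub>R b) * indicator {0..T} t \<partial>lborel) = \<phi> (x + T *\<^sub>R b) - \<phi> x"
proof -
  have "(\<integral>t. partial_deriv b \<phi> (x + t *\<^sub>R b) * indicator {0..T} t \<partial>lborel) = \<phi> (x + T *\<^sub>R b) - \<phi> (x + 0 *\<^sub>R b)"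
  proof (rule integral_FTC_Icc_real[OF T])
    fix t
    let ?y = "x + t *\<^sub>R b"
    have d: "(\<phi> has_derivative frechet_derivative \<phi> (at ?y)) (at ?y)"
      using smooth_differentiable[OF \<phi>] frechet_derivative_works by blast
    have "((\<lambda>t. x + t *\<^sub>R b) has_derivative (\<lambda>h. h *\<^sub>R b)) (at t)"
      by (auto intro!: derivative_eq_intros)
    from diff_chain_at[OF this d]
    have "((\<lambda>t. \<phi> (x + t *\<^sub>R b)) has_derivative (\<lambda>h. frechet_derivative \<phi> (at ?y) (h *\<^sub>R b))) (at t)"
      by (simp add: o_def)
    moreover have "(\<lambda>h. frechet_derivative \<phi> (at ?y) (h *\<^sub>R b)) = (*) (partial_deriv b \<phi> ?y)"
      using linear_scale[OF has_derivative_linear[OF d], of _ b]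
      by (simp add: partial_deriv_def fun_eq_iff)
    ultimately show "((\<lambda>t. \<phi> (x + t *\<^sub>R b)) has_real_derivative partial_deriv b \<phi> ?y) (at t)"
      by (simp only: has_field_derivative_def)
    have "continuous_on UNIV (\<lambda>t. partial_deriv b \<phi> (x + t *\<^sub>R b))"
      by (intro continuous_on_compose2[OF smooth_continuous_on[OF smooth_partial_deriv[OF \<phi> b], of UNIV]] continuous_intros) auto
    then show "isCont (\<lambda>t. partial_deriv b \<phi> (x + t *\<^sub>R b)) t"
      by (simp add: continuous_on_eq_continuous_at)
  qed
  then show ?thesis by simp
qed

lemma line_integrable:
  fixes f :: "'a::euclidean_space \<Rightarrow> real"
  assumes f: "integrable lborel f"
  shows "integrable (lborel \<Otimes>\<^sub>M lborel) (\<lambda>(x, t). f (x + t *\<^sub>R b) * indicator {0..T::real} t)"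
    and "(\<integral>\<^sup>+x. \<integral>\<^sup>+t. ennreal \<bar>f (x + t *\<^sub>R b)\<bar> * indicator {0..T} t \<partial>lborel \<partial>lborel)
       = emeasure lborel {0..T} * (\<integral>\<^sup>+x. ennreal \<bar>f x\<bar> \<partial>lborel)"
proof -
  have [measurable]: "f \<in> borel_measurable borel" using f by simp
  have "(\<integral>\<^sup>+x. \<integral>\<^sup>+t. ennreal \<bar>f (x + t *\<^sub>R b)\<bar> * indicator {0..T} t \<partial>lborel \<partial>lborel)
      = (\<integral>\<^sup>+t. \<integral>\<^sup>+x. ennreal \<bar>f (x + t *\<^sub>R b)\<bar> * indicator {0..T} t \<partial>lborel \<partial>lborel)"
    by (rule lborel_pair.Fubini') measurable
  also have "\<dots> = (\<integral>\<^sup>+t. (\<integral>\<^sup>+x. ennreal \<bar>f x\<bar> \<partial>lborel) * indicator {0..T} t \<partial>lborel)"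
  proof (rule nn_integral_cong)
    fix t
    show "(\<integral>\<^sup>+x. ennreal \<bar>f (x + t *\<^sub>R b)\<bar> * indicator {0..T} t \<partial>lborel) = (\<integral>\<^sup>+x. ennreal \<bar>f x\<bar> \<partial>lborel) * indicator {0..T} t"
      using nn_integral_translate[of "\<lambda>x. ennreal \<bar>f x\<bar>" "t *\<^sub>R b"] by (simp add: nn_integral_multc)
  qed
  also have "\<dots> = (\<integral>\<^sup>+x. ennreal \<bar>f x\<bar> \<partial>lborel) * emeasure lborel {0..T}"
    by (rule nn_integral_cmult_indicator) simp
  finally show eq: "(\<integral>\<^sup>+x. \<integral>\<^sup>+t. ennreal \<bar>f (x + t *\<^sub>R b)\<bar> * indicator {0..T} t \<partial>lborel \<partial>lborel)
       = emeasure lborel {0..T} * (\<integral>\<^sup>+x. ennreal \<bar>f x\<bar> \<partial>lborel)"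
    by (simp only: mult.commute)
  show "integrable (lborel \<Otimes>\<^sub>M lborel) (\<lambda>(x, t). f (x + t *\<^sub>R b) * indicator {0..T} t)"
  proof (rule integrableI_bounded)
    have "(\<integral>\<^sup>+z. ennreal (norm (case z of (x, t) \<Rightarrow> f (x + t *\<^sub>R b) * indicator {0..T} t)) \<partial>(lborel \<Otimes>\<^sub>M lborel))
      = (\<integral>\<^sup>+x. \<integral>\<^sup>+t. ennreal \<bar>f (x + t *\<^sub>R b)\<bar> * indicator {0..T} t \<partial>lborel \<partial>lborel)"
      by (subst lborel.nn_integral_fst[symmetric]) (auto intro!: nn_integral_cong simp: abs_mult indicator_def)
    also have "\<dots> < \<infinity>"
      unfolding eq using f by (cases "0 \<le> T") (simp_all add: integrable_iff_bounded ennreal_mult_less_top)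
    finally show "(\<integral>\<^sup>+z. ennreal (norm (case z of (x, t) \<Rightarrow> f (x + t *\<^sub>R b) * indicator {0..T} t)) \<partial>(lborel \<Otimes>\<^sub>M lborel)) < \<infinity>" .
  qed measurable
qed

text \<open>Translating by one unit in direction \<open>b\<close> does not change the integral of \<open>\<phi>\<close>, and changes it
  by the integral of the derivative.\<close>

lemma integral_partial_deriv_test_function:
  fixes \<phi> :: "'a::euclidean_space \<Rightarrow> real"
  assumes \<phi>: "\<phi> \<in> test_functions \<Omega>" and b: "b \<in> Basis"
  shows "(\<integral>x. partial_deriv b \<phi> x \<partial>lborel) = 0"
proof -
  let ?f = "partial_deriv b \<phi>"
  have f: "integrable lborel ?f" by (rule test_function_integrable[OF partial_deriv_test_function[OF \<phi> b]])
  have [measurable]: "?f \<in> borel_measurable borel" "\<phi> \<in> borel_measurable borel"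
    using f test_function_integrable[OF \<phi>] by auto
  have tr: "(\<integral>x. g (x + t *\<^sub>R b) \<partial>lborel) = (\<integral>x. g x \<partial>lborel)"
    if "g \<in> borel_measurable borel" for g :: "'a \<Rightarrow> real" and t
    using integral_rescale[OF that, of 1 "t *\<^sub>R b"] by (simp add: add.commute)
  have i: "integrable lborel (\<lambda>x. \<phi> (x + 1 *\<^sub>R b))"
    using integrable_rescale[OF test_function_integrable[OF \<phi>], of 1 b] by (simp add: add.commute)
  have "0 = (\<integral>x. \<phi> (x + 1 *\<^sub>R b) - \<phi> x \<partial>lborel)"
    using i test_function_integrable[OF \<phi>] tr[of \<phi> 1] by simp
  also have "\<dots> = (\<integral>x. (\<integral>t. ?f (x + t *\<^sub>R b) * indicator {0..1} t \<partial>lborel) \<partial>lborel)"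
    using test_function_smooth[OF \<phi>] b by (simp add: integral_partial_deriv_line)
  also have "\<dots> = (\<integral>t. (\<integral>x. ?f (x + t *\<^sub>R b) * indicator {0..1} t \<partial>lborel) \<partial>lborel)"
    by (rule lborel_pair.Fubini_integral[symmetric]) (rule line_integrable(1)[OF f])
  also have "\<dots> = (\<integral>t. (\<integral>x. ?f x \<partial>lborel) * indicator {0..1::real} t \<partial>lborel)"
    by (simp add: tr)
  also have "\<dots> = (\<integral>x. ?f x \<partial>lborel)" by simp
  finally show ?thesis by simp
qed

lemma integration_by_parts_test_function:
  fixes \<phi> :: "'a::euclidean_space \<Rightarrow> real"
  assumes \<phi>: "\<phi> \<in> test_functions \<Omega>" and \<psi>: "\<psi> \<in> test_functions \<Omega>" and b: "b \<in> Basis"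
  shows "(\<integral>x. \<phi> x * partial_deriv b \<psi> x \<partial>lborel) = - (\<integral>x. partial_deriv b \<phi> x * \<psi> x \<partial>lborel)"
proof -
  note s = test_function_smooth[OF \<phi>] test_function_smooth[OF \<psi>]
  have pd: "partial_deriv b (\<lambda>x. \<phi> x * \<psi> x) x = \<phi> x * partial_deriv b \<psi> x + partial_deriv b \<phi> x * \<psi> x" for x
  proof -
    have "((\<lambda>x. \<phi> x * \<psi> x) has_derivative (\<lambda>h. \<phi> x * frechet_derivative \<psi> (at x) h
        + frechet_derivative \<phi> (at x) h * \<psi> x)) (at x)"
      using s by (intro has_derivative_mult) (auto simp: smooth_differentiable frechet_derivative_works[symmetric])
    then show ?thesis by (simp add: partial_deriv_eq) (simp add: partial_deriv_def)
  qed
  have i: "integrable lborel (\<lambda>x. \<phi> x * partial_deriv b \<psi> x)" "integrable lborel (\<lambda>x. partial_deriv b \<phi> x * \<psi> x)"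
    using test_function_integrable[OF test_function_mult[OF \<phi> smooth_partial_deriv[OF s(2) b]]]
      test_function_integrable[OF test_function_mult[OF partial_deriv_test_function[OF \<phi> b] s(2)]] by auto
  have "0 = (\<integral>x. partial_deriv b (\<lambda>x. \<phi> x * \<psi> x) x \<partial>lborel)"
    by (rule integral_partial_deriv_test_function[OF test_function_mult[OF \<phi> s(2)] b, symmetric])
  also have "\<dots> = (\<integral>x. \<phi> x * partial_deriv b \<psi> x \<partial>lborel) + (\<integral>x. partial_deriv b \<phi> x * \<psi> x \<partial>lborel)"
    unfolding pd by (rule Bochner_Integration.integral_add[OF i])
  finally show ?thesis by simp
qed

text \<open>The Poincare inequality in \<open>L\<^sup>1\<close> for test functions: a step longer than the diameter of the
  domain leaves it.\<close>

lemma L1_Poincare_test_function: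
  fixes \<Omega> :: "'a::euclidean_space set"
  assumes \<Omega>: "bounded \<Omega>" and b: "b \<in> Basis"
  obtains T where "0 < T"
    "\<And>\<phi>. \<phi> \<in> test_functions \<Omega> \<Longrightarrow>
      (\<integral>\<^sup>+x. ennreal \<bar>\<phi> x\<bar> \<partial>lborel) \<le> ennreal T * (\<integral>\<^sup>+x. ennreal \<bar>partial_deriv b \<phi> x\<bar> \<partial>lborel)"
proof -
  obtain B where B: "B > 0" "\<And>x. x \<in> \<Omega> \<Longrightarrow> norm x \<le> B" using \<Omega> unfolding bounded_pos by blast
  \<comment> \<open>any number above the diameter, which is at most \<open>2 * B\<close>\<close>
  define T where "T = 3 * B"
  have T: "T > 0" using B by (simp add: T_def)
  show ?thesis
  proof (rule that[OF T])
    fix \<phi> assume \<phi>: "\<phi> \<in> test_functions \<Omega>"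
    let ?f = "partial_deriv b \<phi>"
    have f: "integrable lborel ?f" by (rule test_function_integrable[OF partial_deriv_test_function[OF \<phi> b]])
    have [measurable]: "?f \<in> borel_measurable borel" using f by auto
    have "ennreal \<bar>\<phi> x\<bar> \<le> (\<integral>\<^sup>+t. ennreal \<bar>?f (x + t *\<^sub>R b)\<bar> * indicator {0..T} t \<partial>lborel)" for x
    proof (cases "x \<in> \<Omega>")
      case True
      have "x + T *\<^sub>R b \<notin> \<Omega>"
      proof
        assume "x + T *\<^sub>R b \<in> \<Omega>"
        then have "norm (T *\<^sub>R b) \<le> B + B"
          using B(2)[OF True] B(2) norm_triangle_ineq4[of "x + T *\<^sub>R b" x] by fastforce
        then show False using b T B by (simp add: T_def)
      qed
      then have "\<phi> x = - (\<integral>t. ?f (x + t *\<^sub>R b) * indicator {0..T} t \<partial>lborel)"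
        using integral_partial_deriv_line[OF test_function_smooth[OF \<phi>] b, of T x] T
          test_function_zero_outside[OF \<phi>, of "x + T *\<^sub>R b"] by simp
      then have "ennreal \<bar>\<phi> x\<bar> = ennreal (norm (\<integral>t. ?f (x + t *\<^sub>R b) * indicator {0..T} t \<partial>lborel))" by simp
      also have "\<dots> \<le> (\<integral>\<^sup>+t. ennreal (norm (?f (x + t *\<^sub>R b) * indicator {0..T} t)) \<partial>lborel)"
      proof (rule integral_norm_bound_ennreal)
        have "continuous_on {0..T} (\<lambda>t. ?f (x + t *\<^sub>R b))"
          by (intro continuous_on_compose2[OF smooth_continuous_on[OF smooth_partial_deriv[OF test_function_smooth[OF \<phi>] b], of UNIV]] continuous_intros) auto
        then show "integrable lborel (\<lambda>t. ?f (x + t *\<^sub>R b) * indicator {0..T} t)"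
          using borel_integrable_compact[of "{0..T}" "\<lambda>t. ?f (x + t *\<^sub>R b)"] by (simp add: mult.commute)
      qed
      also have "\<dots> = (\<integral>\<^sup>+t. ennreal \<bar>?f (x + t *\<^sub>R b)\<bar> * indicator {0..T} t \<partial>lborel)"
        by (intro nn_integral_cong) (auto simp: indicator_def)
      finally show ?thesis .
    qed (use test_function_zero_outside[OF \<phi>] in simp)
    then have "(\<integral>\<^sup>+x. ennreal \<bar>\<phi> x\<bar> \<partial>lborel) \<le> (\<integral>\<^sup>+x. \<integral>\<^sup>+t. ennreal \<bar>?f (x + t *\<^sub>R b)\<bar> * indicator {0..T} t \<partial>lborel \<partial>lborel)"
      by (intro nn_integral_mono) auto
    also have "\<dots> = emeasure lborel {0..T} * (\<integral>\<^sup>+x. ennreal \<bar>?f x\<bar> \<partial>lborel)"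
      by (rule line_integrable(2)[OF f])
    finally show "(\<integral>\<^sup>+x. ennreal \<bar>\<phi> x\<bar> \<partial>lborel) \<le> ennreal T * (\<integral>\<^sup>+x. ennreal \<bar>?f x\<bar> \<partial>lborel)"
      using T by simp
  qed
qed

lemma locally_integrable_of_integrable:
  assumes "integrable lborel f" shows "locally_integrable \<Omega> f"
  unfolding locally_integrable_def
proof (intro allI impI)
  fix K assume K: "compact K \<and> K \<subseteq> \<Omega>"
  then have "K \<in> sets lebesgue" by (simp add: borel_compact)
  moreover have "integrable lebesgue f" using assms by (subst integrable_completion) auto
  ultimately show "integrable (lebesgue_on K) f"
    by (subst integrable_restrict_space) (auto intro: integrable_mult_indicator)
qed

lemma locally_integrable_linear:
  assumes "locally_integrable \<Omega> f" "locally_integrable \<Omega> g"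
  shows "locally_integrable \<Omega> (\<lambda>x. f x - g x)" "locally_integrable \<Omega> (\<lambda>x. c *\<^sub>R f x)"
    "locally_integrable \<Omega> (\<lambda>x. f x \<bullet> b)"
  using assms by (auto simp: locally_integrable_def)

lemma locally_integrable_times_test_function:
  fixes f :: "'a::euclidean_space \<Rightarrow> real"
  assumes \<Omega>: "open \<Omega>" and f: "locally_integrable \<Omega> f" and \<phi>: "\<phi> \<in> test_functions \<Omega>"
  shows "integrable (lebesgue_on \<Omega>) (\<lambda>x. f x * \<phi> x)"
proof -
  let ?K = "closure {x. \<phi> x \<noteq> 0}"
  have K: "compact ?K" "?K \<subseteq> \<Omega>" using \<phi> by (auto simp: test_functions_def)
  then have Kl: "?K \<in> sets lebesgue" by simp
  obtain C where C: "\<And>x. \<bar>\<phi> x\<bar> \<le> C" using test_function_bounded[OF \<phi>] by blast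
  have [measurable]: "\<phi> \<in> borel_measurable lebesgue"
    using smooth_borel_measurable[OF test_function_smooth[OF \<phi>]] by (intro measurable_completion) simp
  have "integrable (lebesgue_on ?K) f" using f K by (simp add: locally_integrable_def)
  then have "integrable lebesgue (\<lambda>x. indicator ?K x *\<^sub>R f x)"
    using Kl by (subst (asm) integrable_restrict_space) auto
  then have "integrable lebesgue (\<lambda>x. (indicator ?K x *\<^sub>R f x) * \<phi> x)"
    by (rule integrable_mult_bounded_fun) (use C in auto)
  moreover have "(\<lambda>x. (indicator ?K x *\<^sub>R f x) * \<phi> x) = (\<lambda>x. indicator \<Omega> x *\<^sub>R (f x * \<phi> x))"
  proof
    fix x
    have "\<phi> x = 0" if "x \<notin> ?K" using that closure_subset[of "{x. \<phi> x \<noteq> 0}"] by blast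
    then show "(indicator ?K x *\<^sub>R f x) * \<phi> x = indicator \<Omega> x *\<^sub>R (f x * \<phi> x)"
      using K(2) by (cases "x \<in> ?K") (auto simp: indicator_def)
  qed
  ultimately show ?thesis using \<Omega> by (subst integrable_restrict_space) auto
qed

lemma has_weak_gradient_diff:
  assumes \<Omega>: "open \<Omega>" and u: "has_weak_gradient \<Omega> u g" and v: "has_weak_gradient \<Omega> v h"
  shows "has_weak_gradient \<Omega> (\<lambda>x. u x - v x) (\<lambda>x. g x - h x)"
  unfolding has_weak_gradient_def
proof (intro conjI ballI)
  have li: "locally_integrable \<Omega> u" "locally_integrable \<Omega> v" "locally_integrable \<Omega> g" "locally_integrable \<Omega> h"
    using u v by (auto simp: has_weak_gradient_def)
  then show "locally_integrable \<Omega> (\<lambda>x. u x - v x)" "locally_integrable \<Omega> (\<lambda>x. g x - h x)"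
    by (auto intro: locally_integrable_linear)
  fix \<phi> and b :: 'a assume \<phi>: "\<phi> \<in> test_functions \<Omega>" and b: "b \<in> Basis"
  note T = locally_integrable_times_test_function[OF \<Omega>]
  have i: "integrable (lebesgue_on \<Omega>) (\<lambda>x. w x * partial_deriv b \<phi> x)" if "locally_integrable \<Omega> w" for w
    by (rule T[OF that partial_deriv_test_function[OF \<phi> b]])
  have j: "integrable (lebesgue_on \<Omega>) (\<lambda>x. (w x \<bullet> b) * \<phi> x)" if "locally_integrable \<Omega> w" for w
    by (rule T[OF locally_integrable_linear(3)[OF that that] \<phi>])
  show "(\<integral>x. (u x - v x) * partial_deriv b \<phi> x \<partial>lebesgue_on \<Omega>) = - (\<integral>x. ((g x - h x) \<bullet> b) * \<phi> x \<partial>lebesgue_on \<Omega>)"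
    using u v \<phi> b i[OF li(1)] i[OF li(2)] j[OF li(3)] j[OF li(4)]
    by (simp add: has_weak_gradient_def left_diff_distrib inner_diff_left)
qed

lemma has_weak_gradient_scale:
  assumes u: "has_weak_gradient \<Omega> u g"
  shows "has_weak_gradient \<Omega> (\<lambda>x. c * u x) (\<lambda>x. c *\<^sub>R g x)"
  using u locally_integrable_linear(2)[of \<Omega> u u c] locally_integrable_linear(2)[of \<Omega> g g c]
  by (simp add: has_weak_gradient_def mult.assoc)

lemma gradient_measurable:
  assumes "smooth \<phi>" shows "gradient \<phi> \<in> borel_measurable borel"
proof -
  have "partial_deriv b \<phi> \<in> borel_measurable borel" if "b \<in> Basis" for b
    using assms that by (intro smooth_borel_measurable smooth_partial_deriv)
  then show ?thesis unfolding gradient_def by measurable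
qed

lemma test_function_has_weak_gradient:
  fixes \<phi> :: "'a::euclidean_space \<Rightarrow> real"
  assumes \<Omega>: "open \<Omega>" and \<phi>: "\<phi> \<in> test_functions \<Omega>"
  shows "has_weak_gradient \<Omega> \<phi> (gradient \<phi>)"
  unfolding has_weak_gradient_def
proof (intro conjI ballI)
  show "locally_integrable \<Omega> \<phi>"
    by (intro locally_integrable_of_integrable test_function_integrable[OF \<phi>])
  have "integrable lborel (gradient \<phi>)"
    unfolding gradient_def
    by (intro Bochner_Integration.integrable_sum integrable_scaleR_left test_function_integrable[OF partial_deriv_test_function[OF \<phi>]]) auto
  then show "locally_integrable \<Omega> (gradient \<phi>)" by (rule locally_integrable_of_integrable)
  fix \<psi> and b :: 'a assume \<psi>: "\<psi> \<in> test_functions \<Omega>" and b: "b \<in> Basis"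
  have \<Omega>': "\<Omega> \<in> sets borel" using \<Omega> by simp
  have [measurable]: "f \<in> borel_measurable borel" if "f \<in> test_functions \<Omega>" for f
    using that by (intro smooth_borel_measurable test_function_smooth)
  note pd = partial_deriv_test_function[OF \<phi> b] partial_deriv_test_function[OF \<psi> b]
  have eq: "(\<integral>x. f x * g x \<partial>lebesgue_on \<Omega>) = (\<integral>x. f x * g x \<partial>lborel)"
    if "f \<in> test_functions \<Omega>" "g \<in> test_functions \<Omega>" for f g
    using that test_function_zero_outside[OF that(1)]
    by (intro integral_lebesgue_on_eq_lborel[OF \<Omega>'] borel_measurable_lebesgue_on borel_measurable_times) auto
  show "(\<integral>x. \<phi> x * partial_deriv b \<psi> x \<partial>lebesgue_on \<Omega>) = - (\<integral>x. (gradient \<phi> x \<bullet> b) * \<psi> x \<partial>lebesgue_on \<Omega>)"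
    using integration_by_parts_test_function[OF \<phi> \<psi> b] eq[OF \<phi> pd(2)] eq[OF pd(1) \<psi>]
    by (simp add: gradient_inner[OF b])
qed

text \<open>The fundamental lemma of the calculus of variations: the averages of \<open>f\<close> at small scales vanish
  near every point of \<open>\<Omega>\<close>, and they converge to \<open>f\<close> in \<open>L\<^sup>1\<close>.\<close>

lemma fundamental_lemma_variations:
  fixes f :: "'a::euclidean_space \<Rightarrow> real"
  assumes \<Omega>: "open \<Omega>" and f: "locally_integrable \<Omega> f"
    and zero: "\<And>\<phi>. \<phi> \<in> test_functions \<Omega> \<Longrightarrow> (\<integral>x. f x * \<phi> x \<partial>lebesgue_on \<Omega>) = 0"
  shows "AE x in lebesgue_on \<Omega>. f x = 0"
proof -
  have \<Omega>': "\<Omega> \<in> sets borel" using \<Omega> by simp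
  have fm: "f \<in> borel_measurable (lebesgue_on \<Omega>)" by (rule locally_integrable_measurable[OF \<Omega> f])
  obtain F where F[measurable]: "F \<in> borel_measurable borel" and Foff: "\<And>x. x \<notin> \<Omega> \<Longrightarrow> F x = 0"
    and fF: "AE x in lebesgue_on \<Omega>. f x = F x"
    by (rule borel_representative[OF \<Omega>' fm]) (rule that)
  obtain e :: 'a where e: "e \<in> Basis" using nonempty_Basis by blast
  have local: "\<exists>r>0. ball x0 r \<subseteq> \<Omega> \<and> (AE x in lborel. x \<in> ball x0 r \<longrightarrow> F x = 0)" if x0: "x0 \<in> \<Omega>" for x0
  proof -
    obtain R where R: "0 < R" "cball x0 R \<subseteq> \<Omega>" using \<Omega> x0 unfolding open_contains_cball by blast
    define r where "r = R / 4"
    have r: "0 < r" using R by (simp add: r_def)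
    define F1 where "F1 x = F x * indicator (cball x0 R) x" for x
    have [measurable]: "cball x0 R \<in> sets borel" "ball x0 r \<in> sets borel" by simp_all
    have [measurable]: "F1 \<in> borel_measurable borel" unfolding F1_def by measurable
    have "integrable (lebesgue_on (cball x0 R)) f" using f R by (simp add: locally_integrable_def)
    moreover have "AE x in lebesgue_on (cball x0 R). f x = F x"
      using fF R(2) unfolding AE_lebesgue_on_iff[OF \<Omega>']
      by (subst AE_lebesgue_on_iff) (auto elim!: eventually_mono)
    ultimately have "integrable (lebesgue_on (cball x0 R)) F"
      by (subst integrable_cong_AE[of F _ f]) (auto intro: borel_measurable_lebesgue_on elim: eventually_mono)
    then have "integrable lebesgue (\<lambda>x. indicator (cball x0 R) x *\<^sub>R F x)"
      by (subst (asm) integrable_restrict_space) auto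
    then have F1i: "integrable lborel F1"
      unfolding F1_def by (subst (asm) integrable_completion) (auto simp: mult.commute)
    have avg0: "avg e 1 s F1 x = 0" if x: "x \<in> ball x0 r" and s: "0 < s" "s \<le> r" for x s
    proof -
      define \<phi> where "\<phi> y = mollifier e 1 ((1 / s) *\<^sub>R (y - x))" for y
      let ?S = "(\<lambda>z. x + s *\<^sub>R z) ` cball e 1"
      have S: "?S \<subseteq> cball x0 R"
      proof
        fix y assume "y \<in> ?S"
        then obtain z where z: "z \<in> cball e 1" "y = x + s *\<^sub>R z" by auto
        have "y \<in> ball x0 (3 * r)"
          unfolding z(2) using e z(1) x s by (intro cone_step_in_ball[of e 1]) auto
        then show "y \<in> cball x0 R" using R(1) by (simp add: r_def)
      qed
      have supp: "\<phi> y = 0" if "y \<notin> ?S" for y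
        unfolding \<phi>_def by (rule mollifier_affine_eq_0[OF _ s(1) that]) simp
      have test: "\<phi> \<in> test_functions \<Omega>"
        by (rule test_functionI[of _ ?S])
          (use supp S R mollifier_smooth in \<open>auto simp: \<phi>_def[abs_def] intro!: compact_continuous_image continuous_intros\<close>)
      have [measurable]: "\<phi> \<in> borel_measurable borel" unfolding \<phi>_def by measurable
      have "(\<integral>y. F1 y * \<phi> y \<partial>lborel) = (\<integral>y. f y * \<phi> y \<partial>lebesgue_on \<Omega>)"
      proof (rule integral_lebesgue_on_eq_lborel[OF \<Omega>', symmetric])
        show "(\<lambda>y. f y * \<phi> y) \<in> borel_measurable (lebesgue_on \<Omega>)"
          by (intro borel_measurable_times fm borel_measurable_lebesgue_on) measurable
        show "AE y in lebesgue_on \<Omega>. f y * \<phi> y = F1 y * \<phi> y"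
          using fF
        proof eventually_elim
          case (elim y)
          show ?case
          proof (cases "y \<in> cball x0 R")
            case False
            then have "y \<notin> ?S" using S by blast
            then show ?thesis by (simp add: supp)
          qed (simp add: elim F1_def)
        qed
      qed (use Foff in \<open>auto simp: F1_def\<close>)
      then show ?thesis
        using zero[OF test] avg_eq_convolution[of F1 s e 1 x] s by (simp add: \<phi>_def)
    qed
    define \<delta> where "\<delta> n = r / real (Suc n)" for n
    have \<delta>: "0 < \<delta> n" "\<delta> n \<le> r" for n using r by (auto simp: \<delta>_def field_simps)
    have "\<delta> \<longlonglongrightarrow> 0" unfolding \<delta>_def by (rule LIMSEQ_Suc[OF lim_const_over_n])
    then have lim: "(\<lambda>n. \<integral>\<^sup>+x. ennreal \<bar>avg e 1 (\<delta> n) F1 x - F1 x\<bar> \<partial>lborel) \<longlonglongrightarrow> 0"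
      by (intro avg_tendsto_L1 F1i \<delta>) auto
    have "(\<integral>\<^sup>+x. ennreal \<bar>F1 x\<bar> * indicator (ball x0 r) x \<partial>lborel) \<le> 0"
    proof (rule LIMSEQ_le_const[OF lim], intro exI[of _ 0] allI impI nn_integral_mono)
      fix n x
      show "ennreal \<bar>F1 x\<bar> * indicator (ball x0 r) x \<le> ennreal \<bar>avg e 1 (\<delta> n) F1 x - F1 x\<bar>"
        using avg0[of x "\<delta> n"] \<delta>[of n] by (cases "x \<in> ball x0 r") auto
    qed
    then have "AE x in lborel. ennreal \<bar>F1 x\<bar> * indicator (ball x0 r) x = 0"
      by (subst (asm) le_zero_eq, subst (asm) nn_integral_0_iff_AE) auto
    then have "AE x in lborel. x \<in> ball x0 r \<longrightarrow> F x = 0"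
    proof (rule eventually_mono, intro impI)
      fix x assume "ennreal \<bar>F1 x\<bar> * indicator (ball x0 r) x = 0" "x \<in> ball x0 r"
      moreover from this have "x \<in> cball x0 R" using R by (simp add: r_def)
      ultimately show "F x = 0" by (simp add: F1_def)
    qed
    moreover have "ball x0 r \<subseteq> \<Omega>" using R by (auto simp: r_def subset_iff)
    ultimately show ?thesis using r by blast
  qed
  define \<F> where "\<F> = {S. open S \<and> S \<subseteq> \<Omega> \<and> (AE x in lborel. x \<in> S \<longrightarrow> F x = 0)}"
  have "\<Omega> \<subseteq> \<Union>\<F>"
  proof
    fix x assume x: "x \<in> \<Omega>"
    obtain r where "r > 0" "ball x r \<subseteq> \<Omega>" "AE y in lborel. y \<in> ball x r \<longrightarrow> F y = 0"
      using local[OF x] by blast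
    then have "ball x r \<in> \<F>" "x \<in> ball x r" by (auto simp: \<F>_def)
    then show "x \<in> \<Union>\<F>" by blast
  qed
  moreover obtain \<F>' where \<F>': "\<F>' \<subseteq> \<F>" "countable \<F>'" "\<Union>\<F>' = \<Union>\<F>"
    using Lindelof[of \<F>] by (auto simp: \<F>_def)
  ultimately have cover: "\<Omega> \<subseteq> \<Union>\<F>'" by simp
  have "AE x in lborel. \<forall>S\<in>\<F>'. x \<in> S \<longrightarrow> F x = 0"
    using \<F>' by (subst AE_ball_countable) (auto simp: \<F>_def)
  then have "AE x in lborel. x \<in> \<Omega> \<longrightarrow> F x = 0"
    by (rule eventually_mono) (use cover in blast)
  then have "AE x in lebesgue_on \<Omega>. F x = 0" unfolding AE_lebesgue_on_iff[OF \<Omega>'] .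
  with fF show ?thesis by eventually_elim simp
qed

lemma weak_gradient_AE_unique:
  fixes \<Omega> :: "'a::euclidean_space set"
  assumes \<Omega>: "open \<Omega>" and g: "has_weak_gradient \<Omega> u g" and h: "has_weak_gradient \<Omega> u h"
  shows "AE x in lebesgue_on \<Omega>. g x = h x"
proof -
  have d: "has_weak_gradient \<Omega> (\<lambda>x. u x - u x) (\<lambda>x. g x - h x)"
    by (rule has_weak_gradient_diff[OF \<Omega> g h])
  have "AE x in lebesgue_on \<Omega>. (g x - h x) \<bullet> b = 0" if b: "b \<in> Basis" for b
  proof (rule fundamental_lemma_variations[OF \<Omega>])
    have li: "locally_integrable \<Omega> (\<lambda>x. g x - h x)" using d by (simp add: has_weak_gradient_def)
    show "locally_integrable \<Omega> (\<lambda>x. (g x - h x) \<bullet> b)" by (rule locally_integrable_linear(3)[OF li li])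
    show "(\<integral>x. ((g x - h x) \<bullet> b) * \<phi> x \<partial>lebesgue_on \<Omega>) = 0" if "\<phi> \<in> test_functions \<Omega>" for \<phi>
      using d that b by (auto simp: has_weak_gradient_def)
  qed
  then have "AE x in lebesgue_on \<Omega>. \<forall>b\<in>Basis. (g x - h x) \<bullet> b = 0"
    by (intro AE_finite_allI) auto
  then show ?thesis
  proof (rule eventually_mono)
    fix x assume *: "\<forall>b\<in>Basis. (g x - h x) \<bullet> b = 0"
    show "g x = h x"
    proof (rule euclidean_eqI)
      fix b :: 'a assume "b \<in> Basis"
      with * have "(g x - h x) \<bullet> b = 0" by blast
      then show "g x \<bullet> b = h x \<bullet> b" by (simp add: inner_diff_left)
    qed
  qed
qed

section \<open>The compact embedding\<close>

context log_double_phase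
begin

text \<open>On each of finitely many pieces a subsequence is Cauchy in the local exponent; the bounds are inherited by subsequences, so the
  pieces can be treated one after the other.\<close>

proposition bounded_sequence_has_convergent_subsequence:
  fixes u :: "nat \<Rightarrow> 'a \<Rightarrow> real"
  assumes uW: "\<And>n. u n \<in> W1_H \<Omega> p q \<mu>" and uB: "\<And>n. norm_W1_H \<Omega> p q \<mu> (u n) \<le> B"
  shows "\<exists>v\<in>L_H \<Omega> p q \<mu>. \<exists>k. strict_mono k \<and> (\<lambda>n. norm_H \<Omega> p q \<mu> (\<lambda>x. u (k n) x - v x)) \<longlonglongrightarrow> 0"
proof -
  define b where "b = \<bar>B\<bar> + 1"
  have b: "0 < b" by (simp add: b_def)
  have JW: "JW (u n) b \<le> 1" for n
    using JW_le_1_of_norm_less(2)[OF uW, of n b] uB[of n] by (simp add: b_def)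
  define R where "R n V W \<longleftrightarrow> V \<in> borel_measurable borel \<and> (\<forall>x. x \<notin> \<Omega> \<longrightarrow> V x = 0) \<and>
     (AE x in lebesgue_on \<Omega>. u n x = V x) \<and> integrable lborel V \<and> (\<integral>x. \<bar>V x\<bar> \<partial>lborel) \<le> b * (vol + 1) \<and>
     W \<in> borel_measurable borel \<and> integrable lborel W \<and> J (\<lambda>x. norm (W x) / b) \<le> 1 \<and> weak_grad_lborel \<Omega> V W"
    for n V and W :: "'a \<Rightarrow> 'a"
  have "\<exists>V W. R n V W" for n
    by (rule W1_H_representative[OF uW b JW, of n]) (unfold R_def, blast)
  then obtain U G where UG: "\<And>n. R n (U n) (G n)" by metis
  have U: "\<And>n. U n \<in> borel_measurable borel" "\<And>n x. x \<notin> \<Omega> \<Longrightarrow> U n x = 0"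
      "\<And>n. AE x in lebesgue_on \<Omega>. u n x = U n x" "\<And>n. integrable lborel (U n)"
      "\<And>n. (\<integral>x. \<bar>U n x\<bar> \<partial>lborel) \<le> b * (vol + 1)"
    and G: "\<And>n. G n \<in> borel_measurable borel" "\<And>n. integrable lborel (G n)"
      "\<And>n. J (\<lambda>x. norm (G n x) / b) \<le> 1" "\<And>n. weak_grad_lborel \<Omega> (U n) (G n)"
    using UG unfolding R_def by blast+
  have "\<forall>x0\<in>closure \<Omega>. \<exists>d. good_piece \<Omega> p q x0 d"
    using good_piece_exists[OF domain p_C_plus q_C_plus subcritical] by blast
  then obtain d where d: "\<And>x0. x0 \<in> closure \<Omega> \<Longrightarrow> good_piece \<Omega> p q x0 (d x0)" by metis
  define h where "h x0 = fst (d x0)" for x0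
  define rr where "rr x0 = fst (snd (snd (snd (snd (d x0)))))" for x0
  define kk where "kk x0 = snd (snd (snd (snd (snd (d x0)))))" for x0
  define A where "A x0 = \<Omega> \<inter> ball x0 (h x0)" for x0
  have hpos: "0 < h x0" if "x0 \<in> closure \<Omega>" for x0
    using d[OF that] by (cases "d x0" rule: prod_cases6) (simp add: good_piece_def h_def)
  obtain F where F: "F \<subseteq> closure \<Omega>" "finite F" "closure \<Omega> \<subseteq> (\<Union>x0\<in>F. ball x0 (h x0))"
  proof (rule compactE_image[OF compact_closure_\<Omega>, of "closure \<Omega>" "\<lambda>x0. ball x0 (h x0)"])
    show "closure \<Omega> \<subseteq> (\<Union>x0\<in>closure \<Omega>. ball x0 (h x0))" using hpos by force
  qed (auto intro: that)
  have cover: "\<Omega> \<subseteq> (\<Union>i\<in>F. A i)" using F(3) closure_subset[of \<Omega>] by (auto simp: A_def)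
  have A: "A i \<in> sets borel" "A i \<subseteq> \<Omega>" for i using open_\<Omega> by (auto simp: A_def)
  have "\<exists>k. strict_mono k \<and> (\<forall>i\<in>F. Lr_cauchy (A i) (rr i) (U \<circ> k))"
  proof (rule finite_common_subseq[OF F(2), where P="\<lambda>i \<sigma>. Lr_cauchy (A i) (rr i) (U \<circ> \<sigma>)"])
    fix i and \<sigma> :: "nat \<Rightarrow> nat" assume i: "i \<in> F"
    obtain hi e \<rho> p1 r \<kappa> where di: "d i = (hi, e, \<rho>, p1, r, \<kappa>)" by (cases "d i" rule: prod_cases6)
    have g: "0 < hi" "hi \<le> 1" "norm e = 1" "0 < \<rho>" "\<rho> \<le> 1" "1 \<le> p1" "p1 \<le> r"
        "r * (real DIM('a) - p1) < real DIM('a) * p1"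
      and cone: "\<And>x s z. x \<in> \<Omega> \<inter> ball i hi \<Longrightarrow> 0 < s \<Longrightarrow> s \<le> hi \<Longrightarrow> z \<in> cball e \<rho> \<Longrightarrow>
         x + s *\<^sub>R z \<in> \<Omega> \<inter> ball i (3 * hi)"
      and p1: "\<And>x. x \<in> \<Omega> \<inter> ball i (3 * hi) \<Longrightarrow> p1 \<le> p x"
      using d[of i] i F(1) unfolding di good_piece_def prod.case by blast+
    have hr: "h i = hi" "rr i = r" by (simp_all add: h_def rr_def di)
    have K: "(\<integral>\<^sup>+y. ennreal (norm (G n y) powr p1) * indicator (\<Omega> \<inter> ball i (3 * hi)) y \<partial>lborel)
       \<le> ennreal (b powr p1 * (vol + 1))" for n
    proof (rule nn_integral_powr_le[OF _ _ b G(3)])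
      show "(\<lambda>x. norm (G n x)) \<in> borel_measurable borel" using G(1)[of n] by measurable
    qed (use g p1 in auto)
    obtain k where k: "strict_mono (k :: nat \<Rightarrow> nat)" "Lr_cauchy (A i) r ((U \<circ> \<sigma>) \<circ> k)"
    proof (rule Lr_cauchy_subseq[of \<rho> e p1 r "U \<circ> \<sigma>" "G \<circ> \<sigma>" \<Omega> "b * (vol + 1)" "closure \<Omega>" "A i"
          "\<Omega> \<inter> ball i (3 * hi)" hi "b powr p1 * (vol + 1)"])
      show "\<And>n x. x \<notin> closure \<Omega> \<Longrightarrow> (U \<circ> \<sigma>) n x = 0"
        using U(2) closure_subset[of \<Omega>] by (metis comp_apply subsetD)
      show "A i \<subseteq> closure \<Omega>" using closure_subset[of \<Omega>] by (auto simp: A_def)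
      show "\<And>x s z. x \<in> A i \<Longrightarrow> 0 < s \<Longrightarrow> s \<le> hi \<Longrightarrow> z \<in> cball e \<rho> \<Longrightarrow> x + s *\<^sub>R z \<in> \<Omega> \<inter> ball i (3 * hi)"
        unfolding A_def hr by (rule cone)
      show "\<Omega> \<inter> ball i (3 * hi) \<in> sets borel" using open_\<Omega> by simp
    qed (use g U G K A compact_closure_\<Omega> in \<open>simp_all add: that\<close>)
    then show "\<exists>k. strict_mono k \<and> Lr_cauchy (A i) (rr i) (U \<circ> (\<sigma> \<circ> k))"
      unfolding hr by (auto simp: o_assoc)
  next
    fix i and \<sigma> k :: "nat \<Rightarrow> nat"
    assume "Lr_cauchy (A i) (rr i) (U \<circ> \<sigma>)" "strict_mono k"
    then show "Lr_cauchy (A i) (rr i) (U \<circ> (\<sigma> \<circ> k))"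
      using Lr_cauchy_subseq_mono by (metis o_assoc)
  qed
  then obtain k where k: "strict_mono k" and kC: "\<And>i. i \<in> F \<Longrightarrow> Lr_cauchy (A i) (rr i) (U \<circ> k)" by blast
  have W: "\<And>n. (U \<circ> k) n \<in> borel_measurable borel" using U(1) by simp
  have "modular_cauchy (U \<circ> k)"
  proof (rule modular_cauchy_of_pieces[OF F(2) cover A _ _ _ W kC, where \<kappa>=kk])
    fix i assume i: "i \<in> F"
    obtain hi e \<rho> p1 r \<kappa> where di: "d i = (hi, e, \<rho>, p1, r, \<kappa>)" by (cases "d i" rule: prod_cases6)
    have g: "1 \<le> p1" "p1 \<le> r" "0 < \<kappa>" and qr: "\<And>x. x \<in> \<Omega> \<inter> ball i hi \<Longrightarrow> q x + \<kappa> \<le> r"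
      using d[of i] i F(1) unfolding di good_piece_def prod.case by blast+
    have hr: "h i = hi" "rr i = r" "kk i = \<kappa>" by (simp_all add: h_def rr_def kk_def di)
    show "1 \<le> rr i" "0 < kk i" using g by (simp_all add: hr)
    show "q x + kk i \<le> rr i" if "x \<in> A i" for x using that qr unfolding A_def hr by blast
  qed
  then obtain v where v: "v \<in> borel_measurable borel"
    and lim: "\<And>l c. 0 < l \<Longrightarrow> 0 < c \<Longrightarrow> \<exists>N. \<forall>n\<ge>N. J (\<lambda>x. ((U \<circ> k) n x - v x) / l) \<le> ennreal c"
    by (rule modular_complete[OF W, rotated 2]) (use U in \<open>simp_all\<close>)
  have vm[measurable]: "v \<in> borel_measurable (lebesgue_on \<Omega>)" by (rule borel_measurable_lebesgue_on[OF v])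
  have Jeq: "J (\<lambda>x. (u (k n) x - v x) / l) = J (\<lambda>x. ((U \<circ> k) n x - v x) / l)" for n l
    by (rule modular_cong_AE, rule eventually_mono[OF U(3)[of "k n"]]) simp
  have "v \<in> L_H \<Omega> p q \<mu>"
  proof -
    obtain N where N: "J (\<lambda>x. u (k N) x - v x) \<le> ennreal 1"
      using lim[of 1 1] unfolding Jeq[symmetric] by auto
    have uN: "u (k N) \<in> L_H \<Omega> p q \<mu>" using uW by (simp add: W1_H_def)
    then have [measurable]: "u (k N) \<in> borel_measurable (lebesgue_on \<Omega>)" by (simp add: L_H_def)
    have "(\<lambda>x. u (k N) x - v x) \<in> borel_measurable (lebesgue_on \<Omega>)" by measurable
    then have "(\<lambda>x. u (k N) x - v x) \<in> L_H \<Omega> p q \<mu>"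
      using le_less_trans[OF N ennreal_less_top] by (simp add: L_H_def)
    from L_H_dominated[OF uN this vm] show ?thesis by (simp add: always_eventually)
  qed
  moreover have "(\<lambda>n. norm_H \<Omega> p q \<mu> (\<lambda>x. u (k n) x - v x)) \<longlonglongrightarrow> 0"
  proof (rule norm_H_tendsto_0)
    fix l :: real assume "0 < l"
    then show "\<forall>\<^sub>F n in sequentially. J (\<lambda>x. (u (k n) x - v x) / l) \<le> 1"
      using lim[of l 1] unfolding Jeq eventually_sequentially by simp
  qed
  ultimately show ?thesis using k by blast
qed

theorem compact_embedding_W1_H:
  "compact_embedding (W1_H \<Omega> p q \<mu>) (norm_W1_H \<Omega> p q \<mu>) (L_H \<Omega> p q \<mu>) (norm_H \<Omega> p q \<mu>)"
  unfolding compact_embedding_def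
proof (intro conjI allI impI)
  show "W1_H \<Omega> p q \<mu> \<subseteq> L_H \<Omega> p q \<mu>" by (auto simp: W1_H_def)
  show "\<exists>C>0. \<forall>u\<in>W1_H \<Omega> p q \<mu>. norm_H \<Omega> p q \<mu> u \<le> C * norm_W1_H \<Omega> p q \<mu> u"
    using norm_H_le_norm_W1_H by (intro exI[of _ 1]) simp
  fix u :: "nat \<Rightarrow> 'a \<Rightarrow> real"
  assume "(\<forall>n. u n \<in> W1_H \<Omega> p q \<mu>) \<and> (\<exists>B. \<forall>n. norm_W1_H \<Omega> p q \<mu> (u n) \<le> B)"
  then obtain B where "\<And>n. u n \<in> W1_H \<Omega> p q \<mu>" "\<And>n. norm_W1_H \<Omega> p q \<mu> (u n) \<le> B" by blast
  then show "\<exists>v\<in>L_H \<Omega> p q \<mu>. \<exists>r. strict_mono r \<and> (\<lambda>n. norm_H \<Omega> p q \<mu> (\<lambda>x. u (r n) x - v x)) \<longlonglongrightarrow> 0"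
    by (rule bounded_sequence_has_convergent_subsequence)
qed

section \<open>The Poincare inequality\<close>

lemma L_H_bounded:
  assumes u: "u \<in> borel_measurable (lebesgue_on \<Omega>)" and C: "\<And>x. \<bar>u x\<bar> \<le> C"
  shows "u \<in> L_H \<Omega> p q \<mu>"
proof -
  obtain M where M: "AE x in lebesgue_on \<Omega>. 0 \<le> \<mu> x \<and> \<mu> x \<le> M" using \<mu>_bounded by blast
  have "J (\<lambda>x. 1) \<le> (\<integral>\<^sup>+x. ennreal (1 + M * ln (exp 1 + 1)) * 1 \<partial>lebesgue_on \<Omega>)"
    unfolding modular_H_def
  proof (rule nn_integral_mono_AE)
    show "AE x in lebesgue_on \<Omega>. ennreal (H x \<bar>1\<bar>) \<le> ennreal (1 + M * ln (exp 1 + 1)) * 1"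
      using M
    proof eventually_elim
      case (elim x)
      then show ?case using ln_e_add_ge_1[of 1] by (auto simp: H_log_def intro!: ennreal_leI mult_right_mono)
    qed
  qed
  also have "\<dots> = ennreal (1 + M * ln (exp 1 + 1)) * ennreal vol"
    by (subst nn_integral_cmult) (simp_all only: nn_integral_one_lebesgue_on, simp)
  also have "\<dots> < \<infinity>" by (simp add: ennreal_mult_less_top)
  finally have "J (\<lambda>x. 1) < \<infinity>" .
  then have fin: "J (\<lambda>x. C * 1) < \<infinity>" by (intro modular_expand_finite) auto
  have "J u \<le> J (\<lambda>x. C * 1)"
  proof (intro modular_mono_AE always_eventually allI)
    fix x show "\<bar>u x\<bar> \<le> \<bar>C * 1\<bar>" using C[of x] by linarith
  qed
  then show ?thesis using fin u by (simp add: L_H_def)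
qed

lemma test_function_L_H:
  assumes \<phi>: "\<phi> \<in> test_functions \<Omega>"
  shows "\<phi> \<in> L_H \<Omega> p q \<mu>" "(\<lambda>x. norm (gradient \<phi> x)) \<in> L_H \<Omega> p q \<mu>"
proof -
  obtain C where "\<And>x. \<bar>\<phi> x\<bar> \<le> C" using test_function_bounded[OF \<phi>] by blast
  then show "\<phi> \<in> L_H \<Omega> p q \<mu>"
    by (intro L_H_bounded borel_measurable_lebesgue_on smooth_borel_measurable test_function_smooth[OF \<phi>])
  have "\<exists>C. \<forall>x. \<bar>partial_deriv b \<phi> x\<bar> \<le> C" if "b \<in> Basis" for b
    using test_function_bounded[OF partial_deriv_test_function[OF \<phi> that]] by blast
  then obtain D where D: "\<And>b x. b \<in> Basis \<Longrightarrow> \<bar>partial_deriv b \<phi> x\<bar> \<le> D b" by metis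
  have "\<bar>norm (gradient \<phi> x)\<bar> \<le> (\<Sum>b\<in>Basis. D b)" for x
    unfolding gradient_def by (simp, rule order_trans[OF norm_sum]) (auto intro!: sum_mono D)
  moreover have "gradient \<phi> \<in> borel_measurable borel" by (rule gradient_measurable[OF test_function_smooth[OF \<phi>]])
  then have "(\<lambda>x. norm (gradient \<phi> x)) \<in> borel_measurable borel" by measurable
  ultimately show "(\<lambda>x. norm (gradient \<phi> x)) \<in> L_H \<Omega> p q \<mu>"
    by (intro L_H_bounded borel_measurable_lebesgue_on)
qed

text \<open>Membership in \<open>W\<^sup>1\<close> is defined through the chosen weak gradient; by uniqueness any weak gradient may be used to
  verify it.\<close>

lemma W1_H_intro:
  assumes u: "u \<in> L_H \<Omega> p q \<mu>" and g: "has_weak_gradient \<Omega> u g" "(\<lambda>x. norm (g x)) \<in> L_H \<Omega> p q \<mu>"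
  shows "u \<in> W1_H \<Omega> p q \<mu>" "AE x in lebesgue_on \<Omega>. weak_gradient \<Omega> u x = g x"
proof -
  have wg: "has_weak_gradient \<Omega> u (weak_gradient \<Omega> u)"
    unfolding weak_gradient_def by (rule someI[of "has_weak_gradient \<Omega> u", OF g(1)])
  show ae: "AE x in lebesgue_on \<Omega>. weak_gradient \<Omega> u x = g x"
    by (rule weak_gradient_AE_unique[OF open_\<Omega> wg g(1)])
  have [measurable]: "weak_gradient \<Omega> u \<in> borel_measurable (lebesgue_on \<Omega>)"
    using wg by (auto simp: has_weak_gradient_def intro: locally_integrable_measurable[OF open_\<Omega>])
  have "(\<lambda>x. norm (weak_gradient \<Omega> u x)) \<in> L_H \<Omega> p q \<mu>"
    by (rule L_H_dominated[OF g(2) g(2)], measurable, rule eventually_mono[OF ae]) simp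
  then show "u \<in> W1_H \<Omega> p q \<mu>" using u g(1) by (auto simp: W1_H_def)
qed

lemma W1_H_diff_test_function:
  assumes u: "u \<in> W1_H \<Omega> p q \<mu>" and \<phi>: "\<phi> \<in> test_functions \<Omega>"
  shows "(\<lambda>x. u x - \<phi> x) \<in> W1_H \<Omega> p q \<mu>"
    "AE x in lebesgue_on \<Omega>. weak_gradient \<Omega> (\<lambda>x. u x - \<phi> x) x = weak_gradient \<Omega> u x - gradient \<phi> x"
proof -
  have uL: "u \<in> L_H \<Omega> p q \<mu>" "(\<lambda>x. norm (weak_gradient \<Omega> u x)) \<in> L_H \<Omega> p q \<mu>"
    using u by (auto simp: W1_H_def)
  note wg = W1_H_has_weak_gradient[OF u]
  have d: "has_weak_gradient \<Omega> (\<lambda>x. u x - \<phi> x) (\<lambda>x. weak_gradient \<Omega> u x - gradient \<phi> x)"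
    by (rule has_weak_gradient_diff[OF open_\<Omega> wg test_function_has_weak_gradient[OF open_\<Omega> \<phi>]])
  have m[measurable]: "u \<in> borel_measurable (lebesgue_on \<Omega>)" "\<phi> \<in> borel_measurable (lebesgue_on \<Omega>)"
    using uL test_function_L_H[OF \<phi>] by (auto simp: L_H_def)
  have [measurable]: "(\<lambda>x. weak_gradient \<Omega> u x - gradient \<phi> x) \<in> borel_measurable (lebesgue_on \<Omega>)"
    using d by (auto simp: has_weak_gradient_def intro: locally_integrable_measurable[OF open_\<Omega>])
  have 1: "(\<lambda>x. u x - \<phi> x) \<in> L_H \<Omega> p q \<mu>"
  proof (rule L_H_dominated[OF uL(1) test_function_L_H(1)[OF \<phi>]])
    show "AE x in lebesgue_on \<Omega>. \<bar>u x - \<phi> x\<bar> \<le> \<bar>u x\<bar> + \<bar>\<phi> x\<bar>"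
      by (intro always_eventually allI abs_triangle_ineq4)
  qed measurable
  have 2: "(\<lambda>x. norm (weak_gradient \<Omega> u x - gradient \<phi> x)) \<in> L_H \<Omega> p q \<mu>"
    by (rule L_H_dominated[OF uL(2) test_function_L_H(2)[OF \<phi>]], measurable)
      (auto intro!: always_eventually norm_triangle_ineq4)
  show "(\<lambda>x. u x - \<phi> x) \<in> W1_H \<Omega> p q \<mu>"
    "AE x in lebesgue_on \<Omega>. weak_gradient \<Omega> (\<lambda>x. u x - \<phi> x) x = weak_gradient \<Omega> u x - gradient \<phi> x"
    by (rule W1_H_intro[OF 1 d 2])+
qed

lemma W1_H_scale:
  assumes u: "u \<in> W1_H \<Omega> p q \<mu>"
  shows "(\<lambda>x. c * u x) \<in> W1_H \<Omega> p q \<mu>"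
    "AE x in lebesgue_on \<Omega>. weak_gradient \<Omega> (\<lambda>x. c * u x) x = c *\<^sub>R weak_gradient \<Omega> u x"
proof -
  have uL: "u \<in> L_H \<Omega> p q \<mu>" "(\<lambda>x. norm (weak_gradient \<Omega> u x)) \<in> L_H \<Omega> p q \<mu>"
    using u by (auto simp: W1_H_def)
  have "(\<lambda>x. norm (c *\<^sub>R weak_gradient \<Omega> u x)) \<in> L_H \<Omega> p q \<mu>"
    using L_H_scale[OF uL(2), of "\<bar>c\<bar>"] by simp
  then show "(\<lambda>x. c * u x) \<in> W1_H \<Omega> p q \<mu>"
    "AE x in lebesgue_on \<Omega>. weak_gradient \<Omega> (\<lambda>x. c * u x) x = c *\<^sub>R weak_gradient \<Omega> u x"
    using W1_H_intro[OF L_H_scale[OF uL(1)] has_weak_gradient_scale[OF W1_H_has_weak_gradient[OF u]]] by auto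
qed

text \<open>Approximation by test functions transfers the \<open>L\<^sup>1\<close> inequality to \<open>W\<^sub>0\<close>.\<close>

lemma L1_Poincare_W1_H_0:
  obtains C where "0 < C"
    "\<And>u l. u \<in> W1_H_0 \<Omega> p q \<mu> \<Longrightarrow> norm_H \<Omega> p q \<mu> (\<lambda>x. norm (weak_gradient \<Omega> u x)) < l \<Longrightarrow>
      (\<integral>\<^sup>+x. ennreal \<bar>u x\<bar> \<partial>lebesgue_on \<Omega>) \<le> ennreal (C * l)"
proof -
  obtain b :: 'a where b: "b \<in> Basis" using nonempty_Basis by blast
  obtain T where T: "0 < T" and P: "\<And>\<phi>. \<phi> \<in> test_functions \<Omega> \<Longrightarrow>
      (\<integral>\<^sup>+x. ennreal \<bar>\<phi> x\<bar> \<partial>lborel) \<le> ennreal T * (\<integral>\<^sup>+x. ennreal \<bar>partial_deriv b \<phi> x\<bar> \<partial>lborel)"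
    using L1_Poincare_test_function[OF bounded_\<Omega> b] by blast
  define C where "C = (1 + 2 * T) * (vol + 1)"
  have C: "0 < C" using T vol_nonneg unfolding C_def by (intro mult_pos_pos) auto
  have "(\<integral>\<^sup>+x. ennreal \<bar>u x\<bar> \<partial>lebesgue_on \<Omega>) \<le> ennreal (C * l)"
    if u0: "u \<in> W1_H_0 \<Omega> p q \<mu>" and nl: "norm_H \<Omega> p q \<mu> (\<lambda>x. norm (weak_gradient \<Omega> u x)) < l" for u l
  proof -
    let ?g = "weak_gradient \<Omega> u"
    have u: "u \<in> W1_H \<Omega> p q \<mu>" using u0 by (simp add: W1_H_0_def)
    then have gL: "(\<lambda>x. norm (?g x)) \<in> L_H \<Omega> p q \<mu>" by (simp add: W1_H_def)
    have l: "0 < l" and Jg: "J (\<lambda>x. norm (?g x) / l) \<le> 1"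
      using modular_le_1_of_norm_H_less[OF gL nl] by auto
    obtain \<phi> where \<phi>: "\<phi> \<in> test_functions \<Omega>" "norm_W1_H \<Omega> p q \<mu> (\<lambda>x. u x - \<phi> x) < l"
      using u0 l unfolding W1_H_0_def by blast
    let ?d = "weak_gradient \<Omega> (\<lambda>x. u x - \<phi> x)"
    note D = W1_H_diff_test_function[OF u \<phi>(1)]
    have "JW (\<lambda>x. u x - \<phi> x) l \<le> 1" by (rule JW_le_1_of_norm_less(2)[OF D(1) \<phi>(2)])
    then have Jd: "J (\<lambda>x. (u x - \<phi> x) / l) \<le> 1" "J (\<lambda>x. norm (?d x) / l) \<le> 1"
      by (auto elim: order_trans[rotated] intro: add_increasing add_increasing2)
    have m[measurable]: "u \<in> borel_measurable (lebesgue_on \<Omega>)" "\<phi> \<in> borel_measurable (lebesgue_on \<Omega>)"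
      "(\<lambda>x. norm (?g x)) \<in> borel_measurable (lebesgue_on \<Omega>)" "(\<lambda>x. norm (?d x)) \<in> borel_measurable (lebesgue_on \<Omega>)"
      using u D(1) test_function_L_H(1)[OF \<phi>(1)] by (auto simp: W1_H_def L_H_def)
    let ?V = "l * (vol + 1)"
    have V: "0 \<le> ?V" using l vol_nonneg by simp
    have I1: "(\<integral>\<^sup>+x. ennreal \<bar>u x - \<phi> x\<bar> \<partial>lebesgue_on \<Omega>) \<le> ennreal ?V"
      by (intro nn_integral_abs_le l Jd) measurable
    have I2: "(\<integral>\<^sup>+x. ennreal \<bar>norm (?d x)\<bar> \<partial>lebesgue_on \<Omega>) \<le> ennreal ?V"
      by (intro nn_integral_abs_le l Jd) measurable
    have I3: "(\<integral>\<^sup>+x. ennreal \<bar>norm (?g x)\<bar> \<partial>lebesgue_on \<Omega>) \<le> ennreal ?V"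
      by (intro nn_integral_abs_le l Jg) measurable
    have "(\<integral>\<^sup>+x. ennreal \<bar>partial_deriv b \<phi> x\<bar> \<partial>lborel) = (\<integral>\<^sup>+x. ennreal \<bar>partial_deriv b \<phi> x\<bar> * indicator \<Omega> x \<partial>lborel)"
      using test_function_zero_outside[OF partial_deriv_test_function[OF \<phi>(1) b]]
      by (intro nn_integral_cong) (auto simp: indicator_def)
    also have "\<dots> = (\<integral>\<^sup>+x. ennreal \<bar>partial_deriv b \<phi> x\<bar> \<partial>lebesgue_on \<Omega>)"
      by (rule nn_integral_lebesgue_on[OF \<Omega>_borel, symmetric])
    also have "\<dots> \<le> (\<integral>\<^sup>+x. ennreal \<bar>norm (?g x)\<bar> + ennreal \<bar>norm (?d x)\<bar> \<partial>lebesgue_on \<Omega>)"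
    proof (rule nn_integral_mono_AE, rule eventually_mono[OF D(2)])
      fix x assume d: "?d x = ?g x - gradient \<phi> x"
      have "\<bar>partial_deriv b \<phi> x\<bar> \<le> norm (gradient \<phi> x)"
        using Basis_le_norm[OF b, of "gradient \<phi> x"] by (simp add: gradient_inner[OF b])
      also have "gradient \<phi> x = ?g x - ?d x" using d by simp
      also have "norm (?g x - ?d x) \<le> norm (?g x) + norm (?d x)" by (rule norm_triangle_ineq4)
      finally show "ennreal \<bar>partial_deriv b \<phi> x\<bar> \<le> ennreal \<bar>norm (?g x)\<bar> + ennreal \<bar>norm (?d x)\<bar>"
        by (simp add: ennreal_leI flip: ennreal_plus)
    qed
    also have "\<dots> \<le> ennreal ?V + ennreal ?V"
    proof (subst nn_integral_add)
      show "(\<integral>\<^sup>+x. ennreal \<bar>norm (?g x)\<bar> \<partial>lebesgue_on \<Omega>) + (\<integral>\<^sup>+x. ennreal \<bar>norm (?d x)\<bar> \<partial>lebesgue_on \<Omega>)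
          \<le> ennreal ?V + ennreal ?V" by (rule add_mono[OF I3 I2])
    qed measurable
    finally have pd: "(\<integral>\<^sup>+x. ennreal \<bar>partial_deriv b \<phi> x\<bar> \<partial>lborel) \<le> ennreal ?V + ennreal ?V" .
    have "(\<integral>\<^sup>+x. ennreal \<bar>\<phi> x\<bar> \<partial>lebesgue_on \<Omega>) = (\<integral>\<^sup>+x. ennreal \<bar>\<phi> x\<bar> * indicator \<Omega> x \<partial>lborel)"
      by (rule nn_integral_lebesgue_on[OF \<Omega>_borel])
    also have "\<dots> \<le> (\<integral>\<^sup>+x. ennreal \<bar>\<phi> x\<bar> \<partial>lborel)"
      by (intro nn_integral_mono) (auto simp: indicator_def)
    also have "\<dots> \<le> ennreal T * (\<integral>\<^sup>+x. ennreal \<bar>partial_deriv b \<phi> x\<bar> \<partial>lborel)" by (rule P[OF \<phi>(1)])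
    also have "\<dots> \<le> ennreal T * (ennreal ?V + ennreal ?V)" using pd by (rule mult_left_mono) simp
    finally have I4: "(\<integral>\<^sup>+x. ennreal \<bar>\<phi> x\<bar> \<partial>lebesgue_on \<Omega>) \<le> ennreal T * (ennreal ?V + ennreal ?V)" .
    have "(\<integral>\<^sup>+x. ennreal \<bar>u x\<bar> \<partial>lebesgue_on \<Omega>) \<le> (\<integral>\<^sup>+x. ennreal \<bar>u x - \<phi> x\<bar> + ennreal \<bar>\<phi> x\<bar> \<partial>lebesgue_on \<Omega>)"
      by (intro nn_integral_mono) (auto simp flip: ennreal_plus)
    also have "\<dots> = (\<integral>\<^sup>+x. ennreal \<bar>u x - \<phi> x\<bar> \<partial>lebesgue_on \<Omega>) + (\<integral>\<^sup>+x. ennreal \<bar>\<phi> x\<bar> \<partial>lebesgue_on \<Omega>)"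
      by (rule nn_integral_add) measurable
    also have "\<dots> \<le> ennreal ?V + ennreal T * (ennreal ?V + ennreal ?V)" by (rule add_mono[OF I1 I4])
    also have "\<dots> = ennreal (?V + T * (?V + ?V))" 
      using V T by (simp only: ennreal_plus ennreal_mult add_nonneg_nonneg mult_nonneg_nonneg less_imp_le)
    also have "?V + T * (?V + ?V) = C * l" by (simp add: C_def algebra_simps)
    finally show ?thesis .
  qed
  with C show ?thesis by (rule that)
qed

text \<open>Applied to \<open>a = norm_H \<Omega> p q \<mu> u\<close>, this shows that a normalised function has norm at least one.\<close>

lemma norm_H_scale_ge:
  assumes u: "u \<in> L_H \<Omega> p q \<mu>" and a: "0 < a"
  shows "norm_H \<Omega> p q \<mu> u \<le> a * norm_H \<Omega> p q \<mu> (\<lambda>x. (1 / a) * u x)"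
proof -
  let ?w = "\<lambda>x. (1 / a) * u x"
  have "norm_H \<Omega> p q \<mu> u / a \<le> l" if l: "norm_H \<Omega> p q \<mu> ?w < l" for l
  proof -
    have "0 < l" "J (\<lambda>x. ?w x / l) \<le> 1"
      using modular_le_1_of_norm_H_less[OF L_H_scale[OF u] l] by auto
    then have "norm_H \<Omega> p q \<mu> u \<le> a * l"
      using a by (intro norm_H_le) (simp_all add: mult.commute)
    then show ?thesis using a by (simp add: field_simps)
  qed
  then have "norm_H \<Omega> p q \<mu> u / a \<le> norm_H \<Omega> p q \<mu> ?w" by (rule dense_ge)
  then show ?thesis using a by (simp add: field_simps)
qed

text \<open>Otherwise there are functions of norm one with gradients tending to zero. A subsequence
  converges by compactness, and its limit vanishes by the \<open>L\<^sup>1\<close> inequality: a contradiction.\<close>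

theorem Poincare_W1_H_0:
  "\<exists>C>0. \<forall>u\<in>W1_H_0 \<Omega> p q \<mu>.
     norm_H \<Omega> p q \<mu> u \<le> C * norm_H \<Omega> p q \<mu> (\<lambda>x. norm (weak_gradient \<Omega> u x))"
proof (rule ccontr)
  assume neg: "\<not> ?thesis"
  let ?n = "norm_H \<Omega> p q \<mu>"
  have "\<exists>u. u \<in> W1_H_0 \<Omega> p q \<mu> \<and> real (Suc n) * ?n (\<lambda>x. norm (weak_gradient \<Omega> u x)) < ?n u" for n
  proof -
    have "\<not> (\<forall>u\<in>W1_H_0 \<Omega> p q \<mu>. ?n u \<le> real (Suc n) * ?n (\<lambda>x. norm (weak_gradient \<Omega> u x)))"
      using neg by (metis of_nat_0_less_iff zero_less_Suc)
    then show ?thesis by (auto simp: not_le)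
  qed
  then obtain u where u0: "\<And>n. u n \<in> W1_H_0 \<Omega> p q \<mu>"
    and small: "\<And>n. real (Suc n) * ?n (\<lambda>x. norm (weak_gradient \<Omega> (u n) x)) < ?n (u n)" by metis
  have uW: "u n \<in> W1_H \<Omega> p q \<mu>" for n using u0 by (simp add: W1_H_0_def)
  then have uL: "u n \<in> L_H \<Omega> p q \<mu>" "(\<lambda>x. norm (weak_gradient \<Omega> (u n) x)) \<in> L_H \<Omega> p q \<mu>" for n
    by (auto simp: W1_H_def)
  define a where "a n = ?n (u n)" for n
  have a: "0 < a n" for n
  proof -
    have "0 \<le> real (Suc n) * ?n (\<lambda>x. norm (weak_gradient \<Omega> (u n) x))"
      by (intro mult_nonneg_nonneg norm_H_nonneg uL) simp
    then show ?thesis using small[of n] by (simp add: a_def)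
  qed
  have grad: "?n (\<lambda>x. norm (weak_gradient \<Omega> (u n) x)) < a n / real (Suc n)" for n
    using small[of n] by (simp add: a_def field_simps)
  define w where "w n x = (1 / a n) * u n x" for n x
  have wW: "w n \<in> W1_H \<Omega> p q \<mu>" for n unfolding w_def by (rule W1_H_scale(1)[OF uW])
  have wL: "w n \<in> L_H \<Omega> p q \<mu>" for n using wW by (simp add: W1_H_def)
  have w1: "1 \<le> ?n (w n)" for n
    using norm_H_scale_ge[OF uL(1)[of n] a[of n]] a[of n] unfolding w_def[abs_def] a_def by simp
  have quarter: "J (\<lambda>x. f x / 4) \<le> ennreal (1 / 2)"
    if "f \<in> borel_measurable (lebesgue_on \<Omega>)" and J2: "J (\<lambda>x. f x / 2) \<le> 1" for f
  proof -
    have "J (\<lambda>x. (1 / 2) * (f x / 2)) \<le> ennreal (1 / 2) * J (\<lambda>x. f x / 2)"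
      by (rule modular_contract) (use that in auto)
    also have "\<dots> \<le> ennreal (1 / 2) * 1" using J2 by (intro mult_left_mono) auto
    finally show ?thesis by simp
  qed
  \<comment> \<open>at scale two each of the two modulars is at most one, so at scale four their sum is\<close>
  have wB: "norm_W1_H \<Omega> p q \<mu> (w n) \<le> 4" for n
  proof -
    have g: "AE x in lebesgue_on \<Omega>. weak_gradient \<Omega> (w n) x = (1 / a n) *\<^sub>R weak_gradient \<Omega> (u n) x"
      unfolding w_def by (rule W1_H_scale(2)[OF uW])
    have "J (\<lambda>x. u n x / (2 * a n)) \<le> 1"
      using a[of n] by (intro modular_le_1_of_norm_H_less(2)[OF uL(1)]) (simp add: a_def)
    then have J1: "J (\<lambda>x. w n x / 2) \<le> 1" by (simp add: w_def mult.commute)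
    have "a n / real (Suc n) \<le> 2 * a n" using a[of n] by (simp add: field_simps)
    then have "J (\<lambda>x. norm (weak_gradient \<Omega> (u n) x) / (2 * a n)) \<le> 1"
      using grad[of n] by (intro modular_le_1_of_norm_H_less(2)[OF uL(2)]) linarith
    moreover have "J (\<lambda>x. norm (weak_gradient \<Omega> (w n) x) / 2) = J (\<lambda>x. norm (weak_gradient \<Omega> (u n) x) / (2 * a n))"
      by (rule modular_cong_AE, rule eventually_mono[OF g]) (use a[of n] in \<open>simp add: mult.commute\<close>)
    ultimately have J2: "J (\<lambda>x. norm (weak_gradient \<Omega> (w n) x) / 2) \<le> 1" by simp
    have m: "w n \<in> borel_measurable (lebesgue_on \<Omega>)" "(\<lambda>x. norm (weak_gradient \<Omega> (w n) x)) \<in> borel_measurable (lebesgue_on \<Omega>)"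
      using wW by (auto simp: W1_H_def L_H_def)
    have "JW (w n) 4 \<le> ennreal (1 / 2) + ennreal (1 / 2)"
      by (intro add_mono quarter m J1 J2)
    also have "\<dots> = ennreal (1 / 2 + 1 / 2)" by (rule ennreal_plus[symmetric]) auto
    finally have "JW (w n) 4 \<le> 1" by simp
    then show ?thesis unfolding norm_W1_H_eq by (intro Luxemburg_le) simp_all
  qed
  obtain v k where v: "v \<in> L_H \<Omega> p q \<mu>" and k: "strict_mono k"
    and conv: "(\<lambda>n. ?n (\<lambda>x. w (k n) x - v x)) \<longlonglongrightarrow> 0"
    using bounded_sequence_has_convergent_subsequence[of w 4, OF wW wB] by blast
  obtain C where C: "0 < C" and P: "\<And>u l. u \<in> W1_H_0 \<Omega> p q \<mu> \<Longrightarrow>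
      ?n (\<lambda>x. norm (weak_gradient \<Omega> u x)) < l \<Longrightarrow> (\<integral>\<^sup>+x. ennreal \<bar>u x\<bar> \<partial>lebesgue_on \<Omega>) \<le> ennreal (C * l)"
    by (rule L1_Poincare_W1_H_0) blast
  have [measurable]: "v \<in> borel_measurable (lebesgue_on \<Omega>)" "\<And>n. w n \<in> borel_measurable (lebesgue_on \<Omega>)"
     "\<And>n. u n \<in> borel_measurable (lebesgue_on \<Omega>)"
    using v wL uL by (auto simp: L_H_def)
  have w_small: "(\<integral>\<^sup>+x. ennreal \<bar>w n x\<bar> \<partial>lebesgue_on \<Omega>) \<le> ennreal (C / real (Suc n))" for n
  proof -
    have "(\<integral>\<^sup>+x. ennreal \<bar>w n x\<bar> \<partial>lebesgue_on \<Omega>) = (\<integral>\<^sup>+x. ennreal (1 / a n) * ennreal \<bar>u n x\<bar> \<partial>lebesgue_on \<Omega>)"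
      using a[of n] by (intro nn_integral_cong) (simp add: w_def abs_mult flip: ennreal_mult)
    also have "\<dots> = ennreal (1 / a n) * (\<integral>\<^sup>+x. ennreal \<bar>u n x\<bar> \<partial>lebesgue_on \<Omega>)"
      by (rule nn_integral_cmult) measurable
    also have "\<dots> \<le> ennreal (1 / a n) * ennreal (C * (a n / real (Suc n)))"
      by (intro mult_left_mono P u0 grad) simp
    also have "\<dots> = ennreal (C / real (Suc n))"
      using a[of n] C by (subst ennreal_mult[symmetric]) auto
    finally show ?thesis .
  qed
  have v_small: "(\<integral>\<^sup>+x. ennreal \<bar>v x\<bar> \<partial>lebesgue_on \<Omega>) \<le> ennreal c" if c: "0 < c" for c
  proof -
    define l where "l = c / 2 / (vol + 1)"
    have l: "0 < l" "l * (vol + 1) = c / 2" 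
    proof -
      have "0 < vol + 1" using vol_nonneg by simp
      then show "0 < l" using c by (simp add: l_def)
      show "l * (vol + 1) = c / 2"
        using \<open>0 < vol + 1\<close> by (intro iffD1[OF nonzero_eq_divide_eq l_def]) simp
    qed
    have "\<forall>\<^sub>F n in sequentially. ?n (\<lambda>x. w (k n) x - v x) < l"
      using l(1) by (rule order_tendstoD(2)[OF conv])
    moreover have "(\<lambda>n. C / real (Suc n)) \<longlonglongrightarrow> 0" by (rule LIMSEQ_Suc[OF lim_const_over_n])
    then have "\<forall>\<^sub>F n in sequentially. C / real (Suc n) < c / 2" using c by (intro order_tendstoD(2)) auto
    ultimately have "\<forall>\<^sub>F n in sequentially. ?n (\<lambda>x. w (k n) x - v x) < l \<and> C / real (Suc n) < c / 2"
      by eventually_elim simp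
    then obtain n where n: "?n (\<lambda>x. w (k n) x - v x) < l" "C / real (Suc n) < c / 2"
      by (auto simp: eventually_sequentially)
    have "(\<lambda>x. w (k n) x - v x) \<in> L_H \<Omega> p q \<mu>"
    proof (rule L_H_dominated[OF wL[of "k n"] v])
      show "AE x in lebesgue_on \<Omega>. \<bar>w (k n) x - v x\<bar> \<le> \<bar>w (k n) x\<bar> + \<bar>v x\<bar>"
        by (intro always_eventually allI abs_triangle_ineq4)
    qed measurable
    then have "J (\<lambda>x. (w (k n) x - v x) / l) \<le> 1" using n(1) by (rule modular_le_1_of_norm_H_less(2))
    then have d: "(\<integral>\<^sup>+x. ennreal \<bar>w (k n) x - v x\<bar> \<partial>lebesgue_on \<Omega>) \<le> ennreal (c / 2)"
      using nn_integral_abs_le[of "\<lambda>x. w (k n) x - v x" l] l by simp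
    have "C / real (Suc (k n)) \<le> C / real (Suc n)"
      using C seq_suble[OF k, of n] by (intro divide_left_mono) auto
    then have w': "(\<integral>\<^sup>+x. ennreal \<bar>w (k n) x\<bar> \<partial>lebesgue_on \<Omega>) \<le> ennreal (c / 2)"
      using n(2) by (intro order_trans[OF w_small] ennreal_leI) linarith
    have "(\<integral>\<^sup>+x. ennreal \<bar>v x\<bar> \<partial>lebesgue_on \<Omega>) \<le>
       (\<integral>\<^sup>+x. ennreal \<bar>w (k n) x - v x\<bar> + ennreal \<bar>w (k n) x\<bar> \<partial>lebesgue_on \<Omega>)"
      by (intro nn_integral_mono) (auto simp flip: ennreal_plus)
    also have "\<dots> = (\<integral>\<^sup>+x. ennreal \<bar>w (k n) x - v x\<bar> \<partial>lebesgue_on \<Omega>) + (\<integral>\<^sup>+x. ennreal \<bar>w (k n) x\<bar> \<partial>lebesgue_on \<Omega>)"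
      by (rule nn_integral_add) measurable
    also have "\<dots> \<le> ennreal (c / 2) + ennreal (c / 2)" by (rule add_mono[OF d w'])
    also have "\<dots> = ennreal c" using c by (subst ennreal_plus[symmetric]) auto
    finally show ?thesis .
  qed
  have "(\<integral>\<^sup>+x. ennreal \<bar>v x\<bar> \<partial>lebesgue_on \<Omega>) \<le> 0"
  proof (rule ennreal_le_epsilon)
    show "(\<integral>\<^sup>+x. ennreal \<bar>v x\<bar> \<partial>lebesgue_on \<Omega>) \<le> 0 + ennreal c" if "0 < c" for c
      using v_small[OF that] by simp
  qed
  then have "AE x in lebesgue_on \<Omega>. v x = 0"
    by (simp add: nn_integral_0_iff_AE)
  then have "AE x in lebesgue_on \<Omega>. w (k n) x - v x = w (k n) x" for n
    by (rule eventually_mono) simp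
  then have "?n (\<lambda>x. w (k n) x - v x) = ?n (w (k n))" for n by (rule norm_H_cong_AE)
  then have "(\<lambda>n. ?n (w (k n))) \<longlonglongrightarrow> 0" using conv by simp
  then have "1 \<le> (0::real)" by (rule LIMSEQ_le_const) (use w1 in auto)
  then show False by simp
qed

end

theorem proposition3p9:
  fixes \<Omega> :: "'a::euclidean_space set" and p q \<mu> :: "'a \<Rightarrow> real"
  assumes "DIM('a) \<ge> 2"
    and "bounded_lipschitz_domain \<Omega>"
    and "p \<in> C_plus (closure \<Omega>)" and "q \<in> C_plus (closure \<Omega>)"
    and "\<And>x. x \<in> closure \<Omega> \<Longrightarrow> p x \<le> q x \<and> ereal (q x) < crit_exponent p x"
    and "\<mu> \<in> L_infty \<Omega>" and "AE x in lebesgue_on \<Omega>. 0 \<le> \<mu> x"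
  shows "compact_embedding (W1_H \<Omega> p q \<mu>) (norm_W1_H \<Omega> p q \<mu>) (L_H \<Omega> p q \<mu>) (norm_H \<Omega> p q \<mu>) \<and>
    (\<exists>C>0. \<forall>u\<in>W1_H_0 \<Omega> p q \<mu>.
       norm_H \<Omega> p q \<mu> u \<le> C * norm_H \<Omega> p q \<mu> (\<lambda>x. norm (weak_gradient \<Omega> u x)))"
proof -
  interpret log_double_phase \<Omega> p q \<mu> by unfold_locales fact+
  show ?thesis using compact_embedding_W1_H Poincare_W1_H_0 by blast
qed

end
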